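(* Let $\hat\beta^{(\varepsilon)}=\{\hat\beta^{(\varepsilon)}_{jk}\}$ be the wavelet general empirical Bayes (GEB) estimator defined in the context, with positive constants $(j_*,\rho_0,b_0)$. Let $0<\alpha<\infty$, $1/(\alpha+1/2)<p\le\infty$ and $0<q<\infty$. Then $$\lim_{\varepsilon\to0+}\varepsilon^{-2\alpha/(\alpha+1/2)}R^{(\varepsilon)}(\hat\beta^{(\varepsilon)},\beta)=0\qquad\text{for every }\beta\text{ with }\|\beta\|^\alpha_{p,q}<\infty,$$ and for every $\|\cdot\|^\alpha_{p,q}$-compact set $B$, $$\lim_{\varepsilon\to0+}\varepsilon^{-2\alpha/(\alpha+1/2)}\sup\{R^{(\varepsilon)}(\hat\beta^{(\varepsilon)},\beta):\beta\in B\}=0.$$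
   Context: Model: $y_{jk}=\beta_{jk}+\varepsilon z_{jk}$, $1\le k\le\max(2^j,1)$, $j=-1,0,1,\dots$, with $\varepsilon>0$ known, $z_{jk}$ i.i.d. $N(0,1)$; $\beta$ deterministic; $E^{(\varepsilon)}_\beta$ is the expectation. Risk: $R^{(\varepsilon)}(\hat\beta,\beta)\equiv\sum_{j=-1}^\infty\sum_{k=1}^{2^j\vee1}E_\beta^{(\varepsilon)}(\hat\beta_{jk}-\beta_{jk})^2$. Besov (quasi-)norm: $$\|\beta\|^\alpha_{p,q}\equiv\Big[|\beta_{-1,1}|^q+\sum_{j=0}^\infty\Big(2^{j(\alpha+1/2-1/p)}\Big(\sum_{k=1}^{2^j}|\beta_{jk}|^p\Big)^{1/p}\Big)^q\Big]^{1/q}$$ (usual modification if $p=\infty$); compactness of $B$ is in the space $\{\beta:\|\beta\|^\alpha_{p,q}<\infty\}$ with the topology given by $\|\beta-\beta'\|^\alpha_{p,q}$. GEB estimator: fix constants $n_*>2$, $\rho_0>0$, $b_0>0$ and $\eta_n\to0$; let $j_*$ be the largest integer with $2^{j_*}\le n_*$, $\rho(n)=(1+\eta_n)\rho_0\sqrt{2(\log n)/n}>0$, $b(n)=b_0(\log n)/\sqrt n$. Put $\hat\beta^{(\varepsilon)}_{jk}=y_{jk}$ for $j<j_*$ and $\hat\beta^{(\varepsilon)}_{jk}=\varepsilon\,\hat t_{[j]}(y_{jk}/\varepsilon)$ for $j\ge j_*$, where with $n_j=2^j$, $$\hat t_{[j]}(x)\equiv\begin{cases}x+\hat\varphi_{[j]}'(x)/\max\{\rho(n_j),\hat\varphi_{[j]}(x)\},&\hat\kappa_{[j]}>b(n_j),\\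 \operatorname{sgn}(x)(|x|-\sqrt{2\log n_j})^+,&\hat\kappa_{[j]}\le b(n_j),\end{cases}$$ $$\hat\varphi_{[j]}(x)\equiv\frac{\sqrt{2\log n_j}}{n_j}\sum_{k=1}^{2^j}K\big(\sqrt{2\log n_j}(x-y_{jk}/\varepsilon)\big),\quad K(x)\equiv\frac{\sin x}{\pi x},\qquad\hat\kappa_{[j]}\equiv1-\frac{\sqrt2}{n_j}\sum_{k=1}^{2^j}e^{-(y_{jk}/\varepsilon)^2/2}.$$ *)

theory Defs
  imports "HOL-Probability.Probability"
begin

section \<open>Coefficient arrays and Besov quasi-norms\<close>

text \<open>
  A wavelet coefficient array is indexed by a resolution level \<open>j \<ge> -1\<close> and a location
  \<open>1 \<le> k \<le> max (2 ^ j) 1\<close>.  Since \<open>nat (-1) = 0\<close>, the expression \<open>2 ^ nat j\<close> is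
  \<open>max (2 ^ j) 1\<close> for all these levels.
\<close>

type_synonym coefs = "int \<Rightarrow> nat \<Rightarrow> real"

definition level_size :: "int \<Rightarrow> nat" where
  "level_size j = 2 ^ nat j"

definition coef_index :: "(int \<times> nat) set" where
  "coef_index = {(j, k). - 1 \<le> j \<and> 1 \<le> k \<and> k \<le> level_size j}"

definition lp_block :: "ereal \<Rightarrow> nat \<Rightarrow> (nat \<Rightarrow> real) \<Rightarrow> real" where
  "lp_block p n u =
     (if p = \<infinity> then Max ((\<lambda>k. \<bar>u k\<bar>) ` {1..n})
      else (\<Sum>k=1..n. \<bar>u k\<bar> powr real_of_ereal p) powr (1 / real_of_ereal p))"

definition besov_sum :: "real \<Rightarrow> ereal \<Rightarrow> real \<Rightarrow> coefs \<Rightarrow> ennreal" where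
  "besov_sum \<alpha> p q \<beta> =
     ennreal (\<bar>\<beta> (- 1) 1\<bar> powr q) +
     (\<Sum>j. ennreal ((2 powr (real j * (\<alpha> + 1/2 - real_of_ereal (1 / p))) *
                     lp_block p (2 ^ j) (\<beta> (int j))) powr q))"

text \<open>The \<open>q\<close>-th root of \<open>besov_sum\<close>, extended by \<open>\<infinity>\<close>; the library has no power function with
  real exponents on \<open>ennreal\<close>.\<close>

definition besov_norm :: "real \<Rightarrow> ereal \<Rightarrow> real \<Rightarrow> coefs \<Rightarrow> ennreal" where
  "besov_norm \<alpha> p q \<beta> =
     (if besov_sum \<alpha> p q \<beta> = \<infinity> then \<infinity>
      else ennreal (enn2real (besov_sum \<alpha> p q \<beta>) powr (1 / q)))"

text \<open>The arrays are total functions; their irrelevant values outside \<open>coef_index\<close> are set to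
  zero, so that only the zero array has zero quasi-norm.\<close>

definition besov_space :: "real \<Rightarrow> ereal \<Rightarrow> real \<Rightarrow> coefs set" where
  "besov_space \<alpha> p q =
     {\<beta>. (\<forall>j k. (j, k) \<notin> coef_index \<longrightarrow> \<beta> j k = 0) \<and> besov_norm \<alpha> p q \<beta> < \<infinity>}"

text \<open>For \<open>p < 1\<close> or \<open>q < 1\<close> the quasi-norm does not satisfy the triangle inequality, so the
  topology is given by its open sets instead of via a metric type or \<open>Metric_space\<close>.\<close>

definition besov_open :: "real \<Rightarrow> ereal \<Rightarrow> real \<Rightarrow> coefs set \<Rightarrow> bool" where
  "besov_open \<alpha> p q U \<longleftrightarrow>
     U \<subseteq> besov_space \<alpha> p q \<and>
     (\<forall>\<beta>\<in>U. \<exists>r>0. \<forall>\<beta>'\<in>besov_space \<alpha> p q.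
        besov_norm \<alpha> p q (\<lambda>j k. \<beta>' j k - \<beta> j k) < r \<longrightarrow> \<beta>' \<in> U)"

definition besov_topology :: "real \<Rightarrow> ereal \<Rightarrow> real \<Rightarrow> coefs topology" where
  "besov_topology \<alpha> p q = topology (besov_open \<alpha> p q)"

lemma istopology_besov_open: "istopology (besov_open \<alpha> p q)"
  unfolding istopology_def
proof (intro conjI allI impI)
  fix S T assume S: "besov_open \<alpha> p q S" and T: "besov_open \<alpha> p q T"
  show "besov_open \<alpha> p q (S \<inter> T)"
    unfolding besov_open_def
  proof (intro conjI ballI)
    show "S \<inter> T \<subseteq> besov_space \<alpha> p q"
      using S by (auto simp: besov_open_def)
    fix \<beta> assume "\<beta> \<in> S \<inter> T"
    then obtain r s where r: "r > 0" "\<forall>\<beta>'\<in>besov_space \<alpha> p q.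
          besov_norm \<alpha> p q (\<lambda>j k. \<beta>' j k - \<beta> j k) < r \<longrightarrow> \<beta>' \<in> S"
      and s: "s > 0" "\<forall>\<beta>'\<in>besov_space \<alpha> p q.
          besov_norm \<alpha> p q (\<lambda>j k. \<beta>' j k - \<beta> j k) < s \<longrightarrow> \<beta>' \<in> T"
      using S T unfolding besov_open_def by blast
    then show "\<exists>r>0. \<forall>\<beta>'\<in>besov_space \<alpha> p q.
          besov_norm \<alpha> p q (\<lambda>j k. \<beta>' j k - \<beta> j k) < r \<longrightarrow> \<beta>' \<in> S \<inter> T"
      by (intro exI[of _ "min r s"]) auto
  qed
next
  fix \<K> assume "\<forall>K\<in>\<K>. besov_open \<alpha> p q K"
  then show "besov_open \<alpha> p q (\<Union> \<K>)"
    unfolding besov_open_def by (meson Sup_least Union_iff)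
qed

lemma openin_besov_topology: "openin (besov_topology \<alpha> p q) U \<longleftrightarrow> besov_open \<alpha> p q U"
  by (simp add: besov_topology_def istopology_besov_open topology_inverse')

lemma topspace_besov_topology: "topspace (besov_topology \<alpha> p q) = besov_space \<alpha> p q"
proof -
  have "besov_open \<alpha> p q (besov_space \<alpha> p q)"
    unfolding besov_open_def using zero_less_one by blast
  then show ?thesis
    unfolding topspace_def openin_besov_topology by (auto simp: besov_open_def)
qed


section \<open>Gaussian sequence model and risk\<close>

definition observation :: "(int \<Rightarrow> nat \<Rightarrow> 'w \<Rightarrow> real) \<Rightarrow> real \<Rightarrow> coefs \<Rightarrow> 'w \<Rightarrow> coefs" where
  "observation z \<epsilon> \<beta> \<omega> = (\<lambda>j k. \<beta> j k + \<epsilon> * z j k \<omega>)"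

text \<open>An estimator maps the observed array to an array of estimated coefficients.  The outer sum
  runs over the levels \<open>j = int i - 1 = -1, 0, 1, \<dots>\<close>.\<close>

definition risk ::
    "'w measure \<Rightarrow> (int \<Rightarrow> nat \<Rightarrow> 'w \<Rightarrow> real) \<Rightarrow> real \<Rightarrow> (coefs \<Rightarrow> coefs) \<Rightarrow> coefs \<Rightarrow> ennreal" where
  "risk M z \<epsilon> \<delta> \<beta> =
     (\<Sum>i. let j = int i - 1 in
        \<Sum>k=1..level_size j.
          \<integral>\<^sup>+\<omega>. ennreal ((\<delta> (observation z \<epsilon> \<beta> \<omega>) j k - \<beta> j k)\<^sup>2) \<partial>M)"


section \<open>The general empirical Bayes estimator\<close>

text \<open>\<open>sinc\<close> is the library's \<open>sin x / x\<close> with value \<open>1\<close> at \<open>0\<close>.\<close>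

definition sinc_kernel :: "real \<Rightarrow> real" where
  "sinc_kernel x = sinc x / pi"

text \<open>In the following definitions \<open>n\<close> is the size \<open>n\<^sub>j\<close> of a level and \<open>u k\<close>, for
  \<open>1 \<le> k \<le> n\<close>, are the standardized observations \<open>y\<^sub>j\<^sub>k / \<epsilon>\<close> of that level.\<close>

definition geb_density :: "nat \<Rightarrow> (nat \<Rightarrow> real) \<Rightarrow> real \<Rightarrow> real" where
  "geb_density n u x =
     sqrt (2 * ln (real n)) / real n *
       (\<Sum>k=1..n. sinc_kernel (sqrt (2 * ln (real n)) * (x - u k)))"

definition geb_kappa :: "nat \<Rightarrow> (nat \<Rightarrow> real) \<Rightarrow> real" where
  "geb_kappa n u = 1 - sqrt 2 / real n * (\<Sum>k=1..n. exp (- (u k)\<^sup>2 / 2))"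

definition geb_rho :: "(nat \<Rightarrow> real) \<Rightarrow> real \<Rightarrow> nat \<Rightarrow> real" where
  "geb_rho \<eta> \<rho>\<^sub>0 n = (1 + \<eta> n) * \<rho>\<^sub>0 * sqrt (2 * ln (real n) / real n)"

definition geb_b :: "real \<Rightarrow> nat \<Rightarrow> real" where
  "geb_b b\<^sub>0 n = b\<^sub>0 * ln (real n) / sqrt (real n)"

definition soft_threshold :: "real \<Rightarrow> real \<Rightarrow> real" where
  "soft_threshold t x = sgn x * max (\<bar>x\<bar> - t) 0"

definition geb_rule ::
    "(nat \<Rightarrow> real) \<Rightarrow> real \<Rightarrow> real \<Rightarrow> nat \<Rightarrow> (nat \<Rightarrow> real) \<Rightarrow> real \<Rightarrow> real" where
  "geb_rule \<eta> \<rho>\<^sub>0 b\<^sub>0 n u x =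
     (if geb_kappa n u > geb_b b\<^sub>0 n
      then x + deriv (geb_density n u) x / max (geb_rho \<eta> \<rho>\<^sub>0 n) (geb_density n u x)
      else soft_threshold (sqrt (2 * ln (real n))) x)"

definition j_star :: "real \<Rightarrow> int" where
  "j_star n\<^sub>s = (GREATEST j. 2 powi j \<le> n\<^sub>s)"

definition geb_estimator ::
    "real \<Rightarrow> (nat \<Rightarrow> real) \<Rightarrow> real \<Rightarrow> real \<Rightarrow> real \<Rightarrow> coefs \<Rightarrow> coefs" where
  "geb_estimator n\<^sub>s \<eta> \<rho>\<^sub>0 b\<^sub>0 \<epsilon> y = (\<lambda>j k.
     if j < j_star n\<^sub>s then y j k
     else \<epsilon> * geb_rule \<eta> \<rho>\<^sub>0 b\<^sub>0 (level_size j) (\<lambda>k. y j k / \<epsilon>) (y j k / \<epsilon>))"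

end

theory Submission
  imports Defs "HOL-Real_Asymp.Real_Asymp"
begin

text \<open>
  After division by \<open>\<epsilon>\<close>, level \<open>j\<close> is a compound decision problem with \<open>n = 2 ^ j\<close> unit-variance Gaussian
  observations with means \<open>\<theta>\<close>, and the total of the level risks must be of smaller order than
  \<open>N = \<epsilon> powr (- 1 / (\<alpha> + 1/2))\<close>.  Freezing one observation makes the kernel estimate a sum of independent
  bounded variables.  Its bias is negligible, since the Fourier transform of the kernel is an indicator
  and that of the Gaussian is tiny beyond \<open>sqrt (2 * ln n)\<close>; so, up to an error that is a negative power of \<open>n\<close>, the rule is as
  good as the Bayes rule for the empirical distribution of \<open>\<theta>\<close>, which in turn beats every soft threshold.
  Hoeffding's inequality for \<open>geb_kappa\<close> shows that very sparse levels are soft-thresholded at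
  \<open>sqrt (2 * ln n)\<close>, with a risk at \<open>\<theta> = 0\<close> that is summable over all levels.

  This gives three bounds for the risk of a level, for \<open>n\<close> much smaller than, comparable to, and much
  larger than \<open>N\<close>.  Since \<open>q < \<infinity>\<close>, the weighted block norms of \<open>\<beta>\<close> tend to \<open>0\<close>, uniformly on compact
  sets, so that the levels with \<open>n\<close> comparable to \<open>N\<close> contribute only \<open>o(N)\<close>.
\<close>

section \<open>Gaussian integrals and the kernel\<close>

text \<open>The limit is \<open>0\<close> and no sharp constant is at stake, so every inequality may
  lose a fixed factor, and \<mu> may be weakened to \<open>\<mu> powr (1 - g)\<close>. The obstacle
  is summation over infinitely many levels. An error of order \<open>sqrt n\<close> is harmless
  while \<open>n\<close> is near \<open>N\<close> and fatal beyond: far out, each error must be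
  either controlled by a moment of the level or summable in \<open>j\<close> uniformly in
  \<epsilon>. The test on \<open>geb_kappa\<close> achieves this. Where it may well choose the
  empirical Bayes rule, the sparsity is at least of order \<open>1 / sqrt n\<close>, so the
  stochastic error of the kernel estimate is paid for by the sparsity itself; elsewhere soft
  thresholding costs a multiple of the sparsity plus \<open>8 / bw n ^ 3\<close>, which is of order
  \<open>j powr (- 3/2)\<close>. The condition on \<open>p\<close> enters as \<open>s > 1\<close>
  for \<open>s = min p 2 * (\<alpha> + 1/2)\<close>: in units of \<epsilon> the absolute moment of
  order \<open>min p 2\<close> of a level is at most a constant times
  \<open>(n / N) powr (- s)\<close>, and \<open>n\<close> times this must decay beyond
  \<open>N\<close>. Near \<open>N\<close> it is the constant that is small.\<close>

lemma integrable_std_normal_bounded: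
  fixes g :: "real \<Rightarrow> real"
  assumes [measurable]: "g \<in> borel_measurable borel" and "\<And>x. \<bar>g x\<bar> \<le> C"
  shows "integrable lborel (\<lambda>x. std_normal_density x * g x)"
proof (rule Bochner_Integration.integrable_bound)
  show "integrable lborel (\<lambda>x. C * std_normal_density x)" by simp
  have "std_normal_density x * \<bar>g x\<bar> \<le> std_normal_density x * C" for x
    by (intro mult_left_mono assms(2)) auto
  then have "\<bar>std_normal_density x * g x\<bar> \<le> \<bar>C * std_normal_density x\<bar>" for x
    by (simp add: abs_mult mult.commute[of C]) (meson abs_ge_self mult_left_mono normal_density_nonneg order_trans)
  then show "AE x in lborel. norm (std_normal_density x * g x) \<le> norm (C * std_normal_density x)"
    by auto
qed simp

text \<open>Real and imaginary parts of the characteristic function of the standard normal law,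
  which is real-valued.\<close>

lemma std_normal_cos: "(\<integral>x. std_normal_density x * cos (u * x) \<partial>lborel) = exp (- (u\<^sup>2) / 2)"
  and std_normal_sin: "(\<integral>x. std_normal_density x * sin (u * x) \<partial>lborel) = 0"
proof -
  interpret real_distribution std_normal_distribution
    by (rule real_dist_normal_dist)
  have i: "integrable std_normal_distribution (\<lambda>x. iexp (u * x))"
    by (intro integrable_const_bound[where B=1]) auto
  have "char std_normal_distribution u = complex_of_real (exp (- (u\<^sup>2) / 2))"
    by (simp add: char_std_normal_distribution)
  then have c: "(CLINT x|std_normal_distribution. iexp (u * x)) = complex_of_real (exp (- (u\<^sup>2) / 2))"
    by (simp add: char_def)
  have "(\<integral>x. Re (iexp (u * x)) \<partial>std_normal_distribution) = exp (- (u\<^sup>2) / 2)"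
    using integral_Re[OF i] c by (simp del: of_real_exp)
  then show "(\<integral>x. std_normal_density x * cos (u * x) \<partial>lborel) = exp (- (u\<^sup>2) / 2)"
    by (subst (asm) integral_density) (auto simp: Re_exp)
  have "(\<integral>x. Im (iexp (u * x)) \<partial>std_normal_distribution) = 0"
    using integral_Im[OF i] c by (simp del: of_real_exp)
  then show "(\<integral>x. std_normal_density x * sin (u * x) \<partial>lborel) = 0"
    by (subst (asm) integral_density) (auto simp: Im_exp)
qed

lemma DERIV_std_normal_density:
  "(std_normal_density has_real_derivative - x * std_normal_density x) (at x)"
  unfolding std_normal_density_def by (auto intro!: derivative_eq_intros simp: field_simps)

lemma std_normal_le_1: "std_normal_density x \<le> 1"
proof -
  have "1 \<le> sqrt (2 * pi)" using pi_gt3 by (simp add: real_le_rsqrt)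
  then have "1 / sqrt (2*pi) \<le> 1" by simp
  moreover have "exp (- x\<^sup>2/2) \<le> 1" by simp
  ultimately show ?thesis unfolding std_normal_density_def by (meson mult_le_one exp_ge_zero)
qed

text \<open>Integration by parts: \<open>F\<close> vanishes at both infinities, and its derivative
  \<open>f\<close> differs from the integrand by a multiple of the cosine integrand of
  \<open>std_normal_cos\<close>.\<close>

lemma std_normal_x_sin:
  "(\<integral>x. std_normal_density x * (x * sin (u * x)) \<partial>lborel) = u * exp (- (u\<^sup>2) / 2)"
proof -
  define F where "F x = - sin (u * x) * std_normal_density x" for x :: real
  define f where "f x = std_normal_density x * (x * sin (u * x)) - u * (std_normal_density x * cos (u * x))" for x :: real
  have i1: "integrable lborel (\<lambda>x. std_normal_density x * (x * sin (u * x)))"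
  proof (rule Bochner_Integration.integrable_bound)
    show "integrable lborel (\<lambda>x. std_normal_density x * \<bar>x\<bar>^1)"
      by (rule integrable_std_normal_moment_abs)
    have "\<bar>x\<bar> * \<bar>sin (u * x)\<bar> \<le> \<bar>x\<bar>" for x :: real
      by (simp add: mult_left_le)
    then show "AE x in lborel. norm (std_normal_density x * (x * sin (u * x))) \<le> norm (std_normal_density x * \<bar>x\<bar>^1)"
      by (auto simp: abs_mult intro!: mult_left_mono)
  qed simp
  have i2: "integrable lborel (\<lambda>x. std_normal_density x * cos (u * x))"
    by (rule integrable_std_normal_bounded[where C=1]) auto
  have lim: "(std_normal_density \<longlongrightarrow> 0) at_top" "(std_normal_density \<longlongrightarrow> 0) at_bot"
    unfolding std_normal_density_def by real_asymp+
  have "interval_lebesgue_integral lborel (-\<infinity>) \<infinity> f = 0 - 0"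
  proof (rule interval_integral_FTC_integrable)
    show "(F has_vector_derivative f x) (at x)" for x
      unfolding F_def f_def has_real_derivative_iff_has_vector_derivative[symmetric]
      by (auto intro!: derivative_eq_intros DERIV_std_normal_density simp: algebra_simps)
    show "isCont f x" for x
      unfolding f_def std_normal_density_def by (intro continuous_intros) auto
    show "set_integrable lborel (einterval (- \<infinity>) \<infinity>) f"
      unfolding set_integrable_def f_def using i1 i2 by (auto simp: einterval_def)
    have F: "\<bar>F x\<bar> \<le> std_normal_density x" for x
      unfolding F_def by (simp add: abs_mult mult_right_le_one_le mult_left_le_one_le)
    have a: "(F \<longlongrightarrow> 0) at_top" "(F \<longlongrightarrow> 0) at_bot"
      using F by (auto intro!: Lim_null_comparison[OF always_eventually lim(1)] Lim_null_comparison[OF always_eventually lim(2)])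
    show "((F \<circ> real_of_ereal) \<longlongrightarrow> 0) (at_right (- \<infinity>))" "((F \<circ> real_of_ereal) \<longlongrightarrow> 0) (at_left \<infinity>)"
      using a by (auto simp: ereal_tendsto_simps1)
  qed auto
  then have "(\<integral>x. f x \<partial>lborel) = 0"
    by (simp add: interval_lebesgue_integral_def set_lebesgue_integral_def)
  then show ?thesis
    unfolding f_def using i1 i2 by (simp add: std_normal_cos)
qed

section \<open>The sinc kernel in the Fourier domain and its bias for Gaussian data\<close>

definition kern :: "real \<Rightarrow> real \<Rightarrow> real" where
  "kern L t = integral {-L..L} (\<lambda>u. cos (u * t)) / (2 * pi)"

definition kern' :: "real \<Rightarrow> real \<Rightarrow> real" where
  "kern' L t = - integral {-L..L} (\<lambda>u. u * sin (u * t)) / (2 * pi)"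

text \<open>Ties the Fourier form to the kernel of the estimator. The Fourier form has no
  exceptional point \<open>t = 0\<close>, is differentiated under the integral, and turns the bias
  into a truncation error.\<close>

lemma kern_eq_sinc:
  assumes "L > 0" shows "kern L t = L * sinc_kernel (L * t)"
proof (cases "t = 0")
  case True
  then show ?thesis using assms by (simp add: kern_def sinc_kernel_def)
next
  case False
  have "((\<lambda>u. cos (u * t)) has_integral (sin (L * t) / t - sin (- L * t) / t)) {-L..L}"
    using assms False
    by (intro fundamental_theorem_of_calculus)
      (auto intro!: derivative_eq_intros simp flip: has_real_derivative_iff_has_vector_derivative)
  then show ?thesis
    using assms False by (simp add: kern_def sinc_kernel_def integral_unique)
qed

lemma DERIV_kern: "(kern L has_real_derivative kern' L t) (at t)"
proof -
  have "((\<lambda>t. integral (cbox (-L) L) (\<lambda>u. cos (u * t))) has_field_derivative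
      integral (cbox (-L) L) (\<lambda>u. - (u * sin (u * t)))) (at t within UNIV)"
    by (rule leibniz_rule_field_derivative[where U=UNIV and f="\<lambda>t u. cos (u*t)" and fx="\<lambda>t u. - (u * sin (u * t))"])
      (auto intro!: derivative_eq_intros integrable_continuous_interval continuous_intros simp: split_beta)
  then show ?thesis
    unfolding kern_def[abs_def] kern'_def by (auto intro!: derivative_eq_intros)
qed

lemma kern_eq_lborel:
  assumes "L > 0"
  shows "kern L t = (\<integral>u. indicator {-L..L} u * cos (u * t) \<partial>lborel) / (2 * pi)"
proof -
  have "(LINT u:{-L..L}|lborel. cos (u * t)) = integral {-L..L} (\<lambda>u. cos (u * t))"
    by (intro set_borel_integral_eq_integral borel_integrable_atLeastAtMost' continuous_intros)
  then show ?thesis by (simp add: kern_def set_lebesgue_integral_def)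
qed

lemma kern'_eq_lborel:
  assumes "L > 0"
  shows "kern' L t = - (\<integral>u. indicator {-L..L} u * (u * sin (u * t)) \<partial>lborel) / (2 * pi)"
proof -
  have "(LINT u:{-L..L}|lborel. u * sin (u * t)) = integral {-L..L} (\<lambda>u. u * sin (u * t))"
    by (intro set_borel_integral_eq_integral borel_integrable_atLeastAtMost' continuous_intros)
  then show ?thesis by (simp add: kern'_def set_lebesgue_integral_def)
qed

lemma abs_kern_le: assumes "L > 0" shows "\<bar>kern L t\<bar> \<le> L"
proof -
  have "\<bar>integral {-L..L} (\<lambda>u. cos (u * t))\<bar> \<le> 1 * (L - - L)"
    using assms by (intro integral_bound[where 'a=real, simplified real_norm_def]) (auto intro!: continuous_intros)
  then have "\<bar>kern L t\<bar> \<le> 2 * L / (2 * pi)"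
    by (simp add: kern_def field_simps)
  also have "\<dots> \<le> L" using assms pi_gt3 by (simp add: field_simps)
  finally show ?thesis .
qed

lemma abs_kern'_le: assumes "L > 0" shows "\<bar>kern' L t\<bar> \<le> L\<^sup>2"
proof -
  have "\<bar>u * sin (u*t)\<bar> \<le> L" if "u \<in> {-L..L}" for u
  proof -
    have "\<bar>u\<bar> * \<bar>sin (u * t)\<bar> \<le> L * 1" using that assms by (intro mult_mono) auto
    then show ?thesis by (simp add: abs_mult)
  qed
  then have "\<bar>integral {-L..L} (\<lambda>u. u * sin (u * t))\<bar> \<le> L * (L - - L)"
    using assms by (intro integral_bound[where 'a=real, simplified real_norm_def]) (auto intro!: continuous_intros)
  then have "\<bar>kern' L t\<bar> \<le> 2 * L\<^sup>2 / (2 * pi)"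
    by (simp add: kern'_def power2_eq_square field_simps)
  also have "\<dots> \<le> L\<^sup>2" using assms pi_gt3 by (simp add: field_simps)
  finally show ?thesis .
qed

lemma kern'_0[simp]: "kern' L 0 = 0" by (simp add: kern'_def)

lemma isCont_kern: "isCont (kern L) t" using DERIV_kern DERIV_isCont by blast

lemma isCont_kern': "isCont (kern' L) t"
proof -
  have "((\<lambda>t. integral (cbox (-L) L) (\<lambda>u. u * sin (u * t))) has_field_derivative
      integral (cbox (-L) L) (\<lambda>u. u * (u * cos (u * t)))) (at t within UNIV)"
    by (rule leibniz_rule_field_derivative[where U=UNIV and f="\<lambda>t u. u * sin (u*t)" and fx="\<lambda>t u. u * (u * cos (u * t))"])
      (auto intro!: derivative_eq_intros integrable_continuous_interval continuous_intros simp: split_beta)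
  from DERIV_isCont[OF this[simplified]] show ?thesis
    unfolding kern'_def[abs_def] by (intro continuous_intros) auto
qed

lemma kern_measurable[measurable]: "kern L \<in> borel_measurable borel"
  by (intro borel_measurable_continuous_onI continuous_at_imp_continuous_on ballI isCont_kern)
lemma kern'_measurable[measurable]: "kern' L \<in> borel_measurable borel"
  by (intro borel_measurable_continuous_onI continuous_at_imp_continuous_on ballI isCont_kern')

text \<open>The integrand is dominated by a constant times the indicator of \<open>{-L..L}\<close>
  times the normal density, a product of integrable functions. Expectations of kernel values can
  thus be computed frequency by frequency.\<close>

lemma Fubini_std_normal:
  fixes g :: "real \<Rightarrow> real \<Rightarrow> real"
  assumes [measurable]: "case_prod g \<in> borel_measurable (borel \<Otimes>\<^sub>M borel)"
    and b: "\<And>u z. u \<in> {-L..L} \<Longrightarrow> \<bar>g u z\<bar> \<le> C"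
  shows "(\<integral>z. std_normal_density z * (\<integral>u. indicator {-L..L} u * g u z \<partial>lborel) \<partial>lborel) =
    (\<integral>u. indicator {-L..L} u * (\<integral>z. std_normal_density z * g u z \<partial>lborel) \<partial>lborel)"
proof -
  let ?h = "\<lambda>u z. std_normal_density z * (indicator {-L..L} u * g u z)"
  have i: "integrable (lborel \<Otimes>\<^sub>M lborel) (\<lambda>(u, z). ?h u z)"
  proof (rule Bochner_Integration.integrable_bound)
    show "integrable (lborel \<Otimes>\<^sub>M lborel) (\<lambda>(u, z). (C * indicator {-L..L} u) * std_normal_density z)"
      by (rule lborel_pair.Fubini_integrable)
        (auto intro!: integrable_mult_right integrable_real_indicator simp: abs_mult emeasure_lborel_Icc_eq)
    have "\<bar>?h u z\<bar> \<le> \<bar>(C * indicator {-L..L} u) * std_normal_density z\<bar>" for u z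
    proof (cases "u \<in> {-L..L}")
      case True
      have "std_normal_density z * \<bar>g u z\<bar> \<le> std_normal_density z * \<bar>C\<bar>"
        using b[OF True, of z] by (intro mult_left_mono) auto
      with True show ?thesis by (simp add: abs_mult mult.commute)
    qed simp
    then show "AE x in lborel \<Otimes>\<^sub>M lborel. norm (case x of (u, z) \<Rightarrow> ?h u z)
       \<le> norm (case x of (u, z) \<Rightarrow> (C * indicator {-L..L} u) * std_normal_density z)"
      by (auto split: prod.splits)
  qed measurable
  have "(\<integral>z. (\<integral>u. ?h u z \<partial>lborel) \<partial>lborel) = (\<integral>u. (\<integral>z. ?h u z \<partial>lborel) \<partial>lborel)"
    by (rule lborel_pair.Fubini_integral[OF i])
  moreover have "(\<integral>z. ?h u z \<partial>lborel) = indicator {-L..L} u * (\<integral>z. std_normal_density z * g u z \<partial>lborel)" for u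
    by (subst integral_mult_right_zero[symmetric]) (simp add: mult_ac)
  moreover have "(\<integral>u. ?h u z \<partial>lborel) = std_normal_density z * (\<integral>u. indicator {-L..L} u * g u z \<partial>lborel)" for z
    by (subst integral_mult_right_zero[symmetric]) (simp add: mult_ac)
  ultimately show ?thesis by simp
qed

text \<open>The right-hand side is a multiple of the normal density of variance \<open>2\<close>. A
  pointwise bound by \<open>C * exp (z\<^sup>2 / 4)\<close> therefore gives a Gaussian expectation
  of at most \<open>C * sqrt 2\<close>, the source of most tail and moment constants below.\<close>

lemma std_normal_quarter: "std_normal_density z * exp (z\<^sup>2 / 4) = sqrt 2 * normal_density 0 (sqrt 2) z"
  unfolding normal_density_def
  by (simp add: exp_add[symmetric] real_sqrt_mult mult_exp_exp field_simps)

lemma std_normal_exp_quarter: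
  "integrable lborel (\<lambda>z. std_normal_density z * exp (z\<^sup>2 / 4))"
  "(\<integral>z. std_normal_density z * exp (z\<^sup>2 / 4) \<partial>lborel) = sqrt 2"
  unfolding std_normal_quarter by simp_all

text \<open>Half of the exponent pays for the small factor, the other half remains as an integrable
  function.\<close>

lemma exp_cut:
  fixes u L :: real
  assumes "\<bar>u\<bar> > L" "L \<ge> 0" shows "exp (- u\<^sup>2/2) \<le> exp (- L\<^sup>2/4) * exp (-u\<^sup>2/4)"
proof -
  have "L\<^sup>2 \<le> u\<^sup>2" using assms by (simp add: abs_le_square_iff[symmetric])
  then show ?thesis by (simp add: mult_exp_exp)
qed

text \<open>In the Fourier domain, the expected kernel is the normal density with all frequencies
  beyond \<open>L\<close> removed. By \<open>exp_cut\<close> the removed part is at most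
  \<open>exp (- L\<^sup>2/4)\<close> times the integral of \<open>exp (- u\<^sup>2/4)\<close>, which
  is \<open>sqrt (4*pi)\<close> and below the Fourier factor \<open>2*pi\<close>. At
  \<open>L = bw n\<close> the bias is \<open>1 / sqrt n\<close>, up to a logarithm the size of the
  stochastic error.\<close>

lemma kern_bias:
  assumes "L > 0"
  shows "\<bar>(\<integral>z. std_normal_density z * kern L (t - z) \<partial>lborel) - std_normal_density t\<bar> \<le> exp (- L\<^sup>2/4)"
proof -
  have inner: "(\<integral>z. std_normal_density z * cos (u * (t - z)) \<partial>lborel) = cos (u * t) * exp (- u\<^sup>2/2)" for u
  proof -
    have "(\<lambda>z. std_normal_density z * cos (u * (t - z))) =
      (\<lambda>z. cos (u * t) * (std_normal_density z * cos (u * z)) + sin (u*t) * (std_normal_density z * sin (u * z)))"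
      by (simp add: fun_eq_iff right_diff_distrib cos_diff algebra_simps)
    moreover have "integrable lborel (\<lambda>z. std_normal_density z * cos (u * z))" 
      "integrable lborel (\<lambda>z. std_normal_density z * sin (u * z))"
      by (auto intro!: integrable_std_normal_bounded[where C=1])
    ultimately show ?thesis by (simp add: std_normal_cos std_normal_sin)
  qed
  let ?e = "\<lambda>u. exp (- u\<^sup>2/2) :: real"
  have ie: "integrable lborel (\<lambda>u. cos (u * t) * ?e u)"
  proof -
    have "(\<lambda>u. cos (u * t) * ?e u) = (\<lambda>u. sqrt (2*pi) * (std_normal_density u * cos (t * u)))"
      by (simp add: fun_eq_iff std_normal_density_def mult_ac)
    then show ?thesis using integrable_std_normal_bounded[of "\<lambda>u. cos (t*u)" 1] by simp
  qed
  have ie2: "integrable lborel (\<lambda>u. indicator {-L..L} u * (cos (u * t) * ?e u))"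
    using integrable_mult_indicator[of "{-L..L}" lborel, OF _ ie] by simp
  have "(\<integral>u. cos (u * t) * ?e u \<partial>lborel) = sqrt (2*pi) * (\<integral>u. std_normal_density u * cos (t * u) \<partial>lborel)"
    by (subst integral_mult_right_zero[symmetric]) (simp add: std_normal_density_def mult_ac)
  also have "\<dots> = sqrt (2*pi) * exp (- t\<^sup>2/2)" by (simp add: std_normal_cos)
  also have "\<dots> = 2 * pi * std_normal_density t"
    by (simp add: std_normal_density_def field_simps real_sqrt_mult)
  finally have phi: "2 * pi * std_normal_density t = (\<integral>u. cos (u * t) * ?e u \<partial>lborel)" by simp
  have "2 * pi * (\<integral>z. std_normal_density z * kern L (t - z) \<partial>lborel) =
     (\<integral>z. std_normal_density z * (\<integral>u. indicator {-L..L} u * cos (u * (t - z)) \<partial>lborel) \<partial>lborel)"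
    by (subst integral_mult_right_zero[symmetric]) (simp add: kern_eq_lborel[OF assms])
  also have "\<dots> = (\<integral>u. indicator {-L..L} u * (cos (u * t) * ?e u) \<partial>lborel)"
    by (subst Fubini_std_normal[where C=1]) (auto simp: inner)
  finally have "2 * pi * ((\<integral>z. std_normal_density z * kern L (t - z) \<partial>lborel) - std_normal_density t) =
     (\<integral>u. indicator {-L..L} u * (cos (u * t) * ?e u) - cos (u * t) * ?e u \<partial>lborel)"
    using ie ie2 phi by (simp add: right_diff_distrib)
  moreover have "\<bar>\<integral>u. indicator {-L..L} u * (cos (u * t) * ?e u) - cos (u * t) * ?e u \<partial>lborel\<bar>
     \<le> (\<integral>u. exp (- L\<^sup>2/4) * (sqrt (4*pi) * normal_density 0 (sqrt 2) u) \<partial>lborel)"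
  proof (rule integral_abs_bound_integral)
    show "\<bar>indicator {-L..L} u * (cos (u * t) * ?e u) - cos (u * t) * ?e u\<bar>
      \<le> exp (- L\<^sup>2/4) * (sqrt (4*pi) * normal_density 0 (sqrt 2) u)" for u
    proof -
      have n: "sqrt (4*pi) * normal_density 0 (sqrt 2) u = exp (- u\<^sup>2/4)"
        by (simp add: normal_density_def real_sqrt_mult)
      have "\<bar>cos (u * t)\<bar> * ?e u \<le> 1 * ?e u" by (intro mult_right_mono) auto
      then have "\<bar>cos (u * t)\<bar> * ?e u \<le> exp (- L\<^sup>2/4) * exp (- u\<^sup>2/4)" if "\<bar>u\<bar> > L"
        using exp_cut[OF that] assms by linarith
      then show ?thesis unfolding n
        using assms by (cases "\<bar>u\<bar> > L") (auto simp: abs_mult split: split_indicator)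
    qed
  qed (use ie ie2 in auto)
  moreover have "(\<integral>u. exp (- L\<^sup>2/4) * (sqrt (4*pi) * normal_density 0 (sqrt 2) u) \<partial>lborel) = exp (- L\<^sup>2/4) * sqrt (4*pi)"
    by simp
  moreover have "sqrt (4*pi) \<le> 2*pi" using pi_gt3 by (intro real_le_lsqrt) (auto simp: power2_eq_square)
  ultimately have "\<bar>2*pi * ((\<integral>z. std_normal_density z * kern L (t - z) \<partial>lborel) - std_normal_density t)\<bar> \<le> exp (- L\<^sup>2/4) * (2*pi)"
    by (smt (verit) exp_gt_zero mult_left_mono)
  then show ?thesis by (simp add: abs_mult mult.commute)
qed

text \<open>As for \<open>kern_bias\<close>, with one more factor \<open>u\<close> from the
  derivative. It is absorbed by \<open>\<bar>u\<bar> \<le> (1 + u\<^sup>2) / 2\<close> and the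
  second moment \<open>2\<close> of the normal law of variance \<open>2\<close>; the resulting
  \<open>sqrt (4*pi) * (3/2)\<close> is still below \<open>2*pi\<close>.\<close>

lemma kern'_bias:
  assumes "L > 0"
  shows "\<bar>(\<integral>z. std_normal_density z * kern' L (t - z) \<partial>lborel) - (- t * std_normal_density t)\<bar> \<le> exp (- L\<^sup>2/4)"
proof -
  have inner: "(\<integral>z. std_normal_density z * (u * sin (u * (t - z))) \<partial>lborel) = u * sin (u * t) * exp (- u\<^sup>2/2)" for u
  proof -
    have "(\<lambda>z. std_normal_density z * (u * sin (u * (t - z)))) =
      (\<lambda>z. u * (sin (u * t) * (std_normal_density z * cos (u * z)) - cos (u*t) * (std_normal_density z * sin (u * z))))"
      by (simp add: fun_eq_iff right_diff_distrib sin_diff algebra_simps)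
    moreover have "integrable lborel (\<lambda>z. std_normal_density z * cos (u * z))" 
      "integrable lborel (\<lambda>z. std_normal_density z * sin (u * z))"
      by (auto intro!: integrable_std_normal_bounded[where C=1])
    ultimately show ?thesis by (simp add: std_normal_cos std_normal_sin)
  qed
  let ?e = "\<lambda>u. exp (- u\<^sup>2/2) :: real"
  have ie: "integrable lborel (\<lambda>u. u * sin (u * t) * ?e u)"
  proof -
    have "(\<lambda>u. u * sin (u * t) * ?e u) = (\<lambda>u. sqrt (2*pi) * (std_normal_density u * (u * sin (t * u))))"
      by (simp add: fun_eq_iff std_normal_density_def mult_ac)
    moreover have "integrable lborel (\<lambda>x. std_normal_density x * (x * sin (t * x)))"
    proof (rule Bochner_Integration.integrable_bound)
      show "integrable lborel (\<lambda>x. std_normal_density x * \<bar>x\<bar>^1)"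
        by (rule integrable_std_normal_moment_abs)
      have "\<bar>x\<bar> * \<bar>sin (t * x)\<bar> \<le> \<bar>x\<bar>" for x :: real
        by (simp add: mult_left_le)
      then show "AE x in lborel. norm (std_normal_density x * (x * sin (t * x))) \<le> norm (std_normal_density x * \<bar>x\<bar>^1)"
        by (auto simp: abs_mult intro!: mult_left_mono)
    qed simp
    ultimately show ?thesis by simp
  qed
  have ie2: "integrable lborel (\<lambda>u. indicator {-L..L} u * (u * sin (u * t) * ?e u))"
    using integrable_mult_indicator[of "{-L..L}" lborel, OF _ ie] by simp
  have "(\<integral>u. u * sin (u * t) * ?e u \<partial>lborel) = sqrt (2*pi) * (\<integral>u. std_normal_density u * (u * sin (t * u)) \<partial>lborel)"
    by (subst integral_mult_right_zero[symmetric]) (simp add: std_normal_density_def mult_ac)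
  also have "\<dots> = sqrt (2*pi) * (t * exp (- t\<^sup>2/2))" by (simp add: std_normal_x_sin)
  also have "\<dots> = 2 * pi * (t * std_normal_density t)"
    by (simp add: std_normal_density_def field_simps real_sqrt_mult)
  finally have phi: "2 * pi * (t * std_normal_density t) = (\<integral>u. u * sin (u * t) * ?e u \<partial>lborel)" by simp
  have "2 * pi * (\<integral>z. std_normal_density z * kern' L (t - z) \<partial>lborel) =
     - (\<integral>z. std_normal_density z * (\<integral>u. indicator {-L..L} u * (u * sin (u * (t - z))) \<partial>lborel) \<partial>lborel)"
    by (subst integral_mult_right_zero[symmetric]) (simp add: kern'_eq_lborel[OF assms])
  also have "\<dots> = - (\<integral>u. indicator {-L..L} u * (u * sin (u * t) * ?e u) \<partial>lborel)"
  proof (subst Fubini_std_normal[where C=L])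
    fix u z assume "u \<in> {-L..L}"
    then have "\<bar>u\<bar> * \<bar>sin (u * (t - z))\<bar> \<le> L * 1" using assms by (intro mult_mono) auto
    then show "\<bar>u * sin (u * (t - z))\<bar> \<le> L" by (simp add: abs_mult)
  qed (auto simp: inner)
  finally have "2 * pi * ((\<integral>z. std_normal_density z * kern' L (t - z) \<partial>lborel) - (- t * std_normal_density t)) =
     (\<integral>u. u * sin (u * t) * ?e u - indicator {-L..L} u * (u * sin (u * t) * ?e u) \<partial>lborel)"
    using ie ie2 phi by (simp add: distrib_left)
  moreover have "\<bar>\<integral>u. u * sin (u * t) * ?e u - indicator {-L..L} u * (u * sin (u * t) * ?e u) \<partial>lborel\<bar>
     \<le> (\<integral>u. exp (- L\<^sup>2/4) * (sqrt (4*pi) * ((normal_density 0 (sqrt 2) u + normal_density 0 (sqrt 2) u * (u - 0)^2)/2)) \<partial>lborel)"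
  proof (rule integral_abs_bound_integral)
    show "integrable lborel (\<lambda>u. exp (- L\<^sup>2/4) * (sqrt (4*pi) * ((normal_density 0 (sqrt 2) u + normal_density 0 (sqrt 2) u * (u - 0)^2)/2)))"
      by (intro integrable_mult_right integrable_divide Bochner_Integration.integrable_add integrable_normal_moment) auto
    show "\<bar>u * sin (u * t) * ?e u - indicator {-L..L} u * (u * sin (u * t) * ?e u)\<bar>
      \<le> exp (- L\<^sup>2/4) * (sqrt (4*pi) * ((normal_density 0 (sqrt 2) u + normal_density 0 (sqrt 2) u * (u - 0)^2)/2))" for u
    proof -
      have n: "sqrt (4*pi) * ((normal_density 0 (sqrt 2) u + normal_density 0 (sqrt 2) u * (u - 0)^2)/2) = exp (- u\<^sup>2/4) * ((1+u\<^sup>2)/2)"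
        by (simp add: normal_density_def real_sqrt_mult field_simps)
      have a: "\<bar>u\<bar> \<le> (1+u\<^sup>2)/2" using sum_squares_bound[of 1 "\<bar>u\<bar>"] by (simp add: power2_eq_square)
      have "\<bar>u\<bar> * \<bar>sin (u * t)\<bar> \<le> ((1+u\<^sup>2)/2) * 1" using a by (intro mult_mono) auto
      then have "\<bar>u\<bar> * \<bar>sin (u * t)\<bar> * ?e u \<le> ((1+u\<^sup>2)/2) * ?e u" by (intro mult_right_mono) auto
      moreover have "((1+u\<^sup>2)/2) * ?e u \<le> ((1+u\<^sup>2)/2) * (exp (- L\<^sup>2/4) * exp (-u\<^sup>2/4))" if "\<bar>u\<bar> > L"
        using exp_cut[OF that] assms by (intro mult_left_mono) auto
      ultimately have "\<bar>u\<bar> * \<bar>sin (u * t)\<bar> * ?e u \<le> ((1+u\<^sup>2)/2) * (exp (- L\<^sup>2/4) * exp (-u\<^sup>2/4))" if "\<bar>u\<bar> > L" using that by (meson order_trans)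
      then show ?thesis unfolding n
        using assms by (cases "\<bar>u\<bar> > L") (auto simp: abs_mult mult_ac split: split_indicator)
    qed
  qed (use ie ie2 in auto)
  moreover have "(\<integral>u. exp (- L\<^sup>2/4) * (sqrt (4*pi) * ((normal_density 0 (sqrt 2) u + normal_density 0 (sqrt 2) u * (u - 0)^2)/2)) \<partial>lborel)
     = exp (- L\<^sup>2/4) * (sqrt (4*pi) * (3/2))"
  proof -
    have m: "has_bochner_integral lborel (\<lambda>u. normal_density 0 (sqrt 2) u * (u - 0)^2) 2"
      using normal_moment_even[of "sqrt 2" 0 1] by (simp add: numeral_2_eq_2)
    then have "integrable lborel (\<lambda>u. normal_density 0 (sqrt 2) u * (u - 0)^2)"
      "(\<integral>u. normal_density 0 (sqrt 2) u * (u - 0)^2 \<partial>lborel) = 2"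
      using has_bochner_integral_integral_eq by (auto simp: has_bochner_integral_iff)
    then show ?thesis by (simp add: Bochner_Integration.integral_add)
  qed
  moreover have "sqrt (4*pi) * (3/2) \<le> 2*pi"
  proof -
    have "sqrt (4*pi) \<le> 4*pi/3" using pi_gt3 by (intro real_le_lsqrt) (auto simp: power2_eq_square field_simps)
    then show ?thesis by simp
  qed
  ultimately have "\<bar>2*pi * ((\<integral>z. std_normal_density z * kern' L (t - z) \<partial>lborel) - (- t * std_normal_density t))\<bar> \<le> exp (- L\<^sup>2/4) * (2*pi)"
    by (smt (verit) exp_gt_zero mult_left_mono)
  then show ?thesis by (simp add: abs_mult mult.commute)
qed

section \<open>Independent variables\<close>

context prob_space
begin

text \<open>The \<open>k\<close>-th coordinate is independent of the others, so the joint law is a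
  product and Fubini isolates that coordinate as \<open>y\<close>. The rule is evaluated at an
  observation that also enters the density estimate; with \<open>y\<close> fixed, the estimate at
  that point is an average of independent terms, one of them constant.\<close>

lemma nn_integral_indep_resample:
  fixes Z :: "'i \<Rightarrow> 'a \<Rightarrow> real"
  assumes ind: "indep_vars (\<lambda>_. borel) Z I" and k: "k \<in> I"
    and G[measurable]: "G \<in> borel_measurable (PiM I (\<lambda>_. borel))"
    and d: "distributed M lborel (Z k) std_normal_density"
  shows "(\<integral>\<^sup>+\<omega>. G (restrict (\<lambda>i. Z i \<omega>) I) \<partial>M) =
    (\<integral>\<^sup>+y. (\<integral>\<^sup>+\<omega>. G ((restrict (\<lambda>i. Z i \<omega>) I)(k := y)) \<partial>M) \<partial>std_normal_distribution)"
proof -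
  let ?J = "I - {k}"
  let ?P = "PiM {k} (\<lambda>_. borel) :: ('i \<Rightarrow> real) measure"
  let ?Q = "PiM ?J (\<lambda>_. borel) :: ('i \<Rightarrow> real) measure"
  let ?X = "\<lambda>\<omega>. restrict (\<lambda>i. Z i \<omega>) {k}" and ?Y = "\<lambda>\<omega>. restrict (\<lambda>i. Z i \<omega>) ?J"
  have rv[measurable]: "Z i \<in> borel_measurable M" if "i \<in> I" for i
    using ind that by (auto simp: indep_vars_def)
  have "indep_var ?P ?X ?Q ?Y"
    by (rule indep_var_restrict[OF ind]) (use k in auto)
  then have eq: "distr M ?P ?X \<Otimes>\<^sub>M distr M ?Q ?Y = distr M (?P \<Otimes>\<^sub>M ?Q) (\<lambda>\<omega>. (?X \<omega>, ?Y \<omega>))"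
    and Xm[measurable]: "?X \<in> measurable M ?P" and Ym[measurable]: "?Y \<in> measurable M ?Q"
    by (auto simp: indep_var_distribution_eq)
  have dk: "distr M borel (Z k) = std_normal_distribution"
    using distributed_distr_eq_density[OF d] by (simp add: distr_cong[OF refl sets_lborel])
  interpret Y: prob_space "distr M ?Q ?Y" by (rule prob_space_distr) simp
  have Zk[measurable]: "Z k \<in> borel_measurable M" using k by simp
  have upd[measurable]: "(\<lambda>(y, w). w(k := y)) \<in> measurable (borel \<Otimes>\<^sub>M ?Q) (PiM I (\<lambda>_. borel))"
    unfolding split_beta by (rule measurable_fun_upd[where J="?J"]) (use k in auto)
  have upd2[measurable]: "(\<lambda>w. w(k := y)) \<in> measurable ?Q (PiM I (\<lambda>_. borel))" for y
    by (rule measurable_fun_upd[where J="?J"]) (use k in auto)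
  let ?F = "\<lambda>y w. G (w(k := y))"
  have F: "case_prod ?F \<in> borel_measurable (borel \<Otimes>\<^sub>M ?Q)"
    using measurable_compose[OF upd G] by (simp add: split_beta)
  have F'[measurable]: "(\<lambda>(u, w). ?F (u k) w) \<in> borel_measurable (?P \<Otimes>\<^sub>M ?Q)"
  proof -
    have "(\<lambda>(u, w). (u k, w)) \<in> measurable (?P \<Otimes>\<^sub>M ?Q) (borel \<Otimes>\<^sub>M ?Q)" by measurable
    from measurable_compose[OF this F] show ?thesis by (simp add: split_beta)
  qed
  have inner: "(\<integral>\<^sup>+w. ?F y w \<partial>distr M ?Q ?Y) = (\<integral>\<^sup>+\<omega>. ?F y (?Y \<omega>) \<partial>M)" for y
    by (subst nn_integral_distr) auto
  have inner_m[measurable]: "(\<lambda>y. \<integral>\<^sup>+w. ?F y w \<partial>distr M ?Q ?Y) \<in> borel_measurable borel"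
    by (rule Y.borel_measurable_nn_integral) (use F in \<open>simp cong: measurable_cong_sets\<close>)
  have r: "restrict (\<lambda>i. Z i \<omega>) I = (?Y \<omega>)(k := Z k \<omega>)" for \<omega>
    using k by (auto simp: fun_eq_iff)
  have r2: "(restrict (\<lambda>i. Z i \<omega>) I)(k := y) = (?Y \<omega>)(k := y)" for \<omega> y
    using k by (auto simp: fun_eq_iff)
  have "(\<integral>\<^sup>+\<omega>. G (restrict (\<lambda>i. Z i \<omega>) I) \<partial>M) =
      (\<integral>\<^sup>+p. (\<lambda>(u, w). ?F (u k) w) p \<partial>distr M (?P \<Otimes>\<^sub>M ?Q) (\<lambda>\<omega>. (?X \<omega>, ?Y \<omega>)))"
    by (subst nn_integral_distr) (auto simp: r)
  also have "\<dots> = (\<integral>\<^sup>+u. (\<integral>\<^sup>+w. ?F (u k) w \<partial>distr M ?Q ?Y) \<partial>distr M ?P ?X)"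
    unfolding eq[symmetric] by (subst Y.nn_integral_fst[symmetric]) (auto simp: split_beta)
  also have "\<dots> = (\<integral>\<^sup>+\<omega>. (\<integral>\<^sup>+w. ?F (Z k \<omega>) w \<partial>distr M ?Q ?Y) \<partial>M)"
    by (subst nn_integral_distr) auto
  also have "\<dots> = (\<integral>\<^sup>+y. (\<integral>\<^sup>+w. ?F y w \<partial>distr M ?Q ?Y) \<partial>distr M borel (Z k))"
    by (subst nn_integral_distr) auto
  also have "\<dots> = (\<integral>\<^sup>+y. (\<integral>\<^sup>+\<omega>. G ((restrict (\<lambda>i. Z i \<omega>) I)(k := y)) \<partial>M) \<partial>std_normal_distribution)"
    unfolding dk inner by (simp add: r2)
  finally show ?thesis .
qed

text \<open>Induction on the index set: the new term is centred and independent of the sum of the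
  others, so the cross term vanishes. Boundedness supplies all integrability.\<close>

lemma second_moment_indep_sum:
  fixes Y :: "'i \<Rightarrow> 'a \<Rightarrow> real" and B :: real
  assumes "finite I" "indep_vars (\<lambda>_. borel) Y I"
    and "\<And>i \<omega>. i \<in> I \<Longrightarrow> \<bar>Y i \<omega>\<bar> \<le> B" and "\<And>i. i \<in> I \<Longrightarrow> expectation (Y i) = 0"
  shows "expectation (\<lambda>\<omega>. (\<Sum>i\<in>I. Y i \<omega>)\<^sup>2) \<le> card I * B\<^sup>2"
  using assms
proof (induction I rule: finite_induct)
  case empty
  then show ?case by simp
next
  case (insert k I)
  have ind: "indep_vars (\<lambda>_. borel) Y I" using insert.prems(1) by (rule indep_vars_subset) auto
  have rv[measurable]: "Y i \<in> borel_measurable M" if "i \<in> insert k I" for i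
    using insert.prems(1) that by (auto simp: indep_vars_def)
  define S where "S \<omega> = (\<Sum>i\<in>I. Y i \<omega>)" for \<omega>
  have [measurable]: "S \<in> borel_measurable M" unfolding S_def by simp
  have Yk[measurable]: "Y k \<in> borel_measurable M" by simp
  have iv: "indep_var borel (Y k) borel S"
    unfolding S_def by (rule indep_vars_sum) (use insert in auto)
  have bY: "\<bar>Y k \<omega>\<bar> \<le> B" for \<omega> using insert.prems(2) by simp
  have B: "B \<ge> 0" using bY[of undefined] by linarith
  have bS: "\<bar>S \<omega>\<bar> \<le> card I * B" for \<omega>
    unfolding S_def using insert.prems(2) by (intro order_trans[OF sum_abs] sum_bounded_above) auto
  have iY: "integrable M (Y k)" using bY by (intro integrable_const_bound[where B=B]) auto
  have iS: "integrable M S" using bS by (intro integrable_const_bound[where B="card I * B"]) auto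
  have iY2: "integrable M (\<lambda>\<omega>. (Y k \<omega>)\<^sup>2)"
    using power_mono[OF bY, where n=2] by (intro integrable_const_bound[where B="B\<^sup>2"]) auto
  have iS2: "integrable M (\<lambda>\<omega>. (S \<omega>)\<^sup>2)"
    using power_mono[OF bS, where n=2] by (intro integrable_const_bound[where B="(card I * B)\<^sup>2"]) auto
  have iYS: "integrable M (\<lambda>\<omega>. Y k \<omega> * S \<omega>)" by (rule indep_var_integrable[OF iv iY iS])
  have YS: "expectation (\<lambda>\<omega>. Y k \<omega> * S \<omega>) = 0"
    using indep_var_lebesgue_integral[OF iv iY iS] insert.prems(3) by simp
  have "expectation (\<lambda>\<omega>. (\<Sum>i\<in>insert k I. Y i \<omega>)\<^sup>2) = expectation (\<lambda>\<omega>. (Y k \<omega>)\<^sup>2 + (S \<omega>)\<^sup>2 + 2 * (Y k \<omega> * S \<omega>))"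
    using insert.hyps by (simp add: S_def power2_sum mult.assoc)
  also have "\<dots> = expectation (\<lambda>\<omega>. (Y k \<omega>)\<^sup>2) + expectation (\<lambda>\<omega>. (S \<omega>)\<^sup>2)"
    using iY2 iS2 iYS YS by simp
  also have "expectation (\<lambda>\<omega>. (Y k \<omega>)\<^sup>2) \<le> B\<^sup>2"
    using iY2 power_mono[OF bY, where n=2] by (intro integral_le_const) auto
  also have "expectation (\<lambda>\<omega>. (S \<omega>)\<^sup>2) \<le> card I * B\<^sup>2"
    unfolding S_def using insert.IH[OF ind] insert.prems by auto
  finally show ?case using insert.hyps by (simp add: algebra_simps)
qed

lemma variance_indep_sum:
  fixes Y :: "'i \<Rightarrow> 'a \<Rightarrow> real" and B :: real
  assumes "finite I" and ind: "indep_vars (\<lambda>_. borel) Y I"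
    and b: "\<And>i \<omega>. i \<in> I \<Longrightarrow> \<bar>Y i \<omega>\<bar> \<le> B"
  shows "expectation (\<lambda>\<omega>. ((\<Sum>i\<in>I. Y i \<omega>) - (\<Sum>i\<in>I. expectation (Y i)))\<^sup>2) \<le> card I * (2 * B)\<^sup>2"
proof -
  have rv[measurable]: "Y i \<in> borel_measurable M" if "i \<in> I" for i
    using ind that by (auto simp: indep_vars_def)
  have i: "integrable M (Y i)" if "i \<in> I" for i
    using b[OF that] rv[OF that] by (intro integrable_const_bound[where B=B]) auto
  have e: "\<bar>expectation (Y i)\<bar> \<le> B" if "i \<in> I" for i
  proof -
    have "Y i \<omega> \<le> B" "- B \<le> Y i \<omega>" for \<omega> using b[OF that, of \<omega>] by linarith+
    then have "expectation (Y i) \<le> B" "- B \<le> expectation (Y i)"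
      by (auto intro!: integral_le_const integral_ge_const i[OF that])
    then show ?thesis by simp
  qed
  have "expectation (\<lambda>\<omega>. (\<Sum>i\<in>I. Y i \<omega> - expectation (Y i))\<^sup>2) \<le> card I * (2 * B)\<^sup>2"
  proof (rule second_moment_indep_sum[OF assms(1)])
    show "indep_vars (\<lambda>_. borel) (\<lambda>i \<omega>. Y i \<omega> - expectation (Y i)) I"
      by (rule indep_vars_compose2[OF ind]) auto
    fix j assume j: "j \<in> I"
    show "\<bar>Y j \<omega> - expectation (Y j)\<bar> \<le> 2 * B" for \<omega> using b[OF j, of \<omega>] e[OF j] by linarith
    show "expectation (\<lambda>\<omega>. Y j \<omega> - expectation (Y j)) = 0"
      using i[OF j] by (simp add: prob_space)
  qed
  then show ?thesis by (simp add: sum_subtractf)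
qed

lemma hoeffding_bounded:
  fixes Y :: "'i \<Rightarrow> 'a \<Rightarrow> real" and B :: real
  assumes "finite I" "I \<noteq> {}" and ind: "indep_vars (\<lambda>_. borel) Y I"
    and b: "\<And>i \<omega>. i \<in> I \<Longrightarrow> \<bar>Y i \<omega>\<bar> \<le> B" and "B > 0" "t \<ge> 0"
  shows "prob {\<omega> \<in> space M. (\<Sum>i\<in>I. Y i \<omega>) \<le> (\<Sum>i\<in>I. expectation (Y i)) - t} \<le> exp (- t\<^sup>2 / (2 * card I * B\<^sup>2))"
    and "prob {\<omega> \<in> space M. (\<Sum>i\<in>I. Y i \<omega>) \<ge> (\<Sum>i\<in>I. expectation (Y i)) + t} \<le> exp (- t\<^sup>2 / (2 * card I * B\<^sup>2))"
proof -
  interpret Hoeffding_ineq M I Y "\<lambda>_. -B" "\<lambda>_. B" "\<Sum>i\<in>I. expectation (Y i)"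
    using assms by unfold_locales (auto simp: abs_le_iff minus_le_iff)
  have c: "(\<Sum>i\<in>I. (B - - B)\<^sup>2) = 4 * card I * B\<^sup>2" by (simp add: power2_eq_square)
  have pos: "(\<Sum>i\<in>I. (B - - B)\<^sup>2) > 0" unfolding c using assms by (simp add: card_gt_0_iff)
  show "prob {\<omega> \<in> space M. (\<Sum>i\<in>I. Y i \<omega>) \<le> (\<Sum>i\<in>I. expectation (Y i)) - t} \<le> exp (- t\<^sup>2 / (2 * card I * B\<^sup>2))"
    using Hoeffding_ineq_le[OF \<open>t \<ge> 0\<close> pos] unfolding c by (simp add: field_simps)
  show "prob {\<omega> \<in> space M. (\<Sum>i\<in>I. Y i \<omega>) \<ge> (\<Sum>i\<in>I. expectation (Y i)) + t} \<le> exp (- t\<^sup>2 / (2 * card I * B\<^sup>2))"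
    using Hoeffding_ineq_ge[OF \<open>t \<ge> 0\<close> pos] unfolding c by (simp add: field_simps)
qed

end

subsection \<open>Gaussian tails and soft thresholding\<close>

lemma nn_integral_std_normal_exp_bound:
  assumes "\<And>z. g z \<le> C * exp (z\<^sup>2 / 4)" "C \<ge> 0"
  shows "(\<integral>\<^sup>+z. ennreal (g z) \<partial>std_normal_distribution) \<le> ennreal (2 * C)"
proof -
  have "(\<integral>\<^sup>+z. ennreal (g z) \<partial>std_normal_distribution) \<le> (\<integral>\<^sup>+z. ennreal (C * exp (z\<^sup>2 / 4)) \<partial>std_normal_distribution)"
    using assms by (intro nn_integral_mono ennreal_leI) auto
  also have "\<dots> = (\<integral>\<^sup>+z. ennreal (C * (std_normal_density z * exp (z\<^sup>2 / 4))) \<partial>lborel)"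
    using assms(2) by (subst nn_integral_density) (auto simp: ennreal_mult[symmetric] mult_ac)
  also have "\<dots> = ennreal (C * sqrt 2)"
    using std_normal_exp_quarter assms(2) by (subst nn_integral_eq_integral) auto
  also have "\<dots> \<le> ennreal (2 * C)"
    using assms(2) sqrt2_less_2 by (intro ennreal_leI) (auto simp: mult.commute intro: mult_left_mono)
  finally show ?thesis .
qed

lemma sq_le_exp: "(z::real)\<^sup>2 \<le> 8 * exp (z\<^sup>2 / 8)" "z\<^sup>2 \<le> 4 * exp (z\<^sup>2/4)" "z ^ 4 \<le> 64 * exp (z\<^sup>2 / 4)"
proof -
  show a: "z\<^sup>2 \<le> 8 * exp (z\<^sup>2 / 8)" using exp_ge_add_one_self[of "z\<^sup>2/8"] by linarith
  show "z\<^sup>2 \<le> 4 * exp (z\<^sup>2 / 4)" using exp_ge_add_one_self[of "z\<^sup>2/4"] by linarith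
  have "(z\<^sup>2)\<^sup>2 \<le> (8 * exp (z\<^sup>2 / 8))\<^sup>2" using a by (intro power_mono) auto
  also have "\<dots> = 64 * exp (z\<^sup>2/4)" by (simp add: power_mult_distrib exp_double[symmetric])
  finally show "z ^ 4 \<le> 64 * exp (z\<^sup>2 / 4)" by (simp add: power_mult[symmetric])
qed

text \<open>Pointwise form of the Chernoff bound. The choice \<open>c = 4\<close> uses the whole
  budget \<open>exp (z\<^sup>2 / 4)\<close>; the choice \<open>c = 8\<close> leaves room for a
  factor \<open>z\<^sup>2\<close>.\<close>

lemma exp_tail_factor:
  fixes t z c :: real
  assumes "t \<ge> 0" "c > 0"
  shows "(if \<bar>z\<bar> > t then 1 else 0) \<le> exp (- (t\<^sup>2) / c) * exp (z\<^sup>2 / c)"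
proof (cases "\<bar>z\<bar> > t")
  case True
  then have "t\<^sup>2 \<le> z\<^sup>2" using assms by (simp add: abs_le_square_iff[symmetric])
  then have "0 \<le> - (t\<^sup>2)/c + z\<^sup>2/c" using assms by (simp add: divide_right_mono add_divide_distrib[symmetric])
  then show ?thesis using True by (simp add: mult_exp_exp)
qed simp

lemma std_normal_tail:
  assumes "t \<ge> 0"
  shows "(\<integral>\<^sup>+z. ennreal (if \<bar>z\<bar> > t then 1 else 0) \<partial>std_normal_distribution) \<le> ennreal (2 * exp (- (t\<^sup>2)/4))"
  using exp_tail_factor[OF assms, of 4] by (intro nn_integral_std_normal_exp_bound) auto

lemma std_normal_tail_moment2:
  assumes "t \<ge> 0"
  shows "(\<integral>\<^sup>+z. ennreal (z\<^sup>2 * (if \<bar>z\<bar> > t then 1 else 0)) \<partial>std_normal_distribution) \<le> ennreal (16 * exp (- (t\<^sup>2)/8))"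
proof -
  have "z\<^sup>2 * (if \<bar>z\<bar> > t then 1 else 0) \<le> (8 * exp (- (t\<^sup>2)/8)) * exp (z\<^sup>2/4)" for z
  proof -
    have "z\<^sup>2 * (if \<bar>z\<bar> > t then 1 else 0) \<le> (8 * exp (z\<^sup>2/8)) * (exp (- (t\<^sup>2)/8) * exp (z\<^sup>2/8))"
      using exp_tail_factor[OF assms, of 8 z] sq_le_exp(1)[of z] by (intro mult_mono) auto
    also have "\<dots> = (8 * exp (- (t\<^sup>2)/8)) * exp (z\<^sup>2/4)"
      by (simp add: mult_exp_exp field_simps)
    finally show ?thesis .
  qed
  from nn_integral_std_normal_exp_bound[OF this] show ?thesis by (simp add: mult.assoc)
qed

lemma std_normal_moment2: "(\<integral>\<^sup>+z. ennreal (z\<^sup>2) \<partial>std_normal_distribution) \<le> 8"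
  using nn_integral_std_normal_exp_bound[of "\<lambda>z. z\<^sup>2" 4] sq_le_exp by simp

lemma std_normal_moment4: "(\<integral>\<^sup>+z. ennreal (z ^ 4) \<partial>std_normal_distribution) \<le> 128"
  using nn_integral_std_normal_exp_bound[of "\<lambda>z. z ^ 4" 64] sq_le_exp by simp

lemma soft_threshold_measurable[measurable]: "soft_threshold t \<in> borel_measurable borel"
  unfolding soft_threshold_def[abs_def] by measurable

lemma soft_threshold_sq: "t \<ge> 0 \<Longrightarrow> (soft_threshold t x)\<^sup>2 = (max (x - t) 0)\<^sup>2 + (max (- x - t) 0)\<^sup>2"
  unfolding soft_threshold_def by (auto simp: sgn_if max_def abs_if power2_eq_square algebra_simps)

lemma soft_threshold_sq_le: "t \<ge> 0 \<Longrightarrow> (soft_threshold t x)\<^sup>2 \<le> x\<^sup>2 * (if \<bar>x\<bar> > t then 1 else 0)"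
  unfolding soft_threshold_def
  by (auto simp: sgn_if max_def power_mult_distrib abs_le_square_iff[symmetric])

lemma soft_threshold_risk_weak:
  assumes "t \<ge> 0"
  shows "(\<integral>\<^sup>+z. ennreal ((soft_threshold t z)\<^sup>2) \<partial>std_normal_distribution) \<le> ennreal (16 * exp (- (t\<^sup>2)/8))"
  by (rule order_trans[OF nn_integral_mono[OF ennreal_leI[OF soft_threshold_sq_le]] std_normal_tail_moment2]) (use assms in auto)

text \<open>After the shift \<open>z = t + y\<close> the density is at most
  \<open>exp (- (t\<^sup>2)/2) * exp (- (t * y))\<close>, and the integral of
  \<open>y\<^sup>2 * exp (- (t * y))\<close> is \<open>2 / t ^ 3\<close>. Both the full Gaussian
  exponent and the cube matter: at \<open>t = bw n\<close> the bound is
  \<open>4 / (n * t ^ 3)\<close>, so that the total over a level is summable over the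
  levels.\<close>

lemma soft_threshold_risk_zero:
  assumes "t > 0"
  shows "(\<integral>\<^sup>+z. ennreal ((soft_threshold t z)\<^sup>2) \<partial>std_normal_distribution) \<le> ennreal (4 * exp (- (t\<^sup>2)/2) / t ^ 3)"
proof -
  let ?f = "\<lambda>z. std_normal_density z * (max (z - t) 0)\<^sup>2"
  let ?g = "\<lambda>x. ennreal (x^2 * exp (-x)) * indicator {0 ..} x"
  have half: "(\<integral>\<^sup>+z. ennreal (?f z) \<partial>lborel) \<le> ennreal (2 * exp (- (t\<^sup>2)/2) / t ^ 3)"
  proof -
    have "(\<integral>\<^sup>+z. ennreal (?f z) \<partial>lborel) = (\<integral>\<^sup>+y. ennreal (?f (t + y)) \<partial>lborel)"
      using nn_integral_real_affine[of "\<lambda>z. ennreal (?f z)" 1 t] by simp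
    also have "\<dots> \<le> (\<integral>\<^sup>+y. ennreal (exp (- (t\<^sup>2)/2) / t\<^sup>2) * ?g (0 + t * y) \<partial>lborel)"
    proof (rule nn_integral_mono)
      fix y :: real
      show "ennreal (?f (t + y)) \<le> ennreal (exp (- (t\<^sup>2)/2) / t\<^sup>2) * ?g (0 + t * y)"
      proof (cases "y \<ge> 0")
        case True
        have "1 \<le> sqrt (2 * pi)" using pi_gt3 by (simp add: real_le_rsqrt)
        then have "std_normal_density (t + y) \<le> 1 * exp (- (t + y)\<^sup>2/2)"
          unfolding std_normal_density_def by (intro mult_right_mono) auto
        also have "\<dots> \<le> exp (- (t\<^sup>2)/2) * exp (- (t * y))"
          by (simp add: mult_exp_exp power2_sum field_simps)
        finally have "?f (t + y) \<le> exp (- (t\<^sup>2)/2) * exp (- (t * y)) * y\<^sup>2"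
          using True by (intro mult_mono) auto
        also have "\<dots> = (exp (- (t\<^sup>2)/2) / t\<^sup>2) * ((t * y)\<^sup>2 * exp (- (t * y)))"
          using assms by (simp add: power_mult_distrib)
        finally show ?thesis using True assms by (simp add: ennreal_mult[symmetric] ennreal_leI)
      qed simp
    qed
    also have "\<dots> = ennreal (exp (- (t\<^sup>2)/2) / t\<^sup>2) * (\<integral>\<^sup>+y. ?g (0 + t * y) \<partial>lborel)"
      by (rule nn_integral_cmult) measurable
    also have "(\<integral>\<^sup>+y. ?g (0 + t * y) \<partial>lborel) = ennreal (2 / t)"
    proof -
      \<comment> \<open>The integral of \<open>x^2 * exp (- x)\<close> over the half line is
        \<open>2\<close>, and the substitution \<open>x = t * y\<close> contributes the factor
        \<open>t\<close>.\<close>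
      have "ennreal 2 = ennreal t * (\<integral>\<^sup>+y. ?g (0 + t * y) \<partial>lborel)"
        using nn_integral_real_affine[of ?g t 0] assms nn_intergal_power_times_exp_Ici[of 2] by (simp add: numeral_2_eq_2)
      then have "ennreal (1/t) * ennreal 2 = (ennreal (1/t) * ennreal t) * (\<integral>\<^sup>+y. ?g (0 + t * y) \<partial>lborel)"
        by (simp add: mult.assoc)
      moreover have "ennreal (1/t) * ennreal t = 1" using assms by (simp add: ennreal_mult[symmetric] del: ennreal_1)
      ultimately show ?thesis using assms by (simp add: ennreal_mult[symmetric] del: ennreal_numeral)
    qed
    also have "ennreal (exp (- (t\<^sup>2)/2) / t\<^sup>2) * ennreal (2/t) = ennreal (2 * exp (- (t\<^sup>2)/2) / t ^ 3)"
      using assms by (simp add: ennreal_mult[symmetric] power2_eq_square power3_eq_cube mult_ac)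
    finally show ?thesis .
  qed
  have refl': "(\<integral>\<^sup>+z. ennreal (std_normal_density z * (max (- z - t) 0)\<^sup>2) \<partial>lborel) = (\<integral>\<^sup>+z. ennreal (?f z) \<partial>lborel)"
    using nn_integral_real_affine[of "\<lambda>z. ennreal (?f z)" "-1" 0] by (simp add: std_normal_density_def)
  have "(\<integral>\<^sup>+z. ennreal ((soft_threshold t z)\<^sup>2) \<partial>std_normal_distribution) =
     (\<integral>\<^sup>+z. ennreal (?f z) + ennreal (std_normal_density z * (max (- z - t) 0)\<^sup>2) \<partial>lborel)"
    using assms by (subst nn_integral_density)
      (auto simp: soft_threshold_sq ennreal_mult[symmetric] ennreal_plus[symmetric] distrib_left simp del: ennreal_plus intro!: nn_integral_cong)
  also have "\<dots> = (\<integral>\<^sup>+z. ennreal (?f z) \<partial>lborel) + (\<integral>\<^sup>+z. ennreal (?f z) \<partial>lborel)"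
    by (subst nn_integral_add) (auto simp: refl')
  also have "\<dots> \<le> ennreal (2 * exp (- (t\<^sup>2)/2) / t ^ 3) + ennreal (2 * exp (- (t\<^sup>2)/2) / t ^ 3)"
    by (intro add_mono half)
  also have "\<dots> = ennreal (4 * exp (- (t\<^sup>2)/2) / t ^ 3)"
    using assms by (simp add: ennreal_plus[symmetric] add_divide_distrib[symmetric] del: ennreal_plus)
  finally show ?thesis .
qed

lemma soft_threshold_dist: "t \<ge> 0 \<Longrightarrow> \<bar>soft_threshold t x - x\<bar> \<le> t"
  unfolding soft_threshold_def by (auto simp: sgn_if max_def abs_if)

lemma soft_threshold_lipschitz: "t \<ge> 0 \<Longrightarrow> \<bar>soft_threshold t x - soft_threshold t y\<bar> \<le> \<bar>x - y\<bar>"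
  unfolding soft_threshold_def by (auto simp: sgn_if max_def abs_if)

lemma sq_sum2: "(a + b)\<^sup>2 \<le> 2 * a\<^sup>2 + 2 * (b::real)\<^sup>2"
  using sum_squares_bound[of a b] by (simp add: power2_sum)

text \<open>The first bound compares with the observation, from which the rule departs by at most
  \<open>t\<close>; it serves large \<theta>. The second compares with the rule at mean zero through
  the Lipschitz property; it serves small \<theta>.\<close>

lemma soft_threshold_loss:
  assumes "t \<ge> 0"
  shows "(soft_threshold t (\<theta> + z) - \<theta>)\<^sup>2 \<le> 2 * z\<^sup>2 + 2 * t\<^sup>2"
    and "(soft_threshold t (\<theta> + z) - \<theta>)\<^sup>2 \<le> 2 * (soft_threshold t z)\<^sup>2 + 8 * \<theta>\<^sup>2"
proof -
  have "(soft_threshold t (\<theta> + z) - (\<theta> + z))\<^sup>2 \<le> t\<^sup>2"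
    using soft_threshold_dist[OF assms, of "\<theta>+z"] assms by (simp add: abs_le_square_iff[symmetric])
  then show "(soft_threshold t (\<theta> + z) - \<theta>)\<^sup>2 \<le> 2 * z\<^sup>2 + 2 * t\<^sup>2"
    using sq_sum2[of z "soft_threshold t (\<theta> + z) - (\<theta> + z)"] by simp
  have "\<bar>soft_threshold t (\<theta> + z) - soft_threshold t z - \<theta>\<bar> \<le> 2 * \<bar>\<theta>\<bar>"
    using soft_threshold_lipschitz[OF assms, of "\<theta>+z" z] by linarith
  then have "(soft_threshold t (\<theta> + z) - soft_threshold t z - \<theta>)\<^sup>2 \<le> 4 * \<theta>\<^sup>2"
    using abs_le_square_iff[of "soft_threshold t (\<theta> + z) - soft_threshold t z - \<theta>" "2*\<theta>"] by (simp add: power_mult_distrib abs_mult)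
  then show "(soft_threshold t (\<theta> + z) - \<theta>)\<^sup>2 \<le> 2 * (soft_threshold t z)\<^sup>2 + 8 * \<theta>\<^sup>2"
    using sq_sum2[of "soft_threshold t z" "soft_threshold t (\<theta> + z) - soft_threshold t z - \<theta>"] by simp
qed

lemma nn_integral_std_normal_affine:
  assumes [measurable]: "g \<in> borel_measurable borel" and "\<And>z. 0 \<le> g z" "a \<ge> 0" "b \<ge> 0"
  shows "(\<integral>\<^sup>+z. ennreal (a * g z + b) \<partial>std_normal_distribution) =
    ennreal a * (\<integral>\<^sup>+z. ennreal (g z) \<partial>std_normal_distribution) + ennreal b"
proof -
  interpret prob_space std_normal_distribution by (rule prob_space_normal_density) simp
  have "(\<integral>\<^sup>+z. ennreal (a * g z + b) \<partial>std_normal_distribution) = (\<integral>\<^sup>+z. ennreal a * ennreal (g z) + ennreal b \<partial>std_normal_distribution)"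
    using assms by (intro nn_integral_cong) (auto simp: ennreal_mult)
  also have "\<dots> = ennreal a * (\<integral>\<^sup>+z. ennreal (g z) \<partial>std_normal_distribution) + ennreal b"
    by (subst nn_integral_add) (auto simp: nn_integral_cmult emeasure_space_1[simplified])
  finally show ?thesis .
qed

text \<open>The two bounds of \<open>soft_threshold_loss\<close> on either side of
  \<open>\<theta>\<^sup>2 = 1\<close>; \<open>16\<close> is twice the bound \<open>8\<close> for the
  Gaussian second moment. \<open>R\<close> is a parameter because the sharp risk at zero is inserted
  for the threshold that the estimator applies, and the weak one for a competing threshold.\<close>

lemma soft_threshold_risk:
  assumes t: "t \<ge> 0" and R: "(\<integral>\<^sup>+z. ennreal ((soft_threshold t z)\<^sup>2) \<partial>std_normal_distribution) \<le> ennreal R" "R \<ge> 0"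
  shows "(\<integral>\<^sup>+z. ennreal ((soft_threshold t (\<theta> + z) - \<theta>)\<^sup>2) \<partial>std_normal_distribution)
    \<le> ennreal (2 * R + (16 + 2 * t\<^sup>2) * min (\<theta>\<^sup>2) 1)"
proof (cases "\<theta>\<^sup>2 \<le> 1")
  case True
  have "(\<integral>\<^sup>+z. ennreal ((soft_threshold t (\<theta> + z) - \<theta>)\<^sup>2) \<partial>std_normal_distribution) \<le>
    (\<integral>\<^sup>+z. ennreal (2 * (soft_threshold t z)\<^sup>2 + 8 * \<theta>\<^sup>2) \<partial>std_normal_distribution)"
    by (intro nn_integral_mono ennreal_leI soft_threshold_loss t)
  also have "\<dots> = ennreal 2 * (\<integral>\<^sup>+z. ennreal ((soft_threshold t z)\<^sup>2) \<partial>std_normal_distribution) + ennreal (8 * \<theta>\<^sup>2)"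
    by (rule nn_integral_std_normal_affine) auto
  also have "\<dots> \<le> ennreal 2 * ennreal R + ennreal (8 * \<theta>\<^sup>2)"
    by (intro add_right_mono mult_left_mono R) auto
  also have "\<dots> = ennreal (2 * R + 8 * \<theta>\<^sup>2)" using R(2)
    by (simp add: ennreal_mult[symmetric] ennreal_plus[symmetric] del: ennreal_plus ennreal_numeral)
  also have "\<dots> \<le> ennreal (2 * R + (16 + 2 * t\<^sup>2) * min (\<theta>\<^sup>2) 1)"
    using True by (intro ennreal_leI) (auto simp: min_def intro!: mult_right_mono)
  finally show ?thesis .
next
  case False
  have "(\<integral>\<^sup>+z. ennreal ((soft_threshold t (\<theta> + z) - \<theta>)\<^sup>2) \<partial>std_normal_distribution) \<le>
    (\<integral>\<^sup>+z. ennreal (2 * z\<^sup>2 + 2 * t\<^sup>2) \<partial>std_normal_distribution)"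
    by (intro nn_integral_mono ennreal_leI soft_threshold_loss t)
  also have "\<dots> = ennreal 2 * (\<integral>\<^sup>+z. ennreal (z\<^sup>2) \<partial>std_normal_distribution) + ennreal (2 * t\<^sup>2)"
    by (rule nn_integral_std_normal_affine) auto
  also have "\<dots> \<le> ennreal 2 * 8 + ennreal (2 * t\<^sup>2)"
    by (intro add_right_mono mult_left_mono std_normal_moment2) auto
  also have "\<dots> = ennreal (16 + 2 * t\<^sup>2)"
    by (simp add: ennreal_mult[symmetric] ennreal_plus[symmetric] ennreal_numeral[symmetric] del: ennreal_plus ennreal_numeral)
  also have "\<dots> \<le> ennreal (2 * R + (16 + 2 * t\<^sup>2) * min (\<theta>\<^sup>2) 1)"
    using False R by (intro ennreal_leI) (auto simp: min_def)
  finally show ?thesis .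
qed

section \<open>The empirical Bayes rule at a fixed point\<close>

definition bw :: "nat \<Rightarrow> real" where
  "bw n = sqrt (2 * ln (real n))"

text \<open>Marginal density of an observation whose mean is drawn from the empirical distribution
  of \<theta>: the target of \<open>geb_density\<close>. \<open>mixture'\<close> is its derivative,
  since the normal density has derivative \<open>- v\<close> times itself.\<close>

definition mixture :: "nat \<Rightarrow> (nat \<Rightarrow> real) \<Rightarrow> real \<Rightarrow> real" where
  "mixture n \<theta> x = (\<Sum>i=1..n. std_normal_density (x - \<theta> i)) / n"

definition mixture' :: "nat \<Rightarrow> (nat \<Rightarrow> real) \<Rightarrow> real \<Rightarrow> real" where
  "mixture' n \<theta> x = (\<Sum>i=1..n. - (x - \<theta> i) * std_normal_density (x - \<theta> i)) / n"

definition geb_shrink :: "real \<Rightarrow> nat \<Rightarrow> (nat \<Rightarrow> real) \<Rightarrow> real \<Rightarrow> real" where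
  "geb_shrink \<rho> n u x = x + deriv (geb_density n u) x / max \<rho> (geb_density n u x)"

text \<open>What \<open>geb_shrink\<close> would be if the density estimate were exact. The
  regularisation \<rho> is kept so that one ratio bound compares the two rules.\<close>

definition oracle_shrink :: "real \<Rightarrow> nat \<Rightarrow> (nat \<Rightarrow> real) \<Rightarrow> real \<Rightarrow> real" where
  "oracle_shrink \<rho> n \<theta> x = x + mixture' n \<theta> x / max \<rho> (mixture n \<theta> x)"

lemma bw_sq: "n \<ge> 1 \<Longrightarrow> (bw n)\<^sup>2 = 2 * ln (real n)"
  unfolding bw_def by simp

lemma bw_ge_1: assumes "n \<ge> 2" shows "bw n \<ge> 1"
proof -
  have "ln 2 \<le> ln (real n)" using assms by simp
  then have "1 \<le> 2 * ln (real n)" using ln2_ge_two_thirds by linarith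
  then show ?thesis unfolding bw_def by simp
qed

lemma exp_bw: assumes "n \<ge> 1" shows "exp (- (bw n)\<^sup>2 / 4) = 1 / sqrt n" "exp (- (bw n)\<^sup>2 / 2) = 1 / n"
  "exp (- (bw n)\<^sup>2) = 1 / (real n)\<^sup>2"
proof -
  have a: "exp (- ln (real n)) = 1 / n" using assms by (simp add: exp_minus inverse_eq_divide)
  show "exp (- (bw n)\<^sup>2 / 2) = 1 / n" using a by (simp add: bw_sq[OF assms])
  have "exp (- (bw n)\<^sup>2 / 4) = exp (- (ln (real n) / 2))" by (simp add: bw_sq[OF assms])
  also have "ln (real n) / 2 = ln (sqrt n)" using assms by (simp add: ln_sqrt)
  also have "exp (- ln (sqrt n)) = 1 / sqrt n" using assms by (simp add: exp_minus inverse_eq_divide)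
  finally show "exp (- (bw n)\<^sup>2 / 4) = 1 / sqrt n" .
  have "exp (- (bw n)\<^sup>2) = (exp (- ln (real n)))\<^sup>2" by (simp add: bw_sq[OF assms] exp_double[symmetric])
  then show "exp (- (bw n)\<^sup>2) = 1 / (real n)\<^sup>2" unfolding a by (simp add: power_divide)
qed

lemma geb_density_eq:
  assumes "n \<ge> 2" shows "geb_density n u x = (\<Sum>i=1..n. kern (bw n) (x - u i)) / n"
  using bw_ge_1[OF assms] unfolding geb_density_def bw_def[symmetric]
  by (simp add: kern_eq_sinc sum_distrib_left[symmetric])

lemma deriv_geb_density:
  assumes "n \<ge> 2" shows "deriv (geb_density n u) x = (\<Sum>i=1..n. kern' (bw n) (x - u i)) / n"
proof -
  have "geb_density n u = (\<lambda>x. (\<Sum>i=1..n. kern (bw n) (x - u i)) / n)"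
    using geb_density_eq[OF assms] by (simp add: fun_eq_iff)
  moreover have "((\<lambda>x. (\<Sum>i=1..n. kern (bw n) (x - u i)) / n) has_real_derivative
     (\<Sum>i=1..n. kern' (bw n) (x - u i)) / n) (at x)"
  proof -
    have "((\<lambda>x. kern (bw n) (x - u i)) has_real_derivative kern' (bw n) (x - u i) * 1) (at x)" for i
      by (rule DERIV_chain2[OF DERIV_kern]) (auto intro!: derivative_eq_intros)
    then have "((\<lambda>x. \<Sum>i=1..n. kern (bw n) (x - u i)) has_real_derivative (\<Sum>i=1..n. kern' (bw n) (x - u i))) (at x)"
      by (intro DERIV_sum) simp
    then show ?thesis by (rule DERIV_cdivide)
  qed
  ultimately show ?thesis by (simp add: DERIV_imp_deriv)
qed

lemma mixture_nonneg: "mixture n \<theta> x \<ge> 0"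
  unfolding mixture_def by (intro divide_nonneg_nonneg sum_nonneg) auto

lemma mixture_pos: "n \<ge> 1 \<Longrightarrow> mixture n \<theta> x > 0"
  unfolding mixture_def by (intro divide_pos_pos sum_pos) (auto simp: normal_density_pos)

lemma mixture_le_1: assumes "n \<ge> 1" shows "mixture n \<theta> x \<le> 1"
proof -
  have "(\<Sum>i=1..n. std_normal_density (x - \<theta> i)) \<le> real (card {1..n}) * 1"
    by (rule sum_bounded_above) (rule std_normal_le_1)
  then show ?thesis using assms by (simp add: mixture_def)
qed

lemma abs_x_std_normal: "\<bar>v\<bar> * std_normal_density v \<le> exp (- v\<^sup>2 / 4)"
proof -
  have "\<bar>v\<bar> \<le> 1 + v\<^sup>2 / 4"
    using zero_le_power2[of "\<bar>v\<bar>/2 - 1"] by (simp add: power2_diff power_divide)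
  then have v: "\<bar>v\<bar> \<le> exp (v\<^sup>2/4)" using exp_ge_add_one_self[of "v\<^sup>2/4"] by linarith
  have "1 \<le> sqrt (2 * pi)" using pi_gt3 by (simp add: real_le_rsqrt)
  then have "std_normal_density v \<le> 1 * exp (- v\<^sup>2/2)"
    unfolding std_normal_density_def by (intro mult_right_mono) auto
  then have "\<bar>v\<bar> * std_normal_density v \<le> exp (v\<^sup>2/4) * exp (- v\<^sup>2/2)"
    using v by (intro mult_mono) auto
  also have "\<dots> = exp (- v\<^sup>2/4)" by (simp add: mult_exp_exp)
  finally show ?thesis .
qed

lemma abs_x_std_normal_le_1: "\<bar>v * std_normal_density v\<bar> \<le> 1"
proof -
  have "exp (- v\<^sup>2 / 4) \<le> 1" by simp
  with abs_x_std_normal[of v] have "\<bar>v\<bar> * std_normal_density v \<le> 1" by linarith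
  then show ?thesis by (simp add: abs_mult)
qed

lemma abs_mixture'_le_1: assumes "n \<ge> 1" shows "\<bar>mixture' n \<theta> x\<bar> \<le> 1"
proof -
  have "\<bar>\<Sum>i=1..n. - (x - \<theta> i) * std_normal_density (x - \<theta> i)\<bar> \<le> (\<Sum>i=1..n. \<bar>- (x - \<theta> i) * std_normal_density (x - \<theta> i)\<bar>)"
    by (rule sum_abs)
  also have "\<dots> \<le> real (card {1..n}) * 1"
  proof (rule sum_bounded_above)
    show "\<bar>- (x - \<theta> i) * std_normal_density (x - \<theta> i)\<bar> \<le> 1" for i
      using abs_x_std_normal_le_1[of "x - \<theta> i"] by (simp add: abs_mult abs_minus_commute)
  qed
  finally show ?thesis using assms by (simp add: mixture'_def)
qed

text \<open>Terms with \<open>\<bar>v\<bar> \<le> 2 * bw n\<close> are bounded directly. Beyond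
  that, \<open>\<bar>v\<bar>\<close> times the density is at most
  \<open>exp (- v\<^sup>2 / 4)\<close>, hence at most
  \<open>exp (- (bw n)\<^sup>2) = 1 / n\<^sup>2\<close>.\<close>

lemma abs_mixture'_le:
  assumes "n \<ge> 2" shows "\<bar>mixture' n \<theta> x\<bar> \<le> 2 * bw n * mixture n \<theta> x + 1 / n"
proof -
  have L: "bw n \<ge> 1" using bw_ge_1[OF assms] .
  have t: "\<bar>- v * std_normal_density v\<bar> \<le> 2 * bw n * std_normal_density v + 1 / n" for v
  proof (cases "\<bar>v\<bar> \<le> 2 * bw n")
    case True
    then have "\<bar>v\<bar> * std_normal_density v \<le> 2 * bw n * std_normal_density v" by (intro mult_right_mono) auto
    then show ?thesis by (simp add: abs_mult add_increasing2)
  next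
    case False
    then have "(2 * bw n)\<^sup>2 \<le> \<bar>v\<bar>\<^sup>2" using L by (intro power_mono) auto
    then have "exp (- v\<^sup>2/4) \<le> exp (- (bw n)\<^sup>2)" by (simp add: power_mult_distrib)
    also have "\<dots> = 1 / (real n)\<^sup>2" using assms by (intro exp_bw) simp
    also have "\<dots> \<le> 1 / n" using assms by (simp add: power2_eq_square field_simps)
    moreover have "0 \<le> 2 * bw n * std_normal_density v" using L by simp
    ultimately show ?thesis using abs_x_std_normal[of v] by (simp add: abs_mult)
  qed
  have "\<bar>\<Sum>i=1..n. - (x - \<theta> i) * std_normal_density (x - \<theta> i)\<bar> \<le> (\<Sum>i=1..n. 2 * bw n * std_normal_density (x - \<theta> i) + 1 / n)"
    by (rule order_trans[OF sum_abs]) (intro sum_mono t)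
  also have "\<dots> = 2 * bw n * (\<Sum>i=1..n. std_normal_density (x - \<theta> i)) + 1"
    using assms by (simp add: sum.distrib sum_distrib_left)
  finally have "\<bar>mixture' n \<theta> x\<bar> \<le> (2 * bw n * (\<Sum>i=1..n. std_normal_density (x - \<theta> i)) + 1) / n"
    by (simp add: mixture'_def divide_right_mono)
  then show ?thesis by (simp add: mixture_def add_divide_distrib)
qed

text \<open>With \<open>m\<close> and \<open>q\<close> for the two denominators, the difference is
  \<open>((a - a0) + (a0 / q) * (q - m)) / m\<close>, and \<open>a0 / q\<close> is at most
  \<open>K\<close> in absolute value. The denominator left over is the random one, which is bounded
  below by \<rho> always and by half the true density with high probability.\<close>

lemma shrink_ratio_bound:
  fixes a b a0 b0 \<rho> K :: real
  assumes "\<rho> > 0" and K: "\<bar>a0\<bar> \<le> K * max \<rho> b0"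
  shows "(a / max \<rho> b - a0 / max \<rho> b0)\<^sup>2 \<le> 2 * ((a - a0)\<^sup>2 + K\<^sup>2 * (b - b0)\<^sup>2) / (max \<rho> b)\<^sup>2"
proof -
  let ?m = "max \<rho> b" and ?q = "max \<rho> b0"
  have p: "?m > 0" "?q > 0" using assms by auto
  have K0: "K \<ge> 0" using K p by (smt (verit) mult_neg_pos)
  have e: "a / ?m - a0 / ?q = ((a - a0) + (a0 / ?q) * (?q - ?m)) / ?m"
    using p by (simp add: field_simps)
  have "\<bar>a0 / ?q\<bar> \<le> K" using K p by (simp add: abs_divide field_simps)
  moreover have "\<bar>?q - ?m\<bar> \<le> \<bar>b - b0\<bar>" by linarith
  ultimately have "\<bar>(a0 / ?q) * (?q - ?m)\<bar> \<le> K * \<bar>b - b0\<bar>"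
    unfolding abs_mult by (intro mult_mono K0) auto
  then have "((a0 / ?q) * (?q - ?m))\<^sup>2 \<le> (K * \<bar>b - b0\<bar>)\<^sup>2"
    by (metis abs_ge_zero power2_abs power_mono)
  then have "((a - a0) + (a0 / ?q) * (?q - ?m))\<^sup>2 \<le> 2 * ((a - a0)\<^sup>2 + K\<^sup>2 * (b - b0)\<^sup>2)"
    using sq_sum2[of "a - a0" "(a0 / ?q) * (?q - ?m)"] by (simp add: power_mult_distrib)
  then show ?thesis unfolding e power_divide by (intro divide_right_mono) auto
qed

section \<open>One level of standardised observations and the concentration of its kernel
  sums\<close>

locale gauss_level = prob_space M for M :: "'w measure" +
  fixes Z :: "nat \<Rightarrow> 'w \<Rightarrow> real" and n :: nat
  assumes indep: "indep_vars (\<lambda>_. borel) Z {1..n}"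
    and dist: "\<And>i. i \<in> {1..n} \<Longrightarrow> distributed M lborel (Z i) std_normal_density"
    and n2: "n \<ge> 2"
begin

abbreviation L where "L \<equiv> bw n"

lemma L1: "L \<ge> 1" using bw_ge_1[OF n2] .

lemma Z_measurable[measurable (raw)]: "i \<in> {1..n} \<Longrightarrow> Z i \<in> borel_measurable M"
  using indep by (auto simp: indep_vars_def)

lemma expectation_Z:
  assumes "i \<in> {1..n}" and [measurable]: "g \<in> borel_measurable borel"
  shows "expectation (\<lambda>\<omega>. g (Z i \<omega>)) = (\<integral>z. std_normal_density z * g z \<partial>lborel)"
  using distributed_integral[OF dist[OF assms(1)], of g] by simp

text \<open>All but the \<open>k\<close>-th observation are random, and the estimator is evaluated at that observation.\<close>

definition obs :: "(nat \<Rightarrow> real) \<Rightarrow> nat \<Rightarrow> real \<Rightarrow> 'w \<Rightarrow> nat \<Rightarrow> real" where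
  "obs \<theta> k y \<omega> i = \<theta> i + (if i = k then y else Z i \<omega>)"

lemma obs_concentration:
  fixes h \<psi> :: "real \<Rightarrow> real" and B b bz :: real
  assumes k: "k \<in> {1..n}" and x: "x = \<theta> k + y"
    and h[measurable]: "h \<in> borel_measurable borel" and hB: "\<And>t. \<bar>h t\<bar> \<le> B"
    and bias: "\<And>t. \<bar>(\<integral>z. std_normal_density z * h (t - z) \<partial>lborel) - \<psi> t\<bar> \<le> b"
    and bz: "\<And>t. \<bar>h 0 - \<psi> t\<bar> \<le> bz"
  defines "S \<equiv> \<lambda>\<omega>. \<Sum>i=1..n. h (x - obs \<theta> k y \<omega> i)" and "m \<equiv> \<Sum>i=1..n. \<psi> (x - \<theta> i)"
  shows "S \<in> borel_measurable M"
    and "expectation (\<lambda>\<omega>. (S \<omega> - m)\<^sup>2) \<le> 8 * n * B\<^sup>2 + 2 * (n * b + bz)\<^sup>2"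
    and "B > 0 \<Longrightarrow> t \<ge> 0 \<Longrightarrow> prob {\<omega> \<in> space M. S \<omega> \<le> m - (n * b + bz) - t} \<le> exp (- t\<^sup>2 / (2 * n * B\<^sup>2))"
proof -
  define Y where "Y i \<omega> = h (x - obs \<theta> k y \<omega> i)" for i \<omega>
  have Y_eq: "Y i = (if i = k then (\<lambda>\<omega>. h 0) else (\<lambda>\<omega>. h (x - \<theta> i - Z i \<omega>)))" for i
    by (auto simp: Y_def obs_def x fun_eq_iff algebra_simps)
  have indY: "indep_vars (\<lambda>_. borel) Y {1..n}"
  proof -
    have "Y i = (\<lambda>\<omega>. (if i = k then (\<lambda>_. h 0) else (\<lambda>z. h (x - \<theta> i - z))) (Z i \<omega>))" for i
      by (simp add: Y_eq)
    moreover have "indep_vars (\<lambda>_. borel) (\<lambda>i \<omega>. (if i = k then (\<lambda>_. h 0) else (\<lambda>z. h (x - \<theta> i - z))) (Z i \<omega>)) {1..n}"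
      by (rule indep_vars_compose2[OF indep]) auto
    ultimately show ?thesis by presburger
  qed
  have Ym[measurable (raw)]: "i \<in> {1..n} \<Longrightarrow> Y i \<in> borel_measurable M" for i
    using indY by (auto simp: indep_vars_def)
  have S: "S = (\<lambda>\<omega>. \<Sum>i=1..n. Y i \<omega>)" by (simp add: S_def Y_def)
  show Sm[measurable]: "S \<in> borel_measurable M" unfolding S by measurable
  have YB: "\<bar>Y i \<omega>\<bar> \<le> B" for i \<omega> using hB by (simp add: Y_def)
  define \<mu> where "\<mu> = (\<Sum>i=1..n. expectation (Y i))"
  have B0: "B \<ge> 0" "b \<ge> 0" using hB[of 0] bias[of 0] by linarith+
  have bd: "\<bar>expectation (Y i) - \<psi> (x - \<theta> i)\<bar> \<le> (if i = k then bz else b)" if i: "i \<in> {1..n}" for i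
  proof (cases "i = k")
    case True
    then show ?thesis using bz[of "x - \<theta> i"] by (simp add: Y_eq prob_space)
  next
    case False
    then have "expectation (Y i) = (\<integral>z. std_normal_density z * h (x - \<theta> i - z) \<partial>lborel)"
      using expectation_Z[OF i, of "\<lambda>z. h (x - \<theta> i - z)"] by (simp add: Y_eq)
    then show ?thesis using bias[of "x - \<theta> i"] False by simp
  qed
  have "\<bar>\<mu> - m\<bar> \<le> (\<Sum>i=1..n. if i = k then bz else b)"
    unfolding \<mu>_def m_def sum_subtractf[symmetric] by (intro order_trans[OF sum_abs] sum_mono bd)
  also have "\<dots> \<le> (\<Sum>i=1..n. b + (if i = k then bz else 0))" using B0 by (intro sum_mono) auto
  also have "\<dots> = n * b + bz" using k by (simp add: sum.distrib)
  finally have bias': "\<bar>\<mu> - m\<bar> \<le> n * b + bz" .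
  have Sb: "\<bar>S \<omega>\<bar> \<le> n * B" for \<omega>
    unfolding S using YB by (intro order_trans[OF sum_abs] order_trans[OF sum_bounded_above[of _ _ B]]) auto
  have int: "integrable M (\<lambda>\<omega>. (S \<omega> - c)\<^sup>2)" for c
  proof (rule integrable_const_bound[where B="(n * B + \<bar>c\<bar>)\<^sup>2"])
    have "(S \<omega> - c)\<^sup>2 \<le> (n * B + \<bar>c\<bar>)\<^sup>2" for \<omega>
      using Sb[of \<omega>] B0 by (intro abs_le_square_iff[THEN iffD1]) auto
    then show "AE \<omega> in M. norm ((S \<omega> - c)\<^sup>2) \<le> (n * B + \<bar>c\<bar>)\<^sup>2" by simp
  qed simp
  have "expectation (\<lambda>\<omega>. (S \<omega> - m)\<^sup>2) \<le> expectation (\<lambda>\<omega>. 2 * (S \<omega> - \<mu>)\<^sup>2 + 2 * (\<mu> - m)\<^sup>2)"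
  proof (intro integral_mono int)
    show "(S \<omega> - m)\<^sup>2 \<le> 2 * (S \<omega> - \<mu>)\<^sup>2 + 2 * (\<mu> - m)\<^sup>2" for \<omega>
      using sq_sum2[of "S \<omega> - \<mu>" "\<mu> - m"] by simp
  qed (use int in auto)
  also have "\<dots> = 2 * expectation (\<lambda>\<omega>. (S \<omega> - \<mu>)\<^sup>2) + 2 * (\<mu> - m)\<^sup>2" using int by (simp add: prob_space)
  also have "expectation (\<lambda>\<omega>. (S \<omega> - \<mu>)\<^sup>2) \<le> card {1..n} * (2 * B)\<^sup>2"
    unfolding S \<mu>_def by (rule variance_indep_sum[OF _ indY]) (use YB in auto)
  also have "(\<mu> - m)\<^sup>2 \<le> (n * b + bz)\<^sup>2"
    using bias' by (metis abs_ge_zero power2_abs power_mono)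
  finally show "expectation (\<lambda>\<omega>. (S \<omega> - m)\<^sup>2) \<le> 8 * n * B\<^sup>2 + 2 * (n * b + bz)\<^sup>2"
    by (simp add: power_mult_distrib)
  show "prob {\<omega> \<in> space M. S \<omega> \<le> m - (n * b + bz) - t} \<le> exp (- t\<^sup>2 / (2 * n * B\<^sup>2))" if "B > 0" "t \<ge> 0"
  proof -
    have "prob {\<omega> \<in> space M. S \<omega> \<le> m - (n * b + bz) - t} \<le> prob {\<omega> \<in> space M. S \<omega> \<le> \<mu> - t}"
      using bias' by (intro finite_measure_mono) auto
    also have "\<dots> \<le> exp (- t\<^sup>2 / (2 * card {1..n} * B\<^sup>2))"
      unfolding S \<mu>_def using n2 YB that by (intro hoeffding_bounded(1)[OF _ _ indY]) auto
    finally show ?thesis by simp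
  qed
qed

end

text \<open>Only the order \<open>bw n / sqrt n\<close> of the regularisation enters. The constants
  \<open>c\<close> and \<open>C\<close> will be common to all levels and absorb \<eta> and
  \<open>\<rho>\<^sub>0\<close>.\<close>

locale gauss_level_rho = gauss_level +
  fixes \<rho> c C :: real
  assumes c: "0 < c" "c \<le> 1" and C: "C \<ge> 1"
    and rho: "c * bw n / sqrt n \<le> \<rho>" "\<rho> \<le> C * bw n / sqrt n"
begin

text \<open>\<open>K2 * L\<close> bounds the shift of the oracle rule: \<open>2\<close> stems from
  the main term of \<open>abs_mixture'_le\<close>, and \<open>1 / c\<close> from its remainder
  \<open>1 / n\<close>, measured against \<rho>.\<close>

definition "K2 = 2 + 1 / c"
text \<open>The constant of \<open>expectation_shrink_crude\<close>: \<open>64\<close> is twice the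
  \<open>32\<close> of \<open>expectation_err\<close>, and \<open>c\<^sup>2\<close> comes from the
  lower bound for \<rho>.\<close>

definition "KK = 64 * K2\<^sup>2 / c\<^sup>2"

lemma rho_pos: "\<rho> > 0"
proof -
  have "0 < c * bw n / sqrt n" using c L1 n2 by auto
  then show ?thesis using rho(1) by linarith
qed

lemma K2_ge: "K2 \<ge> 3" using c by (simp add: K2_def)

lemma KK_ge: "KK \<ge> 64 * K2\<^sup>2"
proof -
  have "c\<^sup>2 \<le> 1" using c by (simp add: power_le_one)
  then have "64 * K2\<^sup>2 / 1 \<le> 64 * K2\<^sup>2 / c\<^sup>2" using c by (intro divide_left_mono) auto
  then show ?thesis by (simp add: KK_def)
qed

lemma inv_rho_sq: "1 / \<rho>\<^sup>2 \<le> n / (c\<^sup>2 * L\<^sup>2)"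
proof -
  have "(c * L / sqrt n)\<^sup>2 \<le> \<rho>\<^sup>2" using rho c L1 by (intro power_mono) auto
  moreover have "0 < (c * L / sqrt n)\<^sup>2" using c L1 n2 by auto
  ultimately have "1 / \<rho>\<^sup>2 \<le> 1 / (c * L / sqrt n)\<^sup>2"
    by (intro divide_left_mono mult_pos_pos) (use rho_pos in auto)
  also have "\<dots> = n / (c\<^sup>2 * L\<^sup>2)" using n2 by (simp add: power_divide power_mult_distrib)
  finally show ?thesis .
qed

lemma mixture'_ratio: "\<bar>mixture' n \<theta> x\<bar> \<le> K2 * L * max \<rho> (mixture n \<theta> x)"
proof -
  let ?m = "max \<rho> (mixture n \<theta> x)"
  have sn: "1 \<le> sqrt n" using n2 by simp
  have "1 / n \<le> L * L * sqrt n / n" using L1 sn n2 by (intro divide_right_mono mult_ge1_I) auto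
  also have "\<dots> = L * (1 / c) * (c * L / sqrt n)" using c n2 by (simp add: field_simps real_sqrt_mult_self)
  also have "\<dots> \<le> L * (1 / c) * \<rho>" using rho c L1 by (intro mult_left_mono) auto
  also have "\<dots> \<le> L * (1/c) * ?m" using c L1 by (intro mult_left_mono) auto
  finally have "1 / n \<le> L * (1/c) * ?m" .
  moreover have "2 * L * mixture n \<theta> x \<le> 2 * L * ?m" using L1 by (intro mult_left_mono) auto
  ultimately have "\<bar>mixture' n \<theta> x\<bar> \<le> 2 * L * ?m + L * (1/c) * ?m" using abs_mixture'_le[OF n2, of \<theta> x] by linarith
  then show ?thesis by (simp add: K2_def algebra_simps)
qed

section \<open>The estimated rule against the regularised oracle at a frozen observation\<close>

context
  fixes \<theta> :: "nat \<Rightarrow> real" and k :: nat and x y :: real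
  assumes k: "k \<in> {1..n}" and x: "x = \<theta> k + y"
begin

abbreviation "f \<equiv> mixture n \<theta> x"
abbreviation "f1 \<equiv> mixture' n \<theta> x"
definition "D0 \<omega> = geb_density n (obs \<theta> k y \<omega>) x"
definition "D1 \<omega> = deriv (geb_density n (obs \<theta> k y \<omega>)) x"
text \<open>The numerator of \<open>shrink_ratio_bound\<close> for
  \<open>K = K2 * L\<close>.\<close>

definition "err \<omega> = (D1 \<omega> - f1)\<^sup>2 + (K2 * L)\<^sup>2 * (D0 \<omega> - f)\<^sup>2"

lemma b_kern: "\<bar>(\<integral>z. std_normal_density z * kern L (t - z) \<partial>lborel) - std_normal_density t\<bar> \<le> 1 / sqrt n"
  using kern_bias[of L t] exp_bw(1)[of n] n2 L1 by simp

lemma b_kern': "\<bar>(\<integral>z. std_normal_density z * kern' L (t - z) \<partial>lborel) - (- t * std_normal_density t)\<bar> \<le> 1 / sqrt n"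
  using kern'_bias[of L t] exp_bw(1)[of n] n2 L1 by simp

lemma b0_kern: "\<bar>kern L 0 - std_normal_density t\<bar> \<le> 2 * L"
  using abs_kern_le[of L 0] std_normal_le_1[of t] L1 normal_density_nonneg[of 0 1 t] by linarith

lemma b0_kern': "\<bar>kern' L 0 - (- t * std_normal_density t)\<bar> \<le> 1"
  using abs_x_std_normal_le_1[of t] by simp

lemma D0_eq: "D0 \<omega> = (\<Sum>i=1..n. kern L (x - obs \<theta> k y \<omega> i)) / n"
  unfolding D0_def by (rule geb_density_eq[OF n2])

lemma D1_eq: "D1 \<omega> = (\<Sum>i=1..n. kern' L (x - obs \<theta> k y \<omega> i)) / n"
  unfolding D1_def by (rule deriv_geb_density[OF n2])

lemma kernL[simp]: "\<bar>kern L t\<bar> \<le> L" "\<bar>kern' L t\<bar> \<le> L\<^sup>2"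
  using abs_kern_le[of L t] abs_kern'_le[of L t] L1 by auto

lemmas conc0 = obs_concentration[where h="kern L" and \<psi>=std_normal_density and B=L and b="1 / sqrt n" and bz="2 * L" and x=x and \<theta>=\<theta> and k=k and y=y, OF k x kern_measurable kernL(1) b_kern b0_kern]
lemmas conc1 = obs_concentration[where h="kern' L" and \<psi>="\<lambda>t. - t * std_normal_density t" and B="L\<^sup>2" and b="1 / sqrt n" and bz=1 and x=x and \<theta>=\<theta> and k=k and y=y, OF k x kern'_measurable kernL(2) b_kern' b0_kern']

lemma D_measurable[measurable]: "D0 \<in> borel_measurable M" "D1 \<in> borel_measurable M"
  unfolding D0_eq D1_eq using conc0(1) conc1(1) by measurable

lemma D_bounds: "\<bar>D0 \<omega>\<bar> \<le> L" "\<bar>D1 \<omega>\<bar> \<le> L\<^sup>2"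
proof -
  have "\<bar>\<Sum>i=1..n. kern L (x - obs \<theta> k y \<omega> i)\<bar> \<le> real (card {1..n}) * L"
    by (intro order_trans[OF sum_abs] sum_bounded_above) simp
  then show "\<bar>D0 \<omega>\<bar> \<le> L" unfolding D0_eq using n2 by (simp add: field_simps)
  have "\<bar>\<Sum>i=1..n. kern' L (x - obs \<theta> k y \<omega> i)\<bar> \<le> real (card {1..n}) * L\<^sup>2"
    by (intro order_trans[OF sum_abs] sum_bounded_above) simp
  then show "\<bar>D1 \<omega>\<bar> \<le> L\<^sup>2" unfolding D1_eq using n2 by (simp add: field_simps)
qed

lemma err_nonneg: "err \<omega> \<ge> 0" unfolding err_def by auto

lemma err_bound: "err \<omega> \<le> 8 * K2\<^sup>2 * L ^ 4"
proof -
  have "\<bar>D1 \<omega> - f1\<bar> \<le> 2 * L\<^sup>2"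
    using D_bounds(2)[of \<omega>] abs_mixture'_le_1[of n \<theta> x] n2 one_le_power[OF L1, of 2] by linarith
  then have "(D1 \<omega> - f1)\<^sup>2 \<le> (2 * L\<^sup>2)\<^sup>2" by (metis abs_ge_zero power2_abs power_mono)
  moreover have "\<bar>D0 \<omega> - f\<bar> \<le> 2 * L"
    using D_bounds(1)[of \<omega>] mixture_le_1[of n \<theta> x] mixture_nonneg[of n \<theta> x] n2 L1 by linarith
  then have "(D0 \<omega> - f)\<^sup>2 \<le> (2 * L)\<^sup>2" by (metis abs_ge_zero power2_abs power_mono)
  then have "(K2 * L)\<^sup>2 * (D0 \<omega> - f)\<^sup>2 \<le> (K2 * L)\<^sup>2 * (2 * L)\<^sup>2" by (intro mult_left_mono) auto
  ultimately have "err \<omega> \<le> 4 * L ^ 4 + 4 * K2\<^sup>2 * L ^ 4"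
    unfolding err_def by (simp add: power_mult_distrib algebra_simps power2_eq_square power4_eq_xxxx)
  moreover have "1 * L ^ 4 \<le> K2\<^sup>2 * L ^ 4" using K2_ge by (intro mult_right_mono) (auto simp: one_le_power)
  ultimately show ?thesis by simp
qed

lemma err_integrable: "integrable M err"
proof (rule integrable_const_bound[where B="8 * K2\<^sup>2 * L ^ 4"])
  show "err \<in> borel_measurable M" unfolding err_def[abs_def] by measurable
qed (use err_nonneg err_bound in auto)

text \<open>Variance and squared bias of both kernel sums are of order \<open>n\<close> up to powers
  of \<open>L\<close>, and division by \<open>n\<close> squares to a gain of
  \<open>1 / n\<^sup>2\<close>. The power \<open>L ^ 4\<close> is the squared bound
  \<open>L\<^sup>2\<close> for the derivative of the kernel.\<close>

lemma expectation_err: "expectation err \<le> 32 * K2\<^sup>2 * L ^ 4 / n"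
proof -
  have s: "sqrt n * sqrt n = n" "1 \<le> sqrt n" using n2 by auto
  have ns: "n * (1 / sqrt n) = sqrt n" using s n2 by (simp add: field_simps)
  have L4: "1 \<le> L ^ 4" "1 \<le> L\<^sup>2" using L1 by auto
  have "sqrt n \<le> L * sqrt n" "L \<le> L * sqrt n"
    using mult_right_mono[of 1 L "sqrt n"] mult_left_mono[of 1 "sqrt n" L] s L1 by auto
  then have "sqrt n + 2 * L \<le> 3 * L * sqrt n" by linarith
  then have "(sqrt n + 2 * L)\<^sup>2 \<le> (3 * L * sqrt n)\<^sup>2" using L1 s(2) by (intro power_mono) auto
  then have "2 * (sqrt n + 2 * L)\<^sup>2 \<le> 18 * n * L\<^sup>2" using n2 by (simp add: power_mult_distrib mult_ac)
  then have "expectation (\<lambda>\<omega>. ((\<Sum>i=1..n. kern L (x - obs \<theta> k y \<omega> i)) - (\<Sum>i=1..n. std_normal_density (x - \<theta> i)))\<^sup>2) \<le> 26 * n * L\<^sup>2"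
    using conc0(2) unfolding ns by simp
  then have "expectation (\<lambda>\<omega>. (n * (D0 \<omega> - f))\<^sup>2) \<le> 26 * n * L\<^sup>2"
    using n2 by (simp add: D0_eq mixture_def right_diff_distrib)
  then have e0: "expectation (\<lambda>\<omega>. (D0 \<omega> - f)\<^sup>2) \<le> 26 * L\<^sup>2 / n"
    using n2 unfolding power_mult_distrib by (simp add: power2_eq_square[of "real n"] pos_le_divide_eq mult_ac)
  have "\<bar>sqrt n + 1\<bar> \<le> 2 * sqrt n" using s by simp
  then have "(sqrt n + 1)\<^sup>2 \<le> (2 * sqrt n)\<^sup>2" by (intro power_mono) auto
  then have "2 * (sqrt n + 1)\<^sup>2 \<le> 8 * real n * 1" using n2 by (simp add: power_mult_distrib)
  also have "8 * real n * 1 \<le> 8 * real n * L ^ 4" using L4 by (intro mult_left_mono) auto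
  finally have "2 * (sqrt n + 1)\<^sup>2 \<le> 8 * n * L ^ 4" by simp
  then have "expectation (\<lambda>\<omega>. ((\<Sum>i=1..n. kern' L (x - obs \<theta> k y \<omega> i)) - (\<Sum>i=1..n. - (x - \<theta> i) * std_normal_density (x - \<theta> i)))\<^sup>2) \<le> 16 * n * L ^ 4"
    using conc1(2) unfolding ns by (simp flip: power_mult)
  then have "expectation (\<lambda>\<omega>. (n * (D1 \<omega> - f1))\<^sup>2) \<le> 16 * n * L ^ 4"
    using n2 by (simp add: D1_eq mixture'_def right_diff_distrib)
  then have e1: "expectation (\<lambda>\<omega>. (D1 \<omega> - f1)\<^sup>2) \<le> 16 * L ^ 4 / n"
    using n2 unfolding power_mult_distrib by (simp add: power2_eq_square[of "real n"] pos_le_divide_eq mult_ac)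
  have i: "integrable M (\<lambda>\<omega>. (D1 \<omega> - f1)\<^sup>2)" "integrable M (\<lambda>\<omega>. (D0 \<omega> - f)\<^sup>2)"
  proof -
    have "(D1 \<omega> - f1)\<^sup>2 \<le> err \<omega>" for \<omega> unfolding err_def by simp
    then show "integrable M (\<lambda>\<omega>. (D1 \<omega> - f1)\<^sup>2)"
      by (intro Bochner_Integration.integrable_bound[OF err_integrable]) (auto simp: err_nonneg)
    have "1 \<le> (K2 * L)\<^sup>2" using mult_mono[of 1 K2 1 L] K2_ge L1 by (intro one_le_power) simp
    then have "(D0 \<omega> - f)\<^sup>2 \<le> (K2 * L)\<^sup>2 * (D0 \<omega> - f)\<^sup>2" for \<omega> by (metis mult_right_mono mult_1 zero_le_power2)
    then have "(D0 \<omega> - f)\<^sup>2 \<le> err \<omega>" for \<omega> unfolding err_def by (simp add: add_increasing)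
    then show "integrable M (\<lambda>\<omega>. (D0 \<omega> - f)\<^sup>2)"
      by (intro Bochner_Integration.integrable_bound[OF err_integrable]) (auto simp: err_nonneg)
  qed
  have "expectation err \<le> 16 * L ^ 4 / n + (K2 * L)\<^sup>2 * (26 * L\<^sup>2 / n)"
  proof -
    have "expectation err = expectation (\<lambda>\<omega>. (D1 \<omega> - f1)\<^sup>2) + (K2 * L)\<^sup>2 * expectation (\<lambda>\<omega>. (D0 \<omega> - f)\<^sup>2)"
      unfolding err_def using i by simp
    also have "\<dots> \<le> 16 * L ^ 4 / n + (K2 * L)\<^sup>2 * (26 * L\<^sup>2 / n)"
      using e0 e1 by (intro add_mono mult_left_mono) auto
    finally show ?thesis .
  qed
  also have "\<dots> = (16 + 26 * K2\<^sup>2) * L ^ 4 / n"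
    by (simp add: power_mult_distrib add_divide_distrib[symmetric] power2_eq_square power4_eq_xxxx algebra_simps)
  also have "\<dots> \<le> (32 * K2\<^sup>2) * L ^ 4 / n"
  proof (intro divide_right_mono mult_right_mono)
    have "3\<^sup>2 \<le> K2\<^sup>2" using K2_ge by (intro power_mono) auto
    then show "16 + 26 * K2\<^sup>2 \<le> 32 * K2\<^sup>2" by simp
  qed (use L1 in auto)
  finally show ?thesis by simp
qed

lemma shrink_err: "(geb_shrink \<rho> n (obs \<theta> k y \<omega>) x - oracle_shrink \<rho> n \<theta> x)\<^sup>2 \<le> 2 * err \<omega> / (max \<rho> (D0 \<omega>))\<^sup>2"
  using shrink_ratio_bound[OF rho_pos mixture'_ratio[of \<theta> x], of "D1 \<omega>" "D0 \<omega>"]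
  by (simp add: geb_shrink_def oracle_shrink_def err_def D0_def D1_def)

lemma shrink_err': "(geb_shrink \<rho> n (obs \<theta> k y \<omega>) x - oracle_shrink \<rho> n \<theta> x)\<^sup>2 \<le> 2 * err \<omega> / \<rho>\<^sup>2"
proof -
  have "\<rho>\<^sup>2 \<le> (max \<rho> (D0 \<omega>))\<^sup>2" using rho_pos by (intro power_mono) auto
  then have "2 * err \<omega> / (max \<rho> (D0 \<omega>))\<^sup>2 \<le> 2 * err \<omega> / \<rho>\<^sup>2"
    using rho_pos err_nonneg[of \<omega>] by (intro divide_left_mono) auto
  then show ?thesis using shrink_err[of \<omega>] by linarith
qed

lemma shrink_measurable[measurable]: "(\<lambda>\<omega>. geb_shrink \<rho> n (obs \<theta> k y \<omega>) x) \<in> borel_measurable M"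
  unfolding geb_shrink_def D0_def[symmetric] D1_def[symmetric] by measurable

lemma shrink_integrable: "integrable M (\<lambda>\<omega>. (geb_shrink \<rho> n (obs \<theta> k y \<omega>) x - oracle_shrink \<rho> n \<theta> x)\<^sup>2)"
proof (rule Bochner_Integration.integrable_bound)
  show "integrable M (\<lambda>\<omega>. 2 * err \<omega> / \<rho>\<^sup>2)" using err_integrable by simp
  show "AE \<omega> in M. norm ((geb_shrink \<rho> n (obs \<theta> k y \<omega>) x - oracle_shrink \<rho> n \<theta> x)\<^sup>2) \<le> norm (2 * err \<omega> / \<rho>\<^sup>2)"
    using shrink_err' err_nonneg by auto
qed measurable

text \<open>With \<rho> as the lower bound for the denominator, \<open>1 / \<rho>\<^sup>2\<close> is
  of order \<open>n / L\<^sup>2\<close> and cancels the factor \<open>1 / n\<close> of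
  \<open>expectation_err\<close>. This bound serves the points where the mixture density is too
  small for the finer one.\<close>

lemma expectation_shrink_crude:
  "expectation (\<lambda>\<omega>. (geb_shrink \<rho> n (obs \<theta> k y \<omega>) x - oracle_shrink \<rho> n \<theta> x)\<^sup>2) \<le> KK * L\<^sup>2"
proof -
  have "expectation (\<lambda>\<omega>. (geb_shrink \<rho> n (obs \<theta> k y \<omega>) x - oracle_shrink \<rho> n \<theta> x)\<^sup>2) \<le> expectation (\<lambda>\<omega>. 2 * err \<omega> / \<rho>\<^sup>2)"
    by (intro integral_mono shrink_integrable shrink_err') (use err_integrable in auto)
  also have "\<dots> = 2 * expectation err * (1 / \<rho>\<^sup>2)" by simp
  also have "\<dots> \<le> 2 * (32 * K2\<^sup>2 * L ^ 4 / n) * (n / (c\<^sup>2 * L\<^sup>2))"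
    using expectation_err inv_rho_sq by (intro mult_mono mult_left_mono) (auto intro: integral_nonneg err_nonneg)
  also have "\<dots> = KK * L\<^sup>2" using n2 L1 c by (simp add: KK_def field_simps power2_eq_square power4_eq_xxxx)
  finally show ?thesis .
qed

text \<open>Outside the event \<open>A\<close>, of probability at most \<open>1 / n ^ 4\<close>, the
  density estimate exceeds \<open>f / 2\<close>, which then replaces \<rho> as the lower bound for
  the denominator. The condition on \<open>f\<close> makes the bias \<open>sqrt n + 2 * L\<close> at
  most \<open>n * f / 4\<close> and leaves a deviation of \<open>n * f / 4\<close> to Hoeffding's
  inequality.\<close>

lemma expectation_shrink_fine:
  assumes f: "f \<ge> 16 * L\<^sup>2 / sqrt n"
  shows "expectation (\<lambda>\<omega>. (geb_shrink \<rho> n (obs \<theta> k y \<omega>) x - oracle_shrink \<rho> n \<theta> x)\<^sup>2)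
    \<le> 256 * K2\<^sup>2 * L ^ 4 / (n * f\<^sup>2) + KK * L\<^sup>2 / sqrt n"
proof -
  let ?W = "\<lambda>\<omega>. (geb_shrink \<rho> n (obs \<theta> k y \<omega>) x - oracle_shrink \<rho> n \<theta> x)\<^sup>2"
  define A where "A = {\<omega> \<in> space M. D0 \<omega> \<le> f / 2}"
  have [measurable]: "A \<in> sets M" unfolding A_def by measurable
  have f0: "f > 0" using mixture_pos n2 by simp
  have s: "sqrt n * sqrt n = n" "1 \<le> sqrt n" using n2 by auto
  have ns: "n * (1 / sqrt n) = sqrt n" using s n2 by (simp add: field_simps)
  have W: "?W \<omega> \<le> 8 * err \<omega> / f\<^sup>2 + (16 * K2\<^sup>2 * L ^ 4 / \<rho>\<^sup>2) * indicator A \<omega>" if "\<omega> \<in> space M" for \<omega>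
  proof (cases "\<omega> \<in> A")
    case True
    have "?W \<omega> \<le> 2 * (8 * K2\<^sup>2 * L ^ 4) / \<rho>\<^sup>2"
      using err_bound[of \<omega>] by (intro order_trans[OF shrink_err'] divide_right_mono) auto
    then show ?thesis using True err_nonneg[of \<omega>] by (simp add: add_increasing)
  next
    case False
    then have "D0 \<omega> > f / 2" using that by (auto simp: A_def)
    then have "(f / 2)\<^sup>2 \<le> (max \<rho> (D0 \<omega>))\<^sup>2" using f0 by (intro power_mono) auto
    then have "2 * err \<omega> / (max \<rho> (D0 \<omega>))\<^sup>2 \<le> 2 * err \<omega> / (f / 2)\<^sup>2"
      using f0 err_nonneg[of \<omega>] rho_pos by (intro divide_left_mono mult_pos_pos zero_less_power) auto
    then show ?thesis using False shrink_err[of \<omega>] by (simp add: power_divide)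
  qed
  have "f * n \<ge> 16 * L\<^sup>2 / sqrt n * n" using f by (intro mult_right_mono) auto
  moreover have "16 * L\<^sup>2 / sqrt n * n = 16 * L\<^sup>2 * sqrt n" using arg_cong[OF ns, of "\<lambda>r. 16 * L\<^sup>2 * r"] by simp
  ultimately have fn: "16 * L\<^sup>2 * sqrt n \<le> n * f" by (simp add: mult.commute)
  have LL: "L \<le> L\<^sup>2" "1 \<le> L\<^sup>2" using L1 one_le_power[OF L1, of 2] by (auto simp: power2_eq_square)
  have "L * 1 \<le> L\<^sup>2 * sqrt n" "1 * sqrt n \<le> L\<^sup>2 * sqrt n" using LL s L1 by (intro mult_mono; simp)+
  then have t: "sqrt n + 2 * L \<le> n * f / 4" using fn L1 by linarith
  have "prob A = prob {\<omega> \<in> space M. (\<Sum>i=1..n. kern L (x - obs \<theta> k y \<omega> i)) \<le> n * f / 2}"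
    unfolding A_def D0_eq using n2 by (intro arg_cong[where f=prob] Collect_cong) (auto simp: field_simps)
  also have "\<dots> \<le> prob {\<omega> \<in> space M. (\<Sum>i=1..n. kern L (x - obs \<theta> k y \<omega> i)) \<le> (\<Sum>i=1..n. std_normal_density (x - \<theta> i)) - (n * (1 / sqrt n) + 2 * L) - n * f / 4}"
  proof (rule finite_measure_mono)
    have "(\<Sum>i=1..n. std_normal_density (x - \<theta> i)) = n * f" using n2 by (simp add: mixture_def)
    then show "{\<omega> \<in> space M. (\<Sum>i=1..n. kern L (x - obs \<theta> k y \<omega> i)) \<le> n * f / 2} \<subseteq>
      {\<omega> \<in> space M. (\<Sum>i=1..n. kern L (x - obs \<theta> k y \<omega> i)) \<le> (\<Sum>i=1..n. std_normal_density (x - \<theta> i)) - (n * (1 / sqrt n) + 2 * L) - n * f / 4}"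
      using t unfolding ns by auto
  next
    have [measurable]: "(\<lambda>\<omega>. \<Sum>i=1..n. kern L (x - obs \<theta> k y \<omega> i)) \<in> borel_measurable M" by (rule conc0(1))
    show "{\<omega> \<in> space M. (\<Sum>i=1..n. kern L (x - obs \<theta> k y \<omega> i)) \<le> (\<Sum>i=1..n. std_normal_density (x - \<theta> i)) - (n * (1 / sqrt n) + 2 * L) - n * f / 4} \<in> events"
      by measurable
  qed
  also have "\<dots> \<le> exp (- (n * f / 4)\<^sup>2 / (2 * n * L\<^sup>2))"
    using L1 f0 by (intro conc0(3)) auto
  \<comment> \<open>Since \<open>n * f / 4\<close> is at least
    \<open>4 * L\<^sup>2 * sqrt n\<close>. The result is \<open>1 / n ^ 16\<close>, of which
    \<open>1 / n ^ 4\<close> is kept; that outweighs \<open>1 / \<rho>\<^sup>2\<close>, of order at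
    most \<open>n\<close>, on the event \<open>A\<close>.\<close>
  also have "\<dots> \<le> exp (- (8 * L\<^sup>2))"
  proof -
    have "(4 * L\<^sup>2 * sqrt n)\<^sup>2 \<le> (n * f / 4)\<^sup>2" using fn by (intro power_mono) auto
    then have "16 * L ^ 4 * n / (2 * n * L\<^sup>2) \<le> (n * f / 4)\<^sup>2 / (2 * n * L\<^sup>2)"
      by (intro divide_right_mono) (auto simp: power_mult_distrib power_mult[symmetric])
    moreover have "16 * L ^ 4 * n / (2 * n * L\<^sup>2) = 8 * L\<^sup>2"
      using n2 L1 by (simp add: field_simps power2_eq_square power4_eq_xxxx)
    ultimately show ?thesis by simp
  qed
  also have "\<dots> = (1 / (real n)\<^sup>2) ^ 8"
    using exp_bw(3)[of n] exp_of_nat_mult[of 8 "- L\<^sup>2"] n2 by simp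
  also have "\<dots> \<le> (1 / (real n)\<^sup>2) ^ 2" using n2 by (intro power_decreasing) auto
  finally have PA: "prob A \<le> (1 / (real n)\<^sup>2) ^ 2" .
  have "expectation ?W \<le> expectation (\<lambda>\<omega>. 8 * err \<omega> / f\<^sup>2 + (16 * K2\<^sup>2 * L ^ 4 / \<rho>\<^sup>2) * indicator A \<omega>)"
    using err_integrable by (intro integral_mono shrink_integrable W) (auto intro!: integrable_real_indicator simp: less_top[symmetric])
  also have "\<dots> = 8 * expectation err / f\<^sup>2 + 16 * K2\<^sup>2 * L ^ 4 * (1 / \<rho>\<^sup>2) * prob A"
    using err_integrable by (subst Bochner_Integration.integral_add) (auto intro!: integrable_real_indicator simp: less_top[symmetric])
  also have "\<dots> \<le> 8 * (32 * K2\<^sup>2 * L ^ 4 / n) / f\<^sup>2 + 16 * K2\<^sup>2 * L ^ 4 * (n / (c\<^sup>2 * L\<^sup>2)) * (1 / (real n)\<^sup>2) ^ 2"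
    using expectation_err inv_rho_sq PA
    by (intro add_mono divide_right_mono mult_mono mult_left_mono) (auto intro!: mult_nonneg_nonneg)
  also have "16 * K2\<^sup>2 * L ^ 4 * (n / (c\<^sup>2 * L\<^sup>2)) * (1 / (real n)\<^sup>2) ^ 2 = (KK * L\<^sup>2) * (1 / (4 * real n ^ 3))"
    using n2 L1 c by (simp add: KK_def field_simps power2_eq_square power3_eq_cube power4_eq_xxxx)
  also have "\<dots> \<le> (KK * L\<^sup>2) * (1 / sqrt n)"
  proof (intro mult_left_mono divide_left_mono)
    have "sqrt n \<le> n" using n2 s by (simp add: real_le_lsqrt power2_eq_square)
    also have "\<dots> \<le> 4 * real n ^ 3"
    proof -
      have "real n ^ 1 \<le> real n ^ 3" using n2 by (intro power_increasing) auto
      then have "real n \<le> real n ^ 3" by simp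
      moreover have "0 \<le> real n ^ 3" by simp
      ultimately show ?thesis by linarith
    qed
    finally show "sqrt n \<le> 4 * real n ^ 3" .
    show "0 \<le> KK * L\<^sup>2" using c by (simp add: KK_def)
  qed (use n2 in auto)
  finally show ?thesis by (simp add: field_simps)
qed

end

end

section \<open>Compound risk of the empirical Bayes rule\<close>

text \<open>Moves the noise of one coordinate with mean \<open>a\<close> to the common variable
  \<open>x\<close>. The losses of all coordinates then stand under one integral with Gaussian
  weights and can be compared for each \<open>x\<close> separately.\<close>

lemma nn_integral_std_normal_shift:
  assumes [measurable]: "h \<in> borel_measurable borel" and "\<And>x. 0 \<le> h x"
  shows "(\<integral>\<^sup>+y. ennreal (h (a + y)) \<partial>std_normal_distribution) = (\<integral>\<^sup>+x. ennreal (std_normal_density (x - a) * h x) \<partial>lborel)"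
proof -
  have "(\<integral>\<^sup>+y. ennreal (h (a + y)) \<partial>std_normal_distribution) = (\<integral>\<^sup>+y. ennreal (std_normal_density y * h (a + y)) \<partial>lborel)"
    using assms(2) by (subst nn_integral_density) (auto simp: ennreal_mult)
  also have "\<dots> = (\<integral>\<^sup>+x. ennreal (std_normal_density (x - a) * h x) \<partial>lborel)"
    using nn_integral_real_affine[of "\<lambda>x. ennreal (std_normal_density (x - a) * h x)" 1 a] by simp
  finally show ?thesis .
qed

lemma mixture_measurable[measurable]: "mixture n \<theta> \<in> borel_measurable borel" "mixture' n \<theta> \<in> borel_measurable borel"
  unfolding mixture_def[abs_def] mixture'_def[abs_def] by measurable

lemma sq_sum3: "(a + b + c)\<^sup>2 \<le> 3 * a\<^sup>2 + 3 * b\<^sup>2 + 3 * (c::real)\<^sup>2"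
  using zero_le_power2[of "a - b"] zero_le_power2[of "b - c"] zero_le_power2[of "a - c"]
  by (simp add: power2_eq_square algebra_simps)

text \<open>Tweedie's formula, that is, \<open>oracle_shrink\<close> without regularisation.\<close>

definition bayes_rule :: "nat \<Rightarrow> (nat \<Rightarrow> real) \<Rightarrow> real \<Rightarrow> real" where
  "bayes_rule n \<theta> x = x + mixture' n \<theta> x / mixture n \<theta> x"

text \<open>The Bayes rule is the posterior mean under the empirical prior.\<close>

lemma bayes_rule_optimal:
  assumes "n \<ge> 1"
  shows "(\<Sum>k=1..n. std_normal_density (x - \<theta> k) * (bayes_rule n \<theta> x - \<theta> k)\<^sup>2) \<le>
    (\<Sum>k=1..n. std_normal_density (x - \<theta> k) * (s - \<theta> k)\<^sup>2)"
proof -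
  let ?w = "\<lambda>k. std_normal_density (x - \<theta> k)" and ?t = "bayes_rule n \<theta> x"
  have W: "(\<Sum>k=1..n. ?w k) > 0" using assms by (intro sum_pos) (auto simp: normal_density_pos)
  have "mixture' n \<theta> x / mixture n \<theta> x = (\<Sum>k=1..n. - (x - \<theta> k) * ?w k) / (\<Sum>k=1..n. ?w k)"
    using assms by (simp add: mixture'_def mixture_def)
  then have "?t * (\<Sum>k=1..n. ?w k) = x * (\<Sum>k=1..n. ?w k) + (\<Sum>k=1..n. - (x - \<theta> k) * ?w k)"
    using W by (simp add: bayes_rule_def field_simps)
  also have "\<dots> = (\<Sum>k=1..n. \<theta> k * ?w k)"
    by (simp add: sum_distrib_left sum.distrib[symmetric] algebra_simps)
  finally have t: "?t * (\<Sum>k=1..n. ?w k) = (\<Sum>k=1..n. \<theta> k * ?w k)" .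
  have "(\<Sum>k=1..n. ?w k * (s - \<theta> k)\<^sup>2) =
    (\<Sum>k=1..n. ?w k * (?t - \<theta> k)\<^sup>2 + (s - ?t)\<^sup>2 * ?w k + 2 * (s - ?t) * (?t * ?w k - \<theta> k * ?w k))"
    by (intro sum.cong refl) (simp add: power2_eq_square algebra_simps)
  also have "\<dots> = (\<Sum>k=1..n. ?w k * (?t - \<theta> k)\<^sup>2) + (s - ?t)\<^sup>2 * (\<Sum>k=1..n. ?w k) +
      2 * (s - ?t) * (?t * (\<Sum>k=1..n. ?w k) - (\<Sum>k=1..n. \<theta> k * ?w k))"
    by (simp only: sum.distrib sum_distrib_left[symmetric] sum_subtractf)
  also have "\<dots> = (\<Sum>k=1..n. ?w k * (?t - \<theta> k)\<^sup>2) + (s - ?t)\<^sup>2 * (\<Sum>k=1..n. ?w k)" unfolding t by simp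
  finally show ?thesis using W by simp
qed

text \<open>The weighted sum of \<open>((x - \<theta> k) + r)\<^sup>2\<close> is nonnegative, and
  its expansion at \<open>r = mixture' n \<theta> x / mixture n \<theta> x\<close> is the claim. It
  controls the Bayes shift where the mixture density lies below \<rho>.\<close>

lemma mixture'_cauchy_schwarz:
  assumes "n \<ge> 1"
  shows "n * mixture n \<theta> x * (mixture' n \<theta> x / mixture n \<theta> x)\<^sup>2 \<le>
    (\<Sum>k=1..n. std_normal_density (x - \<theta> k) * (x - \<theta> k)\<^sup>2)"
proof -
  let ?w = "\<lambda>k. std_normal_density (x - \<theta> k)" and ?r = "mixture' n \<theta> x / mixture n \<theta> x"
  have f: "mixture n \<theta> x > 0" by (rule mixture_pos[OF assms])
  have s: "(\<Sum>k=1..n. ?w k) = n * mixture n \<theta> x" "(\<Sum>k=1..n. ?w k * (x - \<theta> k)) = - real n * mixture' n \<theta> x"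
    using assms by (simp_all add: mixture_def mixture'_def sum_negf[symmetric] algebra_simps)
  have e: "(\<Sum>k=1..n. ?w k * ((x - \<theta> k) + r)\<^sup>2) =
    (\<Sum>k=1..n. ?w k * (x - \<theta> k)\<^sup>2) + 2 * r * (\<Sum>k=1..n. ?w k * (x - \<theta> k)) + r\<^sup>2 * (\<Sum>k=1..n. ?w k)" for r
    by (simp add: sum_distrib_left sum.distrib[symmetric] power2_eq_square algebra_simps)
  have "0 \<le> (\<Sum>k=1..n. ?w k * ((x - \<theta> k) + ?r)\<^sup>2)" by (intro sum_nonneg) auto
  also have "\<dots> = (\<Sum>k=1..n. ?w k * (x - \<theta> k)\<^sup>2) - n * mixture n \<theta> x * ?r\<^sup>2"
  proof -
    have "2 * ?r * (- real n * mixture' n \<theta> x) = - 2 * (n * mixture n \<theta> x * ?r\<^sup>2)"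
      using f by (simp add: power2_eq_square)
    then show ?thesis unfolding e s by simp
  qed
  finally show ?thesis by simp
qed

lemma geb_shrink_cong:
  assumes "n \<ge> 2" "\<And>i. i \<in> {1..n} \<Longrightarrow> u i = v i"
  shows "geb_shrink \<rho> n u x = geb_shrink \<rho> n v x"
  unfolding geb_shrink_def geb_density_eq[OF assms(1)] deriv_geb_density[OF assms(1)] using assms(2) by simp

text \<open>Bookkeeping for \<open>geb_risk_fine\<close>, where \<open>X\<close> and
  \<open>Y\<close> are \<open>KK * L ^ 4\<close> and \<open>C * L ^ 4\<close>, and \<open>t\<close>,
  \<open>p\<close>, \<open>e\<close> are \<open>T / sqrt n\<close>, the proportion of large means
  and \<open>exp (- T\<^sup>2 / 16)\<close>.\<close>

lemma sum_weights_le: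
  fixes a1 a2 a3 X Y p e t :: real
  assumes "a1 \<le> 4 * X * p" "a2 \<le> 8 * X * e" "a3 \<le> 4 * X * t"
    and "X \<ge> 0" "Y \<ge> 0" "p \<ge> 0" "e \<ge> 0" "t \<ge> 0"
  shows "a1 + a2 + a3 + (96 * X + 24 * Y) * t \<le> 100 * (X + Y) * (t + p + e)"
proof -
  have "0 \<le> X * p" "0 \<le> Y * p" "0 \<le> X * e" "0 \<le> Y * e" "0 \<le> X * t" "0 \<le> Y * t"
    using assms by auto
  then show ?thesis using assms(1-3) by (simp add: algebra_simps)
qed

section \<open>Oracle inequality for the empirical Bayes rule\<close>

context gauss_level_rho
begin

lemma geb_risk_resample:
  assumes k: "k \<in> {1..n}"
  shows "(\<integral>\<^sup>+\<omega>. ennreal ((geb_shrink \<rho> n (\<lambda>i. \<theta> i + Z i \<omega>) (\<theta> k + Z k \<omega>) - \<theta> k)\<^sup>2) \<partial>M) =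
    (\<integral>\<^sup>+y. (\<integral>\<^sup>+\<omega>. ennreal ((geb_shrink \<rho> n (obs \<theta> k y \<omega>) (\<theta> k + y) - \<theta> k)\<^sup>2) \<partial>M) \<partial>std_normal_distribution)"
proof -
  define G where "G w = ennreal ((geb_shrink \<rho> n (\<lambda>i. \<theta> i + w i) (\<theta> k + w k) - \<theta> k)\<^sup>2)" for w
  have [measurable]: "(\<lambda>w. w i) \<in> borel_measurable (PiM {1..n} (\<lambda>_. borel :: real measure))" if "i \<in> {1..n}" for i
    by (rule measurable_component_singleton[OF that])
  have [measurable]: "(\<lambda>w. w k) \<in> borel_measurable (PiM {1..n} (\<lambda>_. borel :: real measure))" using k by measurable
  have G: "G \<in> borel_measurable (PiM {1..n} (\<lambda>_. borel))"
    unfolding G_def[abs_def] geb_shrink_def geb_density_eq[OF n2] deriv_geb_density[OF n2] by measurable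
  have 1: "G (restrict (\<lambda>i. Z i \<omega>) {1..n}) = ennreal ((geb_shrink \<rho> n (\<lambda>i. \<theta> i + Z i \<omega>) (\<theta> k + Z k \<omega>) - \<theta> k)\<^sup>2)" for \<omega>
    unfolding G_def using k by (subst geb_shrink_cong[OF n2, of _ "\<lambda>i. \<theta> i + Z i \<omega>"]) auto
  have 2: "G ((restrict (\<lambda>i. Z i \<omega>) {1..n})(k := y)) = ennreal ((geb_shrink \<rho> n (obs \<theta> k y \<omega>) (\<theta> k + y) - \<theta> k)\<^sup>2)" for \<omega> y
    unfolding G_def using k by (subst geb_shrink_cong[OF n2, of _ "obs \<theta> k y \<omega>"]) (auto simp: obs_def)
  show ?thesis using nn_integral_indep_resample[OF indep k G dist[OF k]] unfolding 1 2 .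
qed

lemma nn_integral_shrink_affine:
  assumes k: "k \<in> {1..n}" and x: "x = \<theta> k + y" and ab: "a \<ge> 0" "b \<ge> 0"
  shows "(\<integral>\<^sup>+\<omega>. ennreal (a * (geb_shrink \<rho> n (obs \<theta> k y \<omega>) x - oracle_shrink \<rho> n \<theta> x)\<^sup>2 + b) \<partial>M) =
    ennreal (a * expectation (\<lambda>\<omega>. (geb_shrink \<rho> n (obs \<theta> k y \<omega>) x - oracle_shrink \<rho> n \<theta> x)\<^sup>2) + b)"
  using shrink_integrable[where \<theta>=\<theta>, OF k x] ab by (subst nn_integral_eq_integral) (auto simp: prob_space)

text \<open>Valid for every \<theta>: the observation itself has bounded risk, the oracle shift is
  at most \<open>K2 * L\<close>, and the estimated rule is within \<open>KK * L\<^sup>2\<close> of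
  the oracle in mean square.\<close>

lemma geb_risk_crude:
  assumes k: "k \<in> {1..n}"
  shows "(\<integral>\<^sup>+\<omega>. ennreal ((geb_shrink \<rho> n (\<lambda>i. \<theta> i + Z i \<omega>) (\<theta> k + Z k \<omega>) - \<theta> k)\<^sup>2) \<partial>M) \<le> ennreal (10 * KK * L\<^sup>2)"
proof -
  have KL: "0 \<le> 2 * (KK * L\<^sup>2) + 4 * (K2 * L)\<^sup>2" using KK_ge by (smt (verit) mult_nonneg_nonneg zero_le_power2)
  have inner: "(\<integral>\<^sup>+\<omega>. ennreal ((geb_shrink \<rho> n (obs \<theta> k y \<omega>) (\<theta> k + y) - \<theta> k)\<^sup>2) \<partial>M) \<le>
      ennreal (4 * y\<^sup>2 + (2 * (KK * L\<^sup>2) + 4 * (K2 * L)\<^sup>2))" for y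
  proof -
    let ?o = "oracle_shrink \<rho> n \<theta> (\<theta> k + y)" and ?x = "\<theta> k + y"
    let ?r = "mixture' n \<theta> ?x / max \<rho> (mixture n \<theta> ?x)"
    have "\<bar>?r\<bar> \<le> K2 * L" using mixture'_ratio[of \<theta> ?x] rho_pos by (simp add: abs_divide field_simps)
    then have "?r\<^sup>2 \<le> (K2 * L)\<^sup>2" by (metis abs_ge_zero power2_abs power_mono)
    then have o: "(?o - \<theta> k)\<^sup>2 \<le> 2 * y\<^sup>2 + 2 * (K2 * L)\<^sup>2"
      using sq_sum2[of y ?r] by (simp add: oracle_shrink_def)
    have "(geb_shrink \<rho> n (obs \<theta> k y \<omega>) ?x - \<theta> k)\<^sup>2 \<le>
      2 * (geb_shrink \<rho> n (obs \<theta> k y \<omega>) ?x - ?o)\<^sup>2 + (4 * y\<^sup>2 + 4 * (K2 * L)\<^sup>2)" for \<omega>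
      using sq_sum2[of "geb_shrink \<rho> n (obs \<theta> k y \<omega>) ?x - ?o" "?o - \<theta> k"] o by simp
    then have "(\<integral>\<^sup>+\<omega>. ennreal ((geb_shrink \<rho> n (obs \<theta> k y \<omega>) ?x - \<theta> k)\<^sup>2) \<partial>M) \<le>
      (\<integral>\<^sup>+\<omega>. ennreal (2 * (geb_shrink \<rho> n (obs \<theta> k y \<omega>) ?x - ?o)\<^sup>2 + (4 * y\<^sup>2 + 4 * (K2 * L)\<^sup>2)) \<partial>M)"
      by (intro nn_integral_mono ennreal_leI)
    also have "\<dots> = ennreal (2 * expectation (\<lambda>\<omega>. (geb_shrink \<rho> n (obs \<theta> k y \<omega>) ?x - ?o)\<^sup>2) + (4 * y\<^sup>2 + 4 * (K2 * L)\<^sup>2))"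
      by (rule nn_integral_shrink_affine[OF k refl]) auto
    also have "\<dots> \<le> ennreal (4 * y\<^sup>2 + (2 * (KK * L\<^sup>2) + 4 * (K2 * L)\<^sup>2))"
      using expectation_shrink_crude[where \<theta>=\<theta> and x="?x" and y=y, OF k refl] by (intro ennreal_leI) simp
    finally show ?thesis .
  qed
  have "(\<integral>\<^sup>+\<omega>. ennreal ((geb_shrink \<rho> n (\<lambda>i. \<theta> i + Z i \<omega>) (\<theta> k + Z k \<omega>) - \<theta> k)\<^sup>2) \<partial>M) \<le>
    (\<integral>\<^sup>+y. ennreal (4 * y\<^sup>2 + (2 * (KK * L\<^sup>2) + 4 * (K2 * L)\<^sup>2)) \<partial>std_normal_distribution)"
    unfolding geb_risk_resample[OF k] by (intro nn_integral_mono inner)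
  also have "\<dots> = ennreal 4 * (\<integral>\<^sup>+y. ennreal (y\<^sup>2) \<partial>std_normal_distribution) + ennreal (2 * (KK * L\<^sup>2) + 4 * (K2 * L)\<^sup>2)"
    using KL by (intro nn_integral_std_normal_affine) auto
  also have "\<dots> \<le> ennreal 4 * ennreal 8 + ennreal (2 * (KK * L\<^sup>2) + 4 * (K2 * L)\<^sup>2)"
    using std_normal_moment2 by (intro add_right_mono mult_left_mono) auto
  also have "\<dots> = ennreal (4 * 8 + (2 * (KK * L\<^sup>2) + 4 * (K2 * L)\<^sup>2))"
    using KL by (simp add: ennreal_mult[symmetric] ennreal_plus[symmetric] del: ennreal_plus ennreal_numeral)
  also have "\<dots> \<le> ennreal (10 * KK * L\<^sup>2)"
  proof (intro ennreal_leI)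
    have "(K2 * L)\<^sup>2 \<le> KK * L\<^sup>2" unfolding power_mult_distrib using KK_ge by (intro mult_right_mono) (smt (verit) zero_le_power2, auto)
    moreover have "9 * 1 \<le> K2\<^sup>2 * L\<^sup>2"
      using power_mono[of 3 K2 2] K2_ge one_le_power[OF L1, of 2] by (intro mult_mono) auto
    ultimately show "4 * 8 + (2 * (KK * L\<^sup>2) + 4 * (K2 * L)\<^sup>2) \<le> 10 * KK * L\<^sup>2"
      unfolding power_mult_distrib by linarith
  qed
  finally show ?thesis .
qed

lemma KK_pos: "KK > 0" using KK_ge K2_ge by (smt (verit) zero_less_power)

context
  fixes \<theta> :: "nat \<Rightarrow> real" and T :: real and s :: "real \<Rightarrow> real"
  assumes T: "T \<ge> 1" and s[measurable]: "s \<in> borel_measurable borel"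
begin

text \<open>The density level from which \<open>expectation_shrink_fine\<close> applies.\<close>

definition "f0 = 16 * L\<^sup>2 / sqrt n"

definition "err_bound_at x =
  (if mixture n \<theta> x \<ge> f0 then 256 * K2\<^sup>2 * L ^ 4 / (n * (mixture n \<theta> x)\<^sup>2) + KK * L\<^sup>2 / sqrt n else KK * L\<^sup>2)"

definition "out x = (if \<bar>x\<bar> > T then 1 else 0 :: real)"

definition "bayes_loss k x = 3 * err_bound_at x + 3 * (oracle_shrink \<rho> n \<theta> x - bayes_rule n \<theta> x)\<^sup>2 + 3 * (bayes_rule n \<theta> x - \<theta> k)\<^sup>2"

text \<open>The loss is bounded by two parts. This one is integrated against the Gaussian weights;
  \<open>flat_part\<close> is integrated against Lebesgue measure on \<open>{-T..T}\<close> and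
  collects the points where only the smallness of the mixture density keeps the contribution small.
  \<open>s\<close> is an arbitrary competing rule.\<close>

definition "loss_majorant k x = 3 * KK * L\<^sup>2 * (out x + 1 / sqrt n) + 3 * ((x - \<theta> k)\<^sup>2 * (if \<bar>x - \<theta> k\<bar> > 2 * L then 1 else 0))
  + 12 * L\<^sup>2 * out x + 3 * (s x - \<theta> k)\<^sup>2"

definition "flat_part = 3 * real n * KK * L\<^sup>2 * f0 + 12 * L\<^sup>2 * n * \<rho>"

lemma f0_pos: "f0 > 0" using L1 n2 by (auto simp: f0_def intro!: divide_pos_pos)

lemma err_bound_at_nonneg: "err_bound_at x \<ge> 0"
  unfolding err_bound_at_def using KK_pos by auto

lemma bayes_loss_nonneg: "bayes_loss k x \<ge> 0"
  unfolding bayes_loss_def using err_bound_at_nonneg by auto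

lemma loss_measurable[measurable]: "bayes_loss k \<in> borel_measurable borel" "loss_majorant k \<in> borel_measurable borel" "out \<in> borel_measurable borel"
  unfolding bayes_loss_def[abs_def] loss_majorant_def[abs_def] err_bound_at_def oracle_shrink_def bayes_rule_def out_def[abs_def]
  by measurable

lemma expectation_shrink_bound:
  assumes k: "k \<in> {1..n}" and x: "x = \<theta> k + y"
  shows "expectation (\<lambda>\<omega>. (geb_shrink \<rho> n (obs \<theta> k y \<omega>) x - oracle_shrink \<rho> n \<theta> x)\<^sup>2) \<le> err_bound_at x"
  using expectation_shrink_crude[where \<theta>=\<theta>, OF k x] expectation_shrink_fine[where \<theta>=\<theta>, OF k x] by (simp add: err_bound_at_def f0_def)

lemma geb_inner:
  assumes k: "k \<in> {1..n}"
  shows "(\<integral>\<^sup>+\<omega>. ennreal ((geb_shrink \<rho> n (obs \<theta> k y \<omega>) (\<theta> k + y) - \<theta> k)\<^sup>2) \<partial>M) \<le> ennreal (bayes_loss k (\<theta> k + y))"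
proof -
  let ?x = "\<theta> k + y" let ?o = "oracle_shrink \<rho> n \<theta> ?x" let ?b = "3 * (?o - bayes_rule n \<theta> ?x)\<^sup>2 + 3 * (bayes_rule n \<theta> ?x - \<theta> k)\<^sup>2"
  have "(geb_shrink \<rho> n (obs \<theta> k y \<omega>) ?x - \<theta> k)\<^sup>2 \<le> 3 * (geb_shrink \<rho> n (obs \<theta> k y \<omega>) ?x - ?o)\<^sup>2 + ?b" for \<omega>
    using sq_sum3[of "geb_shrink \<rho> n (obs \<theta> k y \<omega>) ?x - ?o" "?o - bayes_rule n \<theta> ?x" "bayes_rule n \<theta> ?x - \<theta> k"] by simp
  then have "(\<integral>\<^sup>+\<omega>. ennreal ((geb_shrink \<rho> n (obs \<theta> k y \<omega>) ?x - \<theta> k)\<^sup>2) \<partial>M) \<le>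
    (\<integral>\<^sup>+\<omega>. ennreal (3 * (geb_shrink \<rho> n (obs \<theta> k y \<omega>) ?x - ?o)\<^sup>2 + ?b) \<partial>M)"
    by (intro nn_integral_mono ennreal_leI)
  also have "\<dots> = ennreal (3 * expectation (\<lambda>\<omega>. (geb_shrink \<rho> n (obs \<theta> k y \<omega>) ?x - ?o)\<^sup>2) + ?b)"
    by (rule nn_integral_shrink_affine[OF k refl]) auto
  also have "\<dots> \<le> ennreal (bayes_loss k ?x)"
    unfolding bayes_loss_def using expectation_shrink_bound[OF k refl] by (intro ennreal_leI) simp
  finally show ?thesis .
qed

text \<open>On \<open>{-T..T}\<close> the main term of error times density stays of order
  \<open>f0\<close>: for \<open>g < f0\<close> by the crude bound, and for \<open>g \<ge> f0\<close>
  because \<open>n * f0\<^sup>2 = 256 * L ^ 4\<close> makes the main error term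
  \<open>K2\<^sup>2 * f0\<^sup>2 / g\<^sup>2\<close>, whose product with \<open>g\<close> decreases
  in \<open>g\<close>. Outside the interval the error itself is at most a multiple of
  \<open>L\<^sup>2\<close>.\<close>

lemma err_mass:
  fixes x g :: real
  defines "g \<equiv> mixture n \<theta> x"
  shows "g * err_bound_at x \<le> KK * L\<^sup>2 * (out x + 1 / sqrt n) * g + KK * L\<^sup>2 * f0 * indicator {-T..T} x"
proof -
  have g: "g > 0" unfolding g_def using n2 by (intro mixture_pos) simp
  have ind: "indicator {-T..T} x = 1 - out x" by (auto simp: out_def split: split_indicator)
  have o: "out x = 0 \<or> out x = 1" by (simp add: out_def)
  have KL: "0 < KK * L\<^sup>2" using KK_pos L1 by simp
  have r: "0 \<le> KK * L\<^sup>2 * (1 / sqrt n) * g" using KL g by simp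
  show ?thesis
  proof (cases "g \<ge> f0")
    case True
    let ?q = "256 * K2\<^sup>2 * L ^ 4 / (n * g\<^sup>2)"
    have nf0: "n * f0\<^sup>2 = 256 * L ^ 4" using n2 by (simp add: f0_def power_divide power_mult_distrib)
    have "f0\<^sup>2 \<le> g\<^sup>2" "f0 * g \<le> g\<^sup>2"
      using True f0_pos g power_mono[of f0 g 2] mult_right_mono[of f0 g g] by (auto simp: power2_eq_square)
    then have a: "256 * L ^ 4 \<le> n * g\<^sup>2" "n * (f0 * g) \<le> n * g\<^sup>2" using nf0 n2 by (metis mult_left_mono of_nat_0_le_iff)+
    have b: "K2\<^sup>2 \<le> KK * L\<^sup>2"
      using mult_mono[of "K2\<^sup>2" KK 1 "L\<^sup>2"] KK_ge one_le_power[OF L1, of 2] KK_pos by (smt (verit) zero_le_power2)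
    have nf: "0 < n * g\<^sup>2" using n2 g by simp
    have "?q \<le> K2\<^sup>2" using a(1) nf mult_left_mono[OF a(1), of "K2\<^sup>2"] by (simp add: pos_divide_le_eq mult_ac)
    then have 1: "?q * g \<le> KK * L\<^sup>2 * g" using b g by (intro mult_right_mono) auto
    have "?q * g = K2\<^sup>2 * (n * f0\<^sup>2) / (n * g\<^sup>2) * g" by (simp add: nf0)
    also have "\<dots> = K2\<^sup>2 * f0 * (f0 / g)" using g n2 by (simp add: power2_eq_square field_simps)
    also have "\<dots> \<le> K2\<^sup>2 * f0 * 1" using True g f0_pos by (intro mult_left_mono) auto
    also have "\<dots> \<le> KK * L\<^sup>2 * f0" using b f0_pos by (simp add: mult_right_mono)
    finally have 2: "?q * g \<le> KK * L\<^sup>2 * f0" .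
    have "g * err_bound_at x = ?q * g + KK * L\<^sup>2 * (1 / sqrt n) * g"
      using True by (simp add: err_bound_at_def g_def[symmetric] algebra_simps)
    then show ?thesis unfolding ind using 1 2 o by (auto simp: algebra_simps)
  next
    case False
    then have "KK * L\<^sup>2 * g \<le> KK * L\<^sup>2 * f0" using KL by (intro mult_left_mono) auto
    then show ?thesis unfolding ind using False o r by (auto simp: err_bound_at_def g_def[symmetric] algebra_simps)
  qed
qed

text \<open>The rules agree where the mixture density reaches \<rho>. Elsewhere their distance is at
  most the Bayes shift, which \<open>mixture'_cauchy_schwarz\<close> bounds by a weighted second
  moment of \<open>x - \<theta> k\<close>. Distances up to \<open>2 * L\<close> contribute
  \<open>4 * L\<^sup>2\<close> times the total weight, at most \<open>n * \<rho>\<close>; longer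
  ones are left to the Gaussian tail.\<close>

lemma oracle_bayes_mass:
  fixes x g :: real
  defines "g \<equiv> mixture n \<theta> x"
  shows "n * g * (oracle_shrink \<rho> n \<theta> x - bayes_rule n \<theta> x)\<^sup>2 \<le>
    (\<Sum>k=1..n. std_normal_density (x - \<theta> k) * ((x - \<theta> k)\<^sup>2 * (if \<bar>x - \<theta> k\<bar> > 2 * L then 1 else 0) + 4 * L\<^sup>2 * out x))
    + 4 * L\<^sup>2 * n * \<rho> * indicator {-T..T} x" (is "_ \<le> ?S + _")
proof -
  have g: "g > 0" unfolding g_def using n2 by (intro mixture_pos) simp
  have S: "?S \<ge> 0" by (intro sum_nonneg mult_nonneg_nonneg add_nonneg_nonneg) (auto simp: out_def)
  have ind: "indicator {-T..T} x = 1 - out x" by (auto simp: out_def split: split_indicator)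
  show ?thesis
  proof (cases "g \<ge> \<rho>")
    case True
    then have "oracle_shrink \<rho> n \<theta> x = bayes_rule n \<theta> x"
      by (simp add: oracle_shrink_def bayes_rule_def g_def)
    then show ?thesis using S rho_pos by (simp add: add_nonneg_nonneg)
  next
    case False
    let ?r = "mixture' n \<theta> x / g"
    have "oracle_shrink \<rho> n \<theta> x - bayes_rule n \<theta> x = ?r * (g / \<rho> - 1)"
      using False g rho_pos by (simp add: oracle_shrink_def bayes_rule_def g_def[symmetric] field_simps)
    moreover have "(g / \<rho> - 1)\<^sup>2 \<le> 1"
      using False g rho_pos by (subst abs_square_le_1) (auto simp: abs_le_iff)
    ultimately have "(oracle_shrink \<rho> n \<theta> x - bayes_rule n \<theta> x)\<^sup>2 \<le> ?r\<^sup>2"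
      by (simp only: power_mult_distrib) (rule mult_left_le, auto)
    then have "n * g * (oracle_shrink \<rho> n \<theta> x - bayes_rule n \<theta> x)\<^sup>2 \<le> n * g * ?r\<^sup>2"
      using g by (intro mult_left_mono) auto
    also have "\<dots> \<le> (\<Sum>k=1..n. std_normal_density (x - \<theta> k) * (x - \<theta> k)\<^sup>2)"
      unfolding g_def using n2 by (intro mixture'_cauchy_schwarz) simp
    also have "\<dots> \<le> (\<Sum>k=1..n. std_normal_density (x - \<theta> k) * ((x - \<theta> k)\<^sup>2 * (if \<bar>x - \<theta> k\<bar> > 2 * L then 1 else 0) + 4 * L\<^sup>2))"
    proof (intro sum_mono mult_left_mono)
      show "(x - \<theta> k)\<^sup>2 \<le> (x - \<theta> k)\<^sup>2 * (if \<bar>x - \<theta> k\<bar> > 2 * L then 1 else 0) + 4 * L\<^sup>2" for k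
        using power_mono[of "\<bar>x - \<theta> k\<bar>" "2 * L" 2] by (auto simp: power_mult_distrib)
    qed auto
    also have "\<dots> = ?S + (\<Sum>k=1..n. std_normal_density (x - \<theta> k) * (4 * L\<^sup>2 * (1 - out x)))"
      by (simp add: sum.distrib[symmetric] algebra_simps)
    also have "(\<Sum>k=1..n. std_normal_density (x - \<theta> k) * (4 * L\<^sup>2 * (1 - out x))) = n * g * (4 * L\<^sup>2 * (1 - out x))"
      using n2 by (simp add: g_def mixture_def sum_distrib_right)
    also have "\<dots> \<le> n * \<rho> * (4 * L\<^sup>2 * (1 - out x))"
      using False by (intro mult_right_mono mult_left_mono mult_nonneg_nonneg) (auto simp: out_def)
    finally show ?thesis unfolding ind by (simp add: mult_ac)
  qed
qed

lemma bayes_loss_mass: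
  "(\<Sum>k=1..n. std_normal_density (x - \<theta> k) * bayes_loss k x) \<le>
   (\<Sum>k=1..n. std_normal_density (x - \<theta> k) * loss_majorant k x) + flat_part * indicator {-T..T} x"
proof -
  let ?w = "\<lambda>k. std_normal_density (x - \<theta> k)"
  let ?t = "\<lambda>k. (x - \<theta> k)\<^sup>2 * (if \<bar>x - \<theta> k\<bar> > 2 * L then 1 else 0)"
  have nf: "(\<Sum>k=1..n. ?w k) = n * mixture n \<theta> x" using n2 by (simp add: mixture_def)
  let ?A = "3 * KK * L\<^sup>2 * (out x + 1 / sqrt n)" 
  have "(\<Sum>k=1..n. ?w k * bayes_loss k x) = 3 * real n * (mixture n \<theta> x * err_bound_at x)
    + 3 * (n * mixture n \<theta> x * (oracle_shrink \<rho> n \<theta> x - bayes_rule n \<theta> x)\<^sup>2)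
    + 3 * (\<Sum>k=1..n. ?w k * (bayes_rule n \<theta> x - \<theta> k)\<^sup>2)"
    unfolding bayes_loss_def distrib_left sum.distrib mult.left_commute[of _ 3] sum_distrib_left[symmetric] sum_distrib_right[symmetric] nf
    by (simp add: mult_ac)
  \<comment> \<open>Optimality of the Bayes rule is used pointwise in \<open>x\<close>: its weighted
    loss gives way to that of the competitor \<open>s\<close>.\<close>
  also have "\<dots> \<le> 3 * real n * (KK * L\<^sup>2 * (out x + 1 / sqrt n) * mixture n \<theta> x + KK * L\<^sup>2 * f0 * indicator {-T..T} x)
    + 3 * ((\<Sum>k=1..n. ?w k * (?t k + 4 * L\<^sup>2 * out x)) + 4 * L\<^sup>2 * n * \<rho> * indicator {-T..T} x)
    + 3 * (\<Sum>k=1..n. ?w k * (s x - \<theta> k)\<^sup>2)"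
    using n2 by (intro add_mono mult_left_mono err_mass oracle_bayes_mass bayes_rule_optimal) auto
  also have "\<dots> = (n * mixture n \<theta> x) * ?A + 3 * (\<Sum>k=1..n. ?w k * (?t k + 4 * L\<^sup>2 * out x)) + 3 * (\<Sum>k=1..n. ?w k * (s x - \<theta> k)\<^sup>2)
     + flat_part * indicator {-T..T} x"
    by (simp add: flat_part_def algebra_simps)
  also have "\<dots> = (\<Sum>k=1..n. ?w k * loss_majorant k x) + flat_part * indicator {-T..T} x"
    unfolding nf[symmetric] sum_distrib_right sum_distrib_left sum.distrib[symmetric] loss_majorant_def
    by (intro arg_cong2[where f="(+)"] sum.cong refl) (simp add: algebra_simps)
  finally show ?thesis .
qed

text \<open>If \<open>\<bar>a + y\<bar> > T\<close>, then \<open>\<bar>a\<bar> > T / 2\<close> or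
  \<open>\<bar>y\<bar> > T / 2\<close>.\<close>

lemma nn_integral_out:
  "(\<integral>\<^sup>+y. ennreal (out (a + y)) \<partial>std_normal_distribution) \<le> ennreal ((if \<bar>a\<bar> > T / 2 then 1 else 0) + 2 * exp (- T\<^sup>2 / 16))"
proof -
  interpret N: prob_space std_normal_distribution by (rule prob_space_normal_density) simp
  have "(\<integral>\<^sup>+y. ennreal (out (a + y)) \<partial>std_normal_distribution) \<le>
    (\<integral>\<^sup>+y. ennreal (if \<bar>a\<bar> > T / 2 then 1 else 0) + ennreal (if \<bar>y\<bar> > T / 2 then 1 else 0) \<partial>std_normal_distribution)"
    using T by (intro nn_integral_mono) (auto simp: out_def)
  also have "\<dots> = ennreal (if \<bar>a\<bar> > T / 2 then 1 else 0) + (\<integral>\<^sup>+y. ennreal (if \<bar>y\<bar> > T / 2 then 1 else 0) \<partial>std_normal_distribution)"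
    by (subst nn_integral_add) (auto simp: N.emeasure_space_1[simplified])
  also have "\<dots> \<le> ennreal (if \<bar>a\<bar> > T / 2 then 1 else 0) + ennreal (2 * exp (- ((T / 2)\<^sup>2) / 4))"
    using T by (intro add_left_mono std_normal_tail) auto
  also have "\<dots> = ennreal ((if \<bar>a\<bar> > T / 2 then 1 else 0) + 2 * exp (- T\<^sup>2 / 16))"
    by (simp add: power_divide)
  finally show ?thesis .
qed

lemma nn_integral_loss_majorant:
  "(\<integral>\<^sup>+x. ennreal (std_normal_density (x - \<theta> k) * loss_majorant k x) \<partial>lborel) \<le>
    ennreal ((3 * KK * L\<^sup>2 + 12 * L\<^sup>2) * ((if \<bar>\<theta> k\<bar> > T / 2 then 1 else 0) + 2 * exp (- T\<^sup>2 / 16)) + (3 * KK * L\<^sup>2 / sqrt n + 48 / n))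
    + 3 * (\<integral>\<^sup>+y. ennreal ((s (\<theta> k + y) - \<theta> k)\<^sup>2) \<partial>std_normal_distribution)"
proof -
  interpret N: prob_space std_normal_distribution by (rule prob_space_normal_density) simp
  let ?A = "3 * KK * L\<^sup>2 + 12 * L\<^sup>2" and ?B = "3 * KK * L\<^sup>2 / sqrt n"
  let ?t = "\<lambda>y. y\<^sup>2 * (if \<bar>y\<bar> > 2 * L then 1 else 0)"
  have AB: "?A \<ge> 0" "?B \<ge> 0" using KK_pos by auto
  have o: "out x \<ge> 0" for x by (simp add: out_def)
  have nn: "loss_majorant k x \<ge> 0" for x unfolding loss_majorant_def using KK_pos by (auto simp: out_def)
  have e: "loss_majorant k (\<theta> k + y) = ?A * out (\<theta> k + y) + ?B + 3 * ?t y + 3 * (s (\<theta> k + y) - \<theta> k)\<^sup>2" for y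
    by (simp add: loss_majorant_def algebra_simps)
  have e16: "exp (- ((2 * L)\<^sup>2) / 8) = 1 / n" using exp_bw(2)[of n] n2 by (simp add: power_mult_distrib)
  have "(\<integral>\<^sup>+x. ennreal (std_normal_density (x - \<theta> k) * loss_majorant k x) \<partial>lborel) =
    (\<integral>\<^sup>+y. ennreal (loss_majorant k (\<theta> k + y)) \<partial>std_normal_distribution)"
    by (rule nn_integral_std_normal_shift[symmetric]) (auto simp: nn)
  also have "\<dots> = (\<integral>\<^sup>+y. ennreal ?A * ennreal (out (\<theta> k + y)) + ennreal ?B + ennreal 3 * ennreal (?t y)
      + ennreal 3 * ennreal ((s (\<theta> k + y) - \<theta> k)\<^sup>2) \<partial>std_normal_distribution)"
    unfolding e using AB o
    by (intro nn_integral_cong) (simp add: ennreal_mult[symmetric] ennreal_plus[symmetric] del: ennreal_plus ennreal_numeral)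
  also have "\<dots> = ennreal ?A * (\<integral>\<^sup>+y. ennreal (out (\<theta> k + y)) \<partial>std_normal_distribution) + ennreal ?B
      + ennreal 3 * (\<integral>\<^sup>+y. ennreal (?t y) \<partial>std_normal_distribution)
      + ennreal 3 * (\<integral>\<^sup>+y. ennreal ((s (\<theta> k + y) - \<theta> k)\<^sup>2) \<partial>std_normal_distribution)"
    by (simp add: nn_integral_add nn_integral_cmult N.emeasure_space_1[simplified] del: ennreal_numeral)
  also have "\<dots> \<le> ennreal ?A * ennreal ((if \<bar>\<theta> k\<bar> > T / 2 then 1 else 0) + 2 * exp (- T\<^sup>2 / 16)) + ennreal ?B
      + ennreal 3 * ennreal (16 * exp (- ((2 * L)\<^sup>2) / 8))
      + ennreal 3 * (\<integral>\<^sup>+y. ennreal ((s (\<theta> k + y) - \<theta> k)\<^sup>2) \<partial>std_normal_distribution)"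
    using L1 by (intro add_mono mult_left_mono nn_integral_out std_normal_tail_moment2) auto
  also have "ennreal ?A * ennreal ((if \<bar>\<theta> k\<bar> > T / 2 then 1 else 0) + 2 * exp (- T\<^sup>2 / 16)) + ennreal ?B
      + ennreal 3 * ennreal (16 * exp (- ((2 * L)\<^sup>2) / 8)) =
     ennreal (?A * ((if \<bar>\<theta> k\<bar> > T / 2 then 1 else 0) + 2 * exp (- T\<^sup>2 / 16)) + (?B + 48 / n))"
    unfolding e16 using AB
    by (simp add: ennreal_mult[symmetric] ennreal_plus[symmetric] add.assoc del: ennreal_plus ennreal_numeral)
  finally show ?thesis by simp
qed

text \<open>An oracle inequality against any coordinatewise rule \<open>s\<close>; the factor
  \<open>3\<close> is the number of terms into which the loss is split. In the remainder,
  \<open>T / sqrt n\<close> is the length of \<open>{-T..T}\<close> times the density levels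
  \<open>f0\<close> and \<rho>, and the other two terms measure the mass outside. \<open>T\<close>
  stays free, as different ranges of levels call for different values.\<close>

lemma geb_risk_fine:
  fixes R :: real
  assumes R: "(\<Sum>k=1..n. \<integral>\<^sup>+y. ennreal ((s (\<theta> k + y) - \<theta> k)\<^sup>2) \<partial>std_normal_distribution) \<le> ennreal (n * R)" "R \<ge> 0"
  shows "(\<Sum>k=1..n. \<integral>\<^sup>+\<omega>. ennreal ((geb_shrink \<rho> n (\<lambda>i. \<theta> i + Z i \<omega>) (\<theta> k + Z k \<omega>) - \<theta> k)\<^sup>2) \<partial>M) \<le>
    ennreal (n * (3 * R + 100 * (KK + C) * L ^ 4 *
      (T / sqrt n + (\<Sum>k=1..n. if \<bar>\<theta> k\<bar> > T / 2 then 1 else 0) / n + exp (- T\<^sup>2 / 16))))"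
proof -
  let ?A = "3 * KK * L\<^sup>2 + 12 * L\<^sup>2" and ?B = "3 * KK * L\<^sup>2 / sqrt n + 48 / n"
  let ?I = "\<lambda>k. if \<bar>\<theta> k\<bar> > T / 2 then 1 else 0 :: real" and ?E = "exp (- T\<^sup>2 / 16)"
  let ?\<pi> = "(\<Sum>k=1..n. ?I k) / n"
  have flat0: "flat_part \<ge> 0" unfolding flat_part_def using KK_pos f0_pos rho_pos by (intro add_nonneg_nonneg mult_nonneg_nonneg) auto
  have AB: "?A \<ge> 0" "?B \<ge> 0" using KK_pos by auto
  have nn: "loss_majorant k x \<ge> 0" for k x unfolding loss_majorant_def using KK_pos by (auto simp: out_def)
  have "(\<Sum>k=1..n. \<integral>\<^sup>+\<omega>. ennreal ((geb_shrink \<rho> n (\<lambda>i. \<theta> i + Z i \<omega>) (\<theta> k + Z k \<omega>) - \<theta> k)\<^sup>2) \<partial>M) \<le>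
    (\<Sum>k=1..n. \<integral>\<^sup>+y. ennreal (bayes_loss k (\<theta> k + y)) \<partial>std_normal_distribution)"
    by (intro sum_mono) (simp add: geb_risk_resample, intro nn_integral_mono geb_inner, simp)
  also have "\<dots> = (\<Sum>k=1..n. \<integral>\<^sup>+x. ennreal (std_normal_density (x - \<theta> k) * bayes_loss k x) \<partial>lborel)"
    by (intro sum.cong refl nn_integral_std_normal_shift) (auto simp: bayes_loss_nonneg)
  also have "\<dots> = (\<integral>\<^sup>+x. ennreal (\<Sum>k=1..n. std_normal_density (x - \<theta> k) * bayes_loss k x) \<partial>lborel)"
    by (subst nn_integral_sum[symmetric]) (auto simp: sum_ennreal bayes_loss_nonneg)
  also have "\<dots> \<le> (\<integral>\<^sup>+x. ennreal ((\<Sum>k=1..n. std_normal_density (x - \<theta> k) * loss_majorant k x) + flat_part * indicator {-T..T} x) \<partial>lborel)"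
    by (intro nn_integral_mono ennreal_leI bayes_loss_mass)
  also have "\<dots> = (\<integral>\<^sup>+x. (\<Sum>k=1..n. ennreal (std_normal_density (x - \<theta> k) * loss_majorant k x)) + ennreal flat_part * indicator {-T..T} x \<partial>lborel)"
    using flat0 nn by (intro nn_integral_cong) (auto simp: sum_ennreal sum_nonneg split: split_indicator)
  also have "\<dots> = (\<Sum>k=1..n. \<integral>\<^sup>+x. ennreal (std_normal_density (x - \<theta> k) * loss_majorant k x) \<partial>lborel) + ennreal flat_part * ennreal (2 * T)"
    using T by (subst nn_integral_add) (auto simp: nn_integral_sum nn_integral_cmult)
  also have "\<dots> \<le> (\<Sum>k=1..n. ennreal (?A * (?I k + 2 * ?E) + ?B) + 3 * (\<integral>\<^sup>+y. ennreal ((s (\<theta> k + y) - \<theta> k)\<^sup>2) \<partial>std_normal_distribution))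
      + ennreal (flat_part * (2 * T))"
    using flat0 T by (intro add_mono sum_mono nn_integral_loss_majorant) (simp add: ennreal_mult)
  also have "\<dots> = ennreal (\<Sum>k=1..n. ?A * (?I k + 2 * ?E) + ?B) + 3 * (\<Sum>k=1..n. \<integral>\<^sup>+y. ennreal ((s (\<theta> k + y) - \<theta> k)\<^sup>2) \<partial>std_normal_distribution)
      + ennreal (flat_part * (2 * T))"
  proof -
    have "(\<Sum>k=1..n. ennreal (?A * (?I k + 2 * ?E) + ?B)) = ennreal (\<Sum>k=1..n. ?A * (?I k + 2 * ?E) + ?B)"
      using AB by (intro sum_ennreal) auto
    then show ?thesis by (subst sum.distrib) (simp only: sum_distrib_left)
  qed
  also have "\<dots> \<le> ennreal (\<Sum>k=1..n. ?A * (?I k + 2 * ?E) + ?B) + ennreal 3 * ennreal (n * R) + ennreal (flat_part * (2 * T))"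
    using mult_left_mono[OF R(1), of 3] by (intro add_mono order_refl) simp
  also have "\<dots> = ennreal ((\<Sum>k=1..n. ?A * (?I k + 2 * ?E) + ?B) + 3 * (n * R) + flat_part * (2 * T))"
  proof -
    have "0 \<le> (\<Sum>k=1..n. ?A * (?I k + 2 * ?E) + ?B)" using KK_pos by (intro sum_nonneg add_nonneg_nonneg mult_nonneg_nonneg) auto
    moreover have "0 \<le> flat_part * (2 * T)" using flat0 T by simp
    ultimately show ?thesis using R(2) by (simp add: ennreal_mult[symmetric] ennreal_plus[symmetric] del: ennreal_plus ennreal_numeral)
  qed
  also have "\<dots> \<le> ennreal (n * (3 * R + 100 * (KK + C) * L ^ 4 * (T / sqrt n + ?\<pi> + ?E)))"
  proof (intro ennreal_leI)
    define r where "r = sqrt n"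
    have r: "r * r = n" "r \<ge> 1" using n2 by (auto simp: r_def)
    have L: "1 \<le> L\<^sup>2" "L\<^sup>2 \<le> L ^ 4" "1 \<le> L ^ 4" "L ^ 3 \<le> L ^ 4"
      using L1 power_increasing[OF _ L1, of 2 4] power_increasing[OF _ L1, of 3 4] by auto
    have KK: "KK \<ge> 576" using KK_ge power_mono[of 3 K2 2] K2_ge by simp
    have pi0: "?\<pi> \<ge> 0" by (intro divide_nonneg_nonneg sum_nonneg) auto
    have Tr: "1 / r \<le> T / r" "1 / n \<le> T / r"
      using T r n2 by (auto intro!: divide_right_mono frac_le simp: r(1)[symmetric] mult_le_cancel_left1)
    have "(\<Sum>k=1..n. ?A * (?I k + 2 * ?E) + ?B) = ?A * (\<Sum>k=1..n. ?I k) + n * (?A * (2 * ?E) + ?B)"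
      by (simp add: sum.distrib distrib_left sum_distrib_left algebra_simps)
    also have "\<dots> = n * (?A * ?\<pi> + ?A * (2 * ?E) + ?B)" using n2 by (simp add: field_simps)
    finally have 1: "(\<Sum>k=1..n. ?A * (?I k + 2 * ?E) + ?B) = n * (?A * ?\<pi> + ?A * (2 * ?E) + ?B)" .
    have A: "?A \<le> 4 * KK * L ^ 4"
    proof -
      have "12 * L\<^sup>2 \<le> KK * L\<^sup>2" using KK by (intro mult_right_mono) auto
      moreover have "KK * L\<^sup>2 \<le> KK * L ^ 4" using KK L by (intro mult_left_mono) auto
      ultimately show ?thesis by simp
    qed
    have B: "?B \<le> 4 * KK * L ^ 4 * (T / r)"
    proof -
      have b1: "3 * KK * L\<^sup>2 * (1 / r) \<le> 3 * KK * L ^ 4 * (T / r)" using KK L Tr r by (intro mult_mono) auto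
      have b2: "48 * (1 / n) \<le> (KK * L ^ 4) * (T / r)"
        using KK L Tr r mult_mono[of 48 KK 1 "L ^ 4"] T by (intro mult_mono) auto
      have "?B = 3 * KK * L\<^sup>2 * (1 / r) + 48 * (1 / n)" by (simp add: r_def)
      also have "\<dots> \<le> 3 * KK * L ^ 4 * (T / r) + (KK * L ^ 4) * (T / r)" by (rule add_mono[OF b1 b2])
      also have "\<dots> = 4 * KK * L ^ 4 * (T / r)" by algebra
      finally show ?thesis .
    qed
    have F: "flat_part * (2 * T) \<le> n * ((96 * KK + 24 * C) * L ^ 4 * (T / r))"
    proof -
      have "L\<^sup>2 * \<rho> \<le> L\<^sup>2 * (C * L / r)" using rho(2) by (intro mult_left_mono) (auto simp: r_def)
      also have "\<dots> = C * (L ^ 3 / r)" by (simp add: power2_eq_square power3_eq_cube)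
      also have "\<dots> \<le> C * (L ^ 4 / r)" using L C r by (intro mult_left_mono divide_right_mono) auto
      finally have "(L\<^sup>2 * \<rho>) * (24 * n * T) \<le> C * (L ^ 4 / r) * (24 * n * T)" using T by (intro mult_right_mono) auto
      moreover have "flat_part * (2 * T) = 96 * KK * n * L ^ 4 * (T / r) + (L\<^sup>2 * \<rho>) * (24 * n * T)"
        by (simp add: flat_part_def f0_def r_def algebra_simps power2_eq_square power4_eq_xxxx)
      ultimately show ?thesis by (simp add: algebra_simps)
    qed
    have K0: "0 \<le> KK * L ^ 4" "0 \<le> C * L ^ 4" using KK L C by auto
    have "?A * ?\<pi> \<le> 4 * KK * L ^ 4 * ?\<pi>" "?A * (2 * ?E) \<le> 4 * KK * L ^ 4 * (2 * ?E)"
      by (intro mult_right_mono A pi0, intro mult_right_mono A) simp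
    then have "?A * ?\<pi> \<le> 4 * (KK * L ^ 4) * ?\<pi>" "?A * (2 * ?E) \<le> 8 * (KK * L ^ 4) * ?E" "?B \<le> 4 * (KK * L ^ 4) * (T / r)"
      using B by (simp_all only: mult_ac)
    from sum_weights_le[OF this K0 pi0] T r
    have 2: "?A * ?\<pi> + ?A * (2 * ?E) + ?B + (96 * KK + 24 * C) * L ^ 4 * (T / r) \<le>
       100 * (KK + C) * L ^ 4 * (T / r + ?\<pi> + ?E)"
      by (simp only: distrib_right[of _ _ "L ^ 4"] mult.assoc) simp
    have "(\<Sum>k=1..n. ?A * (?I k + 2 * ?E) + ?B) + 3 * (n * R) + flat_part * (2 * T) \<le>
      n * (3 * R + (?A * ?\<pi> + ?A * (2 * ?E) + ?B + (96 * KK + 24 * C) * L ^ 4 * (T / r)))"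
      using F unfolding 1 by (simp add: algebra_simps)
    also have "\<dots> \<le> n * (3 * R + 100 * (KK + C) * L ^ 4 * (T / r + ?\<pi> + ?E))"
      using 2 by (intro mult_left_mono add_left_mono) auto
    finally show "(\<Sum>k=1..n. ?A * (?I k + 2 * ?E) + ?B) + 3 * (n * R) + flat_part * (2 * T) \<le>
      n * (3 * R + 100 * (KK + C) * L ^ 4 * (T / sqrt n + ?\<pi> + ?E))" by (simp add: r_def)
  qed
  finally show ?thesis .
qed

end

end

section \<open>The hybrid rule on one level\<close>

text \<open>Summed over a level, the bound of \<open>soft_threshold_risk\<close> is affine in this
  quantity.\<close>

definition sparsity :: "nat \<Rightarrow> (nat \<Rightarrow> real) \<Rightarrow> real" where
  "sparsity n \<theta> = (\<Sum>i=1..n. min ((\<theta> i)\<^sup>2) 1) / n"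

text \<open>The expectation of \<open>geb_kappa\<close>: each exponential there has mean
  \<open>exp (- (\<theta> i)\<^sup>2 / 4) / sqrt 2\<close>, which its factor \<open>sqrt 2\<close>
  normalises.\<close>

definition kappa :: "nat \<Rightarrow> (nat \<Rightarrow> real) \<Rightarrow> real" where
  "kappa n \<theta> = (\<Sum>i=1..n. 1 - exp (- (\<theta> i)\<^sup>2 / 4)) / n"

text \<open>What the test measures is comparable to what governs soft thresholding. The factor
  \<open>5\<close> comes from \<open>exp (1/4) \<ge> 5/4\<close>, by which
  \<open>1 - exp (- 1/4)\<close> is at least \<open>1/5\<close>.\<close>

lemma kappa_sparsity: "sparsity n \<theta> \<le> 5 * kappa n \<theta>" "kappa n \<theta> \<le> sparsity n \<theta>"
proof -
  have a: "min x 1 \<le> 5 * (1 - exp (- x / 4))" if "x \<ge> 0" for x :: real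
  proof (cases "x \<le> 1")
    case True
    have "exp (- (x/4)) \<le> 1 / (1 + x/4)"
      using exp_ge_add_one_self[of "x/4"] that by (simp add: exp_minus field_simps)
    then have "5 * (1 - exp (- x / 4)) \<ge> 5 * (1 - 1 / (1 + x/4))" by simp
    moreover have "5 * (1 - 1 / (1 + x/4)) \<ge> x" using that True mult_left_mono[OF True that] by (simp add: field_simps)
    ultimately show ?thesis by simp
  next
    case False
    have "exp (- (x / 4)) \<le> exp (- (1 / 4))" using False by simp
    also have "\<dots> \<le> 4 / 5" using exp_ge_add_one_self[of "1/4::real"] by (simp add: exp_minus field_simps)
    finally show ?thesis using False by simp
  qed
  have b: "1 - exp (- x / 4) \<le> min x 1" if "x \<ge> 0" for x :: real
    using exp_ge_add_one_self[of "- x / 4"] that by simp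
  show "sparsity n \<theta> \<le> 5 * kappa n \<theta>"
    unfolding sparsity_def kappa_def times_divide_eq_right sum_distrib_left
    by (intro divide_right_mono sum_mono a) auto
  show "kappa n \<theta> \<le> sparsity n \<theta>"
    unfolding sparsity_def kappa_def by (intro divide_right_mono sum_mono b) auto
qed

lemma sparsity_nonneg: "sparsity n \<theta> \<ge> 0"
  unfolding sparsity_def by (intro divide_nonneg_nonneg sum_nonneg) auto

text \<open>Completing the square shows a multiple of the normal density with mean
  \<open>- t / 2\<close> and variance \<open>1 / 2\<close>.\<close>

lemma integral_std_normal_exp_sq:
  "(\<integral>z. std_normal_density z * exp (- (t + z)\<^sup>2 / 2) \<partial>lborel) = exp (- t\<^sup>2 / 4) / sqrt 2"
proof -
  have "std_normal_density z * exp (- (t + z)\<^sup>2 / 2) = exp (- t\<^sup>2 / 4) / sqrt 2 * normal_density (- t / 2) (1 / sqrt 2) z" for z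
  proof -
    have "- z\<^sup>2 / 2 + (- (t + z)\<^sup>2 / 2) = - t\<^sup>2 / 4 + (- (z - - t / 2)\<^sup>2 / (2 * (1 / sqrt 2)\<^sup>2))"
      by (simp add: power_divide power2_eq_square field_simps)
    then have "exp (- z\<^sup>2 / 2) * exp (- (t + z)\<^sup>2 / 2) = exp (- t\<^sup>2 / 4) * exp (- (z - - t / 2)\<^sup>2 / (2 * (1 / sqrt 2)\<^sup>2))"
      unfolding mult_exp_exp by simp
    then show ?thesis
      unfolding normal_density_def std_normal_density_def by (simp add: real_sqrt_mult real_sqrt_divide power_divide field_simps)
  qed
  then show ?thesis by simp
qed

section \<open>The test on the estimated sparsity, and expectations over rare events\<close>

context gauss_level
begin

abbreviation X where "X \<theta> \<omega> \<equiv> \<lambda>i. \<theta> i + Z i \<omega>"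

lemma kappa_measurable[measurable]: "(\<lambda>\<omega>. geb_kappa n (X \<theta> \<omega>)) \<in> borel_measurable M"
  unfolding geb_kappa_def by measurable

text \<open>When \<open>kappa\<close> is at most half or at least twice the threshold, a wrong
  decision means a deviation of at least \<open>b / 2\<close>, that is, of
  \<open>n * b / (2 * sqrt 2)\<close> for a sum of \<open>n\<close> independent terms bounded by
  \<open>1\<close>. Hoeffding's inequality then gives the exponent.\<close>

lemma kappa_concentration:
  fixes b :: real
  assumes "b > 0"
  shows "kappa n \<theta> \<le> b / 2 \<Longrightarrow> prob {\<omega> \<in> space M. geb_kappa n (X \<theta> \<omega>) > b} \<le> exp (- (n * b\<^sup>2) / 16)"
    and "kappa n \<theta> \<ge> 2 * b \<Longrightarrow> prob {\<omega> \<in> space M. geb_kappa n (X \<theta> \<omega>) \<le> b} \<le> exp (- (n * b\<^sup>2) / 16)"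
proof -
  let ?Y = "\<lambda>i \<omega>. exp (- (\<theta> i + Z i \<omega>)\<^sup>2 / 2)"
  have ind: "indep_vars (\<lambda>_. borel) ?Y {1..n}"
    by (rule indep_vars_compose2[OF indep, where Y="\<lambda>i z. exp (- (\<theta> i + z)\<^sup>2 / 2)"]) auto
  have EY: "expectation (?Y i) = exp (- (\<theta> i)\<^sup>2 / 4) / sqrt 2" if "i \<in> {1..n}" for i
    using expectation_Z[OF that, of "\<lambda>z. exp (- (\<theta> i + z)\<^sup>2 / 2)"] unfolding integral_std_normal_exp_sq by simp
  have \<mu>: "(\<Sum>i=1..n. expectation (?Y i)) = n * (1 - kappa n \<theta>) / sqrt 2"
  proof -
    have "(\<Sum>i=1..n. expectation (?Y i)) = (\<Sum>i=1..n. exp (- (\<theta> i)\<^sup>2 / 4) / sqrt 2)"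
      using EY by (intro sum.cong) auto
    also have "\<dots> = n * (1 - kappa n \<theta>) / sqrt 2"
      using n2 by (simp add: kappa_def sum_subtractf sum_divide_distrib[symmetric] field_simps)
    finally show ?thesis .
  qed
  have S: "(\<Sum>i=1..n. ?Y i \<omega>) = n * (1 - geb_kappa n (X \<theta> \<omega>)) / sqrt 2" for \<omega>
    using n2 by (simp add: geb_kappa_def field_simps)
  have ex: "exp (- (n * d / sqrt 2)\<^sup>2 / (real (2 * card {1..n}) * 1\<^sup>2)) \<le> exp (- (n * b\<^sup>2) / 16)" if "d \<ge> b / 2" for d :: real
  proof -
    have "(b / 2)\<^sup>2 \<le> d\<^sup>2" using that assms by (intro power_mono) auto
    then have "n * (b / 2)\<^sup>2 \<le> n * d\<^sup>2" by (intro mult_left_mono) auto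
    then show ?thesis using n2 by (simp add: power_divide power_mult_distrib power2_eq_square field_simps)
  qed
  have Yb: "\<bar>?Y i \<omega>\<bar> \<le> 1" for i \<omega> by simp
  note H = hoeffding_bounded[OF _ _ ind Yb]
  show "prob {\<omega> \<in> space M. geb_kappa n (X \<theta> \<omega>) > b} \<le> exp (- (n * b\<^sup>2) / 16)" if k: "kappa n \<theta> \<le> b / 2"
  proof -
    have "prob {\<omega> \<in> space M. geb_kappa n (X \<theta> \<omega>) > b} \<le>
      prob {\<omega> \<in> space M. (\<Sum>i=1..n. ?Y i \<omega>) \<le> (\<Sum>i=1..n. expectation (?Y i)) - n * (b / 2) / sqrt 2}"
    proof (rule finite_measure_mono)
      show "{\<omega> \<in> space M. geb_kappa n (X \<theta> \<omega>) > b} \<subseteq>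
        {\<omega> \<in> space M. (\<Sum>i=1..n. ?Y i \<omega>) \<le> (\<Sum>i=1..n. expectation (?Y i)) - n * (b / 2) / sqrt 2}"
      proof safe
        fix \<omega> assume "geb_kappa n (X \<theta> \<omega>) > b"
        then have "n * (1 - geb_kappa n (X \<theta> \<omega>)) / sqrt 2 \<le> n * (1 - kappa n \<theta> - b / 2) / sqrt 2"
          using k by (intro divide_right_mono mult_left_mono) auto
        then show "(\<Sum>i=1..n. ?Y i \<omega>) \<le> (\<Sum>i=1..n. expectation (?Y i)) - n * (b / 2) / sqrt 2"
          unfolding S \<mu> by (simp add: right_diff_distrib diff_divide_distrib)
      qed
    qed measurable
    also have "\<dots> \<le> exp (- (n * (b / 2) / sqrt 2)\<^sup>2 / (real (2 * card {1..n}) * 1\<^sup>2))"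
      using n2 assms by (intro H(1)) auto
    also have "\<dots> \<le> exp (- (n * b\<^sup>2) / 16)" by (rule ex) simp
    finally show ?thesis .
  qed
  show "prob {\<omega> \<in> space M. geb_kappa n (X \<theta> \<omega>) \<le> b} \<le> exp (- (n * b\<^sup>2) / 16)" if k: "kappa n \<theta> \<ge> 2 * b"
  proof -
    have "prob {\<omega> \<in> space M. geb_kappa n (X \<theta> \<omega>) \<le> b} \<le>
      prob {\<omega> \<in> space M. (\<Sum>i=1..n. ?Y i \<omega>) \<ge> (\<Sum>i=1..n. expectation (?Y i)) + n * b / sqrt 2}"
    proof (rule finite_measure_mono)
      show "{\<omega> \<in> space M. geb_kappa n (X \<theta> \<omega>) \<le> b} \<subseteq>
        {\<omega> \<in> space M. (\<Sum>i=1..n. ?Y i \<omega>) \<ge> (\<Sum>i=1..n. expectation (?Y i)) + n * b / sqrt 2}"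
      proof safe
        fix \<omega> assume "geb_kappa n (X \<theta> \<omega>) \<le> b"
        then have "n * (1 - kappa n \<theta> + b) / sqrt 2 \<le> n * (1 - geb_kappa n (X \<theta> \<omega>)) / sqrt 2"
          using k by (intro divide_right_mono mult_left_mono) auto
        then show "(\<Sum>i=1..n. expectation (?Y i)) + n * b / sqrt 2 \<le> (\<Sum>i=1..n. ?Y i \<omega>)"
          unfolding S \<mu> by (simp add: distrib_left add_divide_distrib)
      qed
    qed measurable
    also have "\<dots> \<le> exp (- (n * b / sqrt 2)\<^sup>2 / (real (2 * card {1..n}) * 1\<^sup>2))"
      using n2 assms by (intro H(2)) auto
    also have "\<dots> \<le> exp (- (n * b\<^sup>2) / 16)" using assms by (intro ex) simp
    finally show ?thesis .
  qed
qed

lemma nn_integral_Z: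
  assumes "i \<in> {1..n}" "g \<in> borel_measurable borel"
  shows "(\<integral>\<^sup>+\<omega>. g (Z i \<omega>) \<partial>M) = (\<integral>\<^sup>+z. g z \<partial>std_normal_distribution)"
  using distributed_nn_integral[OF dist[OF assms(1)], of g] assms(2) by (simp add: nn_integral_density)

text \<open>The bound is useful for events of probability \<open>O(1 / n ^ 4)\<close>; it rests on \<open>z\<^sup>2 \<le> n\<^sup>2 + z ^ 4 / n\<^sup>2\<close>.\<close>

lemma nn_integral_rare:
  assumes i: "i \<in> {1..n}" and A[measurable]: "A \<in> sets M" and q: "q \<ge> 0"
    and le: "\<And>\<omega>. \<omega> \<in> A \<Longrightarrow> g \<omega> \<le> 2 * (Z i \<omega>)\<^sup>2 + q"
  shows "(\<integral>\<^sup>+\<omega>. ennreal (g \<omega>) * indicator A \<omega> \<partial>M) \<le> ennreal ((2 * (real n)\<^sup>2 + q) * prob A + 256 / (real n)\<^sup>2)"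
proof -
  have [measurable]: "Z i \<in> borel_measurable M" using i by measurable
  have "(\<integral>\<^sup>+\<omega>. ennreal (g \<omega>) * indicator A \<omega> \<partial>M) \<le>
    (\<integral>\<^sup>+\<omega>. ennreal (2 * (real n)\<^sup>2 + q) * indicator A \<omega> + ennreal (2 / (real n)\<^sup>2) * ennreal ((Z i \<omega>) ^ 4) \<partial>M)"
  proof (rule nn_integral_mono)
    fix \<omega> 
    have "2 * z\<^sup>2 \<le> 2 * (real n)\<^sup>2 + 2 / (real n)\<^sup>2 * z ^ 4" for z
    proof -
      have "0 \<le> (z\<^sup>2 / n - n)\<^sup>2 + (real n)\<^sup>2 + z ^ 4 / (real n)\<^sup>2" by simp
      also have "\<dots> = 2 * (real n)\<^sup>2 + 2 * z ^ 4 / (real n)\<^sup>2 - 2 * z\<^sup>2"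
        using n2 by (simp add: power2_diff power_divide power_mult[symmetric])
      finally show ?thesis by simp
    qed
    from this[of "Z i \<omega>"] le[of \<omega>] have "\<omega> \<in> A \<Longrightarrow> g \<omega> \<le> (2 * (real n)\<^sup>2 + q) + 2 / (real n)\<^sup>2 * (Z i \<omega>) ^ 4" by linarith
    moreover have "0 \<le> (Z i \<omega>) ^ 4" by simp
    ultimately show "ennreal (g \<omega>) * indicator A \<omega> \<le> ennreal (2 * (real n)\<^sup>2 + q) * indicator A \<omega> + ennreal (2 / (real n)\<^sup>2) * ennreal ((Z i \<omega>) ^ 4)"
      using q by (auto simp: ennreal_mult[symmetric] ennreal_plus[symmetric] simp del: ennreal_plus split: split_indicator intro!: ennreal_leI)
  qed
  also have "\<dots> = ennreal (2 * (real n)\<^sup>2 + q) * emeasure M A + ennreal (2 / (real n)\<^sup>2) * (\<integral>\<^sup>+\<omega>. ennreal ((Z i \<omega>) ^ 4) \<partial>M)"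
    by (subst nn_integral_add) (auto simp: nn_integral_cmult)
  also have "\<dots> \<le> ennreal (2 * (real n)\<^sup>2 + q) * ennreal (prob A) + ennreal (2 / (real n)\<^sup>2) * ennreal 128"
    using std_normal_moment4 nn_integral_Z[OF i, of "\<lambda>z. ennreal (z ^ 4)"]
    by (intro add_mono mult_left_mono) (auto simp: emeasure_eq_measure)
  also have "\<dots> = ennreal ((2 * (real n)\<^sup>2 + q) * prob A + 256 / (real n)\<^sup>2)"
    using q by (simp add: ennreal_mult[symmetric] ennreal_plus[symmetric] measure_nonneg del: ennreal_plus ennreal_numeral)
  finally show ?thesis .
qed

end

lemma bw_sq_le: "n \<ge> 1 \<Longrightarrow> (bw n)\<^sup>2 \<le> 2 * real n"
  using ln_le_minus_one[of "real n"] by (simp add: bw_sq)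

section \<open>Risk of the hybrid rule, split by the outcome of the test\<close>

locale gauss_level_geb = gauss_level_rho +
  fixes b0 :: real
  assumes b0: "b0 > 0"
begin

definition "b = geb_b b0 n"
text \<open>Collects the constants of \<open>rare_total\<close>: the first summand belongs to the
  probability of the event, and \<open>256\<close> is twice the bound \<open>128\<close> for the
  Gaussian fourth moment.\<close>

definition "rare_const = 6 * exp (64 / b0\<^sup>2) / c\<^sup>2 + 256"

definition "gebE \<theta> = {\<omega> \<in> space M. geb_kappa n (X \<theta> \<omega>) > b}"

definition hybrid :: "(nat \<Rightarrow> real) \<Rightarrow> 'a \<Rightarrow> nat \<Rightarrow> real" where
  "hybrid \<theta> \<omega> k = (if \<omega> \<in> gebE \<theta> then geb_shrink \<rho> n (X \<theta> \<omega>) (X \<theta> \<omega> k) else soft_threshold L (X \<theta> \<omega> k))"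

definition "risk_sum \<theta> = (\<Sum>k=1..n. \<integral>\<^sup>+\<omega>. ennreal ((hybrid \<theta> \<omega> k - \<theta> k)\<^sup>2) \<partial>M)"
definition "geb_part \<theta> = (\<Sum>k=1..n. \<integral>\<^sup>+\<omega>. ennreal ((geb_shrink \<rho> n (X \<theta> \<omega>) (X \<theta> \<omega> k) - \<theta> k)\<^sup>2) * indicator (gebE \<theta>) \<omega> \<partial>M)"
definition "soft_part \<theta> = (\<Sum>k=1..n. \<integral>\<^sup>+\<omega>. ennreal ((soft_threshold L (X \<theta> \<omega> k) - \<theta> k)\<^sup>2) * indicator (space M - gebE \<theta>) \<omega> \<partial>M)"

lemma b_pos: "b > 0" unfolding b_def geb_b_def using b0 n2 by auto

lemma gebE_sets[measurable]: "gebE \<theta> \<in> sets M" unfolding gebE_def by measurable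

lemma geb_shrink_measurable[measurable]: "k \<in> {1..n} \<Longrightarrow> (\<lambda>\<omega>. geb_shrink \<rho> n (X \<theta> \<omega>) (X \<theta> \<omega> k)) \<in> borel_measurable M"
  unfolding geb_shrink_def geb_density_eq[OF n2] deriv_geb_density[OF n2] by measurable

lemma risk_sum_le: "risk_sum \<theta> \<le> geb_part \<theta> + soft_part \<theta>"
proof -
  have "(\<integral>\<^sup>+\<omega>. ennreal ((hybrid \<theta> \<omega> k - \<theta> k)\<^sup>2) \<partial>M) =
    (\<integral>\<^sup>+\<omega>. ennreal ((geb_shrink \<rho> n (X \<theta> \<omega>) (X \<theta> \<omega> k) - \<theta> k)\<^sup>2) * indicator (gebE \<theta>) \<omega> \<partial>M) +
    (\<integral>\<^sup>+\<omega>. ennreal ((soft_threshold L (X \<theta> \<omega> k) - \<theta> k)\<^sup>2) * indicator (space M - gebE \<theta>) \<omega> \<partial>M)" if k: "k \<in> {1..n}" for k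
  proof -
    note [measurable] = geb_shrink_measurable[OF k] Z_measurable[OF k]
    show ?thesis
      by (subst nn_integral_add[symmetric]) (auto simp: hybrid_def intro!: nn_integral_cong split: split_indicator)
  qed
  then show ?thesis unfolding risk_sum_def geb_part_def soft_part_def sum.distrib[symmetric] by simp
qed

text \<open>Here \<open>n * b\<^sup>2\<close> is \<open>(b0 * ln n)\<^sup>2\<close>, quadratic in
  \<open>ln n\<close> and so larger than any multiple of \<open>ln n\<close> up to a constant.
  Completing the square for the multiple \<open>4\<close> yields \<open>64 / b0\<^sup>2\<close>.
  This is the effect of the logarithm in \<open>geb_b\<close>.\<close>

lemma rare_prob: "exp (- (n * b\<^sup>2) / 16) \<le> exp (64 / b0\<^sup>2) / real n ^ 4"
proof -
  let ?t = "ln (real n)"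
  have nb: "n * b\<^sup>2 = b0\<^sup>2 * ?t\<^sup>2" using n2 by (simp add: b_def geb_b_def power_divide power_mult_distrib)
  have "0 \<le> (b0 * ?t / 4 - 8 / b0)\<^sup>2" by simp
  also have "\<dots> = b0\<^sup>2 * ?t\<^sup>2 / 16 - 4 * ?t + 64 / b0\<^sup>2"
    using b0 by (simp add: power2_diff power_divide power_mult_distrib)
  finally have "- (n * b\<^sup>2) / 16 \<le> 64 / b0\<^sup>2 - 4 * ?t" unfolding nb by simp
  then have "exp (- (n * b\<^sup>2) / 16) \<le> exp (64 / b0\<^sup>2 - 4 * ?t)" by simp
  also have "\<dots> = exp (64 / b0\<^sup>2) / exp (4 * ?t)" by (simp add: exp_diff)
  also have "exp (4 * ?t) = real n ^ 4" using exp_of_nat_mult[of 4 ?t] n2 by simp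
  finally show ?thesis .
qed

lemma rare_const_ge: "rare_const \<ge> 256" unfolding rare_const_def by simp

lemma rare_total:
  assumes q: "0 \<le> q" "q \<le> 4 * (real n)\<^sup>2 / c\<^sup>2" and P: "P \<le> exp (64 / b0\<^sup>2) / real n ^ 4" "P \<ge> 0"
  shows "(2 * (real n)\<^sup>2 + q) * P + 256 / (real n)\<^sup>2 \<le> rare_const / (real n)\<^sup>2"
proof -
  have "c\<^sup>2 \<le> 1" using c by (simp add: power_le_one)
  then have "2 * (real n)\<^sup>2 * 1 \<le> 2 * (real n)\<^sup>2 * (1 / c\<^sup>2)" using c by (intro mult_left_mono) auto
  then have "2 * (real n)\<^sup>2 + q \<le> 6 * (real n)\<^sup>2 / c\<^sup>2" using q by simp
  then have "(2 * (real n)\<^sup>2 + q) * P \<le> (6 * (real n)\<^sup>2 / c\<^sup>2) * (exp (64 / b0\<^sup>2) / real n ^ 4)"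
    using P q by (intro mult_mono) auto
  also have "\<dots> = (6 * exp (64 / b0\<^sup>2) / c\<^sup>2) / (real n)\<^sup>2"
    using n2 c by (simp add: field_simps power2_eq_square power4_eq_xxxx)
  finally show ?thesis by (simp add: rare_const_def add_divide_distrib)
qed

text \<open>The empirical Bayes rule moves an observation by at most
  \<open>L\<^sup>2 / \<rho>\<close>, which is polynomial in \<open>n\<close>, while the test selects
  it only with probability of order \<open>1 / n ^ 4\<close>.\<close>

lemma geb_part_rare:
  assumes "kappa n \<theta> \<le> b / 2"
  shows "geb_part \<theta> \<le> ennreal (rare_const / n)"
proof -
  let ?q = "2 * L ^ 4 * (1 / \<rho>\<^sup>2)"
  have q: "0 \<le> ?q" "?q \<le> 4 * (real n)\<^sup>2 / c\<^sup>2"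
  proof -
    have "?q \<le> 2 * L ^ 4 * (n / (c\<^sup>2 * L\<^sup>2))" using inv_rho_sq by (intro mult_left_mono) auto
    also have "\<dots> = 2 * L\<^sup>2 * (n / c\<^sup>2)" using L1 c by (simp add: field_simps power2_eq_square power4_eq_xxxx)
    also have "\<dots> \<le> 2 * (2 * real n) * (n / c\<^sup>2)" using bw_sq_le[of n] n2 by (intro mult_right_mono mult_left_mono) auto
    finally show "?q \<le> 4 * (real n)\<^sup>2 / c\<^sup>2" by (simp add: power2_eq_square)
  qed simp
  have P: "prob (gebE \<theta>) \<le> exp (64 / b0\<^sup>2) / real n ^ 4"
    using kappa_concentration(1)[OF b_pos assms] rare_prob unfolding gebE_def by linarith
  have "(\<integral>\<^sup>+\<omega>. ennreal ((geb_shrink \<rho> n (X \<theta> \<omega>) (X \<theta> \<omega> k) - \<theta> k)\<^sup>2) * indicator (gebE \<theta>) \<omega> \<partial>M) \<le> ennreal (rare_const / (real n)\<^sup>2)"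
    if k: "k \<in> {1..n}" for k
  proof -
    have "(geb_shrink \<rho> n (X \<theta> \<omega>) (X \<theta> \<omega> k) - \<theta> k)\<^sup>2 \<le> 2 * (Z k \<omega>)\<^sup>2 + ?q" for \<omega>
    proof -
      let ?x = "X \<theta> \<omega> k" let ?d = "deriv (geb_density n (X \<theta> \<omega>)) ?x" let ?m = "max \<rho> (geb_density n (X \<theta> \<omega>) ?x)"
      have "\<bar>\<Sum>i=1..n. kern' L (?x - X \<theta> \<omega> i)\<bar> \<le> real (card {1..n}) * L\<^sup>2"
        using abs_kern'_le L1 by (intro order_trans[OF sum_abs] sum_bounded_above) auto
      then have "\<bar>?d\<bar> \<le> L\<^sup>2" unfolding deriv_geb_density[OF n2] using n2 by (simp add: field_simps)
      then have "?d\<^sup>2 \<le> (L\<^sup>2)\<^sup>2" by (metis abs_ge_zero power2_abs power_mono)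
      then have d2: "?d\<^sup>2 \<le> L ^ 4" by (simp add: power_mult[symmetric])
      have "\<rho>\<^sup>2 \<le> ?m\<^sup>2" using rho_pos by (intro power_mono) auto
      then have "(?d / ?m)\<^sup>2 \<le> L ^ 4 / \<rho>\<^sup>2"
        unfolding power_divide using rho_pos d2 by (intro frac_le) auto
      then show ?thesis using sq_sum2[of "Z k \<omega>" "?d / ?m"] by (simp add: geb_shrink_def)
    qed
    then have "(\<integral>\<^sup>+\<omega>. ennreal ((geb_shrink \<rho> n (X \<theta> \<omega>) (X \<theta> \<omega> k) - \<theta> k)\<^sup>2) * indicator (gebE \<theta>) \<omega> \<partial>M) \<le>
      ennreal ((2 * (real n)\<^sup>2 + ?q) * prob (gebE \<theta>) + 256 / (real n)\<^sup>2)"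
      by (intro nn_integral_rare[OF k] q(1)) auto
    also have "\<dots> \<le> ennreal (rare_const / (real n)\<^sup>2)"
      by (intro ennreal_leI rare_total q P) simp
    finally show ?thesis .
  qed
  then have "geb_part \<theta> \<le> (\<Sum>k=1..n. ennreal (rare_const / (real n)\<^sup>2))"
    unfolding geb_part_def by (intro sum_mono) auto
  also have "\<dots> = ennreal (rare_const / n)"
    using n2 rare_const_ge by (subst sum_ennreal) (auto simp: power2_eq_square)
  finally show ?thesis .
qed

text \<open>The opposite wrong decision; soft thresholding moves an observation by at most
  \<open>L\<close>.\<close>

lemma soft_part_rare:
  assumes "kappa n \<theta> \<ge> 2 * b"
  shows "soft_part \<theta> \<le> ennreal (rare_const / n)"
proof -
  let ?q = "2 * L\<^sup>2" and ?A = "space M - gebE \<theta>"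
  have q: "0 \<le> ?q" "?q \<le> 4 * (real n)\<^sup>2 / c\<^sup>2"
  proof -
    have c2: "c\<^sup>2 \<le> 1" using c by (simp add: power_le_one)
    have "?q \<le> 4 * real n" using bw_sq_le[of n] n2 by simp
    also have "\<dots> \<le> 4 * (real n)\<^sup>2" using n2 by (simp add: power2_eq_square)
    also have "4 * (real n)\<^sup>2 * 1 \<le> 4 * (real n)\<^sup>2 * (1 / c\<^sup>2)" using c c2 by (intro mult_left_mono) auto
    finally show "?q \<le> 4 * (real n)\<^sup>2 / c\<^sup>2" by simp
  qed simp
  have "?A = {\<omega> \<in> space M. geb_kappa n (X \<theta> \<omega>) \<le> b}" unfolding gebE_def by auto
  then have P: "prob ?A \<le> exp (64 / b0\<^sup>2) / real n ^ 4"
    using kappa_concentration(2)[OF b_pos assms] rare_prob by simp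
  have "(\<integral>\<^sup>+\<omega>. ennreal ((soft_threshold L (X \<theta> \<omega> k) - \<theta> k)\<^sup>2) * indicator ?A \<omega> \<partial>M) \<le> ennreal (rare_const / (real n)\<^sup>2)"
    if k: "k \<in> {1..n}" for k
  proof -
    have "(\<integral>\<^sup>+\<omega>. ennreal ((soft_threshold L (X \<theta> \<omega> k) - \<theta> k)\<^sup>2) * indicator ?A \<omega> \<partial>M) \<le>
      ennreal ((2 * (real n)\<^sup>2 + ?q) * prob ?A + 256 / (real n)\<^sup>2)"
      using L1 by (intro nn_integral_rare[OF k] q(1) soft_threshold_loss) auto
    also have "\<dots> \<le> ennreal (rare_const / (real n)\<^sup>2)"
      by (intro ennreal_leI rare_total q P) simp
    finally show ?thesis .
  qed
  then have "soft_part \<theta> \<le> (\<Sum>k=1..n. ennreal (rare_const / (real n)\<^sup>2))"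
    unfolding soft_part_def by (intro sum_mono) auto
  also have "\<dots> = ennreal (rare_const / n)"
    using n2 rare_const_ge by (subst sum_ennreal) (auto simp: power2_eq_square)
  finally show ?thesis .
qed

lemma nn_integral_soft_le:
  assumes k: "k \<in> {1..n}"
  shows "(\<integral>\<^sup>+\<omega>. ennreal ((soft_threshold L (X \<theta> \<omega> k) - \<theta> k)\<^sup>2) * indicator A \<omega> \<partial>M) \<le>
    ennreal (8 / (n * L ^ 3) + (16 + 2 * L\<^sup>2) * min ((\<theta> k)\<^sup>2) 1)"
proof -
  have "(\<integral>\<^sup>+\<omega>. ennreal ((soft_threshold L (X \<theta> \<omega> k) - \<theta> k)\<^sup>2) * indicator A \<omega> \<partial>M) \<le>
    (\<integral>\<^sup>+\<omega>. ennreal ((soft_threshold L (\<theta> k + Z k \<omega>) - \<theta> k)\<^sup>2) \<partial>M)"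
    by (intro nn_integral_mono) (auto split: split_indicator)
  also have "\<dots> = (\<integral>\<^sup>+z. ennreal ((soft_threshold L (\<theta> k + z) - \<theta> k)\<^sup>2) \<partial>std_normal_distribution)"
    by (rule nn_integral_Z[OF k]) simp
  also have "\<dots> \<le> ennreal (2 * (4 * exp (- (L\<^sup>2) / 2) / L ^ 3) + (16 + 2 * L\<^sup>2) * min ((\<theta> k)\<^sup>2) 1)"
    using L1 by (intro soft_threshold_risk soft_threshold_risk_zero) auto
  also have "2 * (4 * exp (- (L\<^sup>2) / 2) / L ^ 3) = 8 / (n * L ^ 3)"
    using exp_bw(2)[of n] n2 by simp
  finally show ?thesis .
qed

text \<open>The first term is \<open>n\<close> times \<open>8 / (n * L ^ 3)\<close>, twice the sharp
  bound for the risk at mean zero with threshold \<open>L\<close>.\<close>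

lemma soft_part_le: "soft_part \<theta> \<le> ennreal (8 / L ^ 3 + 18 * n * L\<^sup>2 * sparsity n \<theta>)"
proof -
  have "soft_part \<theta> \<le> (\<Sum>k=1..n. ennreal (8 / (n * L ^ 3) + (16 + 2 * L\<^sup>2) * min ((\<theta> k)\<^sup>2) 1))"
    unfolding soft_part_def by (intro sum_mono nn_integral_soft_le)
  also have "\<dots> = ennreal (\<Sum>k=1..n. 8 / (n * L ^ 3) + (16 + 2 * L\<^sup>2) * min ((\<theta> k)\<^sup>2) 1)"
    using L1 by (intro sum_ennreal add_nonneg_nonneg mult_nonneg_nonneg) auto
  also have "(\<Sum>k=1..n. 8 / (n * L ^ 3) + (16 + 2 * L\<^sup>2) * min ((\<theta> k)\<^sup>2) 1) = 8 / L ^ 3 + (16 + 2 * L\<^sup>2) * (n * sparsity n \<theta>)"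
    using n2 by (simp add: sum.distrib sum_distrib_left[symmetric] sparsity_def)
  also have "\<dots> \<le> 8 / L ^ 3 + (18 * L\<^sup>2) * (n * sparsity n \<theta>)"
    using one_le_power[OF L1, of 2] sparsity_nonneg[of n \<theta>] by (intro add_left_mono mult_right_mono) auto
  finally show ?thesis by (simp add: mult_ac ennreal_leI)
qed

text \<open>Free of any assumption on \<theta>: either \<open>kappa\<close> is large and soft
  thresholding is selected with negligible probability, or the sparsity is at most
  \<open>10 * b\<close>, of order \<open>L\<^sup>2 / sqrt n\<close>, which
  \<open>soft_part_le\<close> multiplies by \<open>n * L\<^sup>2\<close>.\<close>

lemma soft_part_small:
  "soft_part \<theta> \<le> ennreal (n * ((8 + 90 * b0 + rare_const) * L ^ 4 / sqrt n))"
proof -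
  have L: "1 \<le> L ^ 4" "1 \<le> L ^ 3" using L1 by auto
  have s: "sqrt n \<ge> 1" "sqrt n * sqrt n = n" "sqrt n \<le> n"
    using n2 by (auto simp: real_le_lsqrt power2_eq_square)
  have sL: "1 \<le> sqrt n * L ^ 4" using mult_mono[of 1 "sqrt n" 1 "L ^ 4"] s L by simp
  have e: "n * (r * L ^ 4 / sqrt n) = r * (sqrt n * L ^ 4)" for r using s(2) n2 by (simp add: field_simps)
  show ?thesis
  proof (cases "kappa n \<theta> \<ge> 2 * b")
    case True
    have "rare_const / n \<le> rare_const * 1" using rare_const_ge n2 by (simp add: field_simps)
    also have "\<dots> \<le> (8 + 90 * b0 + rare_const) * (sqrt n * L ^ 4)"
      using rare_const_ge sL b0 by (intro mult_mono) auto
    finally show ?thesis unfolding e by (intro order_trans[OF soft_part_rare[OF True]] ennreal_leI)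
  next
    case False
    have "sparsity n \<theta> \<le> 10 * b" using kappa_sparsity(1)[of n \<theta>] False by linarith
    also have "10 * b = 5 * b0 * L\<^sup>2 / sqrt n" using n2 by (simp add: b_def geb_b_def bw_sq)
    finally have "18 * n * L\<^sup>2 * sparsity n \<theta> \<le> 18 * n * L\<^sup>2 * (5 * b0 * L\<^sup>2 / sqrt n)" by (intro mult_left_mono) auto
    also have "\<dots> = n * ((90 * b0) * L ^ 4 / sqrt n)" by (simp add: power2_eq_square power4_eq_xxxx)
    also have "\<dots> = (90 * b0) * (sqrt n * L ^ 4)" by (rule e)
    finally have "18 * n * L\<^sup>2 * sparsity n \<theta> \<le> (90 * b0) * (sqrt n * L ^ 4)" .
    moreover have "8 / L ^ 3 \<le> 8 / 1" using L L1 by (intro divide_left_mono) auto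
    moreover have "8 * 1 \<le> 8 * (sqrt n * L ^ 4)" using sL by (intro mult_left_mono) auto
    moreover have "0 \<le> rare_const * (sqrt n * L ^ 4)" using rare_const_ge sL by (intro mult_nonneg_nonneg) auto
    ultimately have "8 / L ^ 3 + 18 * n * L\<^sup>2 * sparsity n \<theta> \<le> 8 * (sqrt n * L ^ 4) + (90 * b0) * (sqrt n * L ^ 4) + rare_const * (sqrt n * L ^ 4)"
      by linarith
    then show ?thesis
      unfolding e by (intro order_trans[OF soft_part_le] ennreal_leI) (simp only: distrib_right)
  qed
qed

lemma geb_part_le:
  "geb_part \<theta> \<le> (\<Sum>k=1..n. \<integral>\<^sup>+\<omega>. ennreal ((geb_shrink \<rho> n (X \<theta> \<omega>) (X \<theta> \<omega> k) - \<theta> k)\<^sup>2) \<partial>M)"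
  unfolding geb_part_def by (intro sum_mono nn_integral_mono) (auto split: split_indicator)

lemma risk_sum_crude: "risk_sum \<theta> \<le> ennreal (n * ((10 * KK + 26) * L\<^sup>2))"
proof -
  have g: "geb_part \<theta> \<le> (\<Sum>k=1..n. ennreal (10 * KK * L\<^sup>2))"
    by (rule order_trans[OF geb_part_le]) (intro sum_mono geb_risk_crude)
  have m: "sparsity n \<theta> \<le> 1"
  proof -
    have "(\<Sum>i=1..n. min ((\<theta> i)\<^sup>2) 1) \<le> real (card {1..n}) * 1" by (intro sum_bounded_above) auto
    then show ?thesis using n2 by (simp add: sparsity_def)
  qed
  have KK: "KK > 0" by (rule KK_pos)
  have "8 / L ^ 3 \<le> 8 / 1" using L1 one_le_power[OF L1, of 3] by (intro divide_left_mono) auto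
  also have "8 / 1 = 8 * (1::real)" by simp
  also have "8 * 1 \<le> 8 * (n * L\<^sup>2)" using one_le_power[OF L1, of 2] n2 mult_mono[of 1 "real n" 1 "L\<^sup>2"] by (intro mult_left_mono) auto
  finally have "8 / L ^ 3 + 18 * n * L\<^sup>2 * sparsity n \<theta> \<le> 8 * (n * L\<^sup>2) + 18 * n * L\<^sup>2 * 1"
    using m by (intro add_mono mult_left_mono) auto
  then have "soft_part \<theta> \<le> ennreal (26 * (n * L\<^sup>2))"
    by (intro order_trans[OF soft_part_le] ennreal_leI) simp
  with g have "risk_sum \<theta> \<le> (\<Sum>k=1..n. ennreal (10 * KK * L\<^sup>2)) + ennreal (26 * (n * L\<^sup>2))"
    by (intro order_trans[OF risk_sum_le] add_mono)
  also have "\<dots> = ennreal (n * (10 * KK * L\<^sup>2)) + ennreal (26 * (n * L\<^sup>2))"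
    using KK by (subst sum_ennreal) auto
  also have "\<dots> = ennreal (n * ((10 * KK + 26) * L\<^sup>2))"
    using KK by (subst ennreal_plus[symmetric]) (auto simp: algebra_simps)
  finally show ?thesis .
qed

text \<open>The soft threshold with \<open>t\<^sup>2 = 8 ln (1 / \<mu>)\<close> is nearly optimal for sparsity \<open>\<mu> \<le> 1\<close>; for \<open>\<mu> > 1\<close>
  the identity is used.\<close>

lemma geb_part_fine:
  assumes \<mu>: "\<mu> > 0" "sparsity n \<theta> \<le> \<mu>" and g: "0 < g" "g < 1" and T: "T \<ge> 1"
  shows "geb_part \<theta> \<le> ennreal (n * ((144 + 48 / g) * min 1 (\<mu> powr (1 - g)) + 100 * (KK + C) * L ^ 4 *
      (T / sqrt n + (\<Sum>k=1..n. if \<bar>\<theta> k\<bar> > T / 2 then 1 else 0) / n + exp (- T\<^sup>2 / 16))))"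
proof -
  define R where "R = (48 + 16 / g) * min 1 (\<mu> powr (1 - g))"
  have R0: "R \<ge> 0" unfolding R_def using g by auto
  have "\<exists>s \<in> borel_measurable borel. (\<Sum>k=1..n. \<integral>\<^sup>+y. ennreal ((s (\<theta> k + y) - \<theta> k)\<^sup>2) \<partial>std_normal_distribution) \<le> ennreal (n * R)"
  proof (cases "\<mu> \<le> 1")
    case True
    define t where "t = sqrt (8 * ln (1 / \<mu>))"
    have t: "t \<ge> 0" "t\<^sup>2 = 8 * ln (1 / \<mu>)" using True \<mu> by (auto simp: t_def ln_div)
    have ex: "exp (- (t\<^sup>2) / 8) = \<mu>" using \<mu> unfolding t by (simp add: ln_div)
    have "(\<Sum>k=1..n. \<integral>\<^sup>+y. ennreal ((soft_threshold t (\<theta> k + y) - \<theta> k)\<^sup>2) \<partial>std_normal_distribution) \<le>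
      (\<Sum>k=1..n. ennreal (2 * (16 * exp (- (t\<^sup>2) / 8)) + (16 + 2 * t\<^sup>2) * min ((\<theta> k)\<^sup>2) 1))"
      using t by (intro sum_mono soft_threshold_risk soft_threshold_risk_weak) auto
    also have "\<dots> = ennreal (\<Sum>k=1..n. 2 * (16 * exp (- (t\<^sup>2) / 8)) + (16 + 2 * t\<^sup>2) * min ((\<theta> k)\<^sup>2) 1)"
      by (intro sum_ennreal add_nonneg_nonneg mult_nonneg_nonneg) auto
    also have "(\<Sum>k=1..n. 2 * (16 * exp (- (t\<^sup>2) / 8)) + (16 + 2 * t\<^sup>2) * min ((\<theta> k)\<^sup>2) 1) = n * (32 * \<mu> + (16 + 2 * t\<^sup>2) * sparsity n \<theta>)"
      using n2 unfolding ex by (simp add: sum.distrib sum_distrib_left[symmetric] sparsity_def distrib_left)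
    also have "\<dots> \<le> n * R"
    proof (intro mult_left_mono)
      \<comment> \<open>The logarithm in \<open>t\<^sup>2\<close> is traded for a small power of
        \<open>1 / \<mu>\<close>; this is the origin of the exponent \<open>1 - g\<close>.\<close>
      have l: "ln (1 / \<mu>) \<le> (1 / \<mu>) powr g / g" using True \<mu> g by (intro ln_powr_bound) auto
      have pg: "(1 / \<mu>) powr g * \<mu> = \<mu> powr (1 - g)"
        using \<mu> by (simp add: powr_divide powr_diff)
      have le: "\<mu> \<le> \<mu> powr (1 - g)" using \<mu> True g powr_mono'[of "1 - g" 1 \<mu>] by simp
      have "(16 + 2 * t\<^sup>2) * sparsity n \<theta> \<le> (16 + 16 * ln (1 / \<mu>)) * \<mu>"
        using \<mu> True t by (intro mult_mono) (auto simp: sparsity_nonneg)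
      also have "\<dots> \<le> 16 * \<mu> + 16 * ((1 / \<mu>) powr g / g * \<mu>)"
        using mult_right_mono[OF l, of \<mu>] \<mu> by (simp add: distrib_right)
      also have "(1 / \<mu>) powr g / g * \<mu> = \<mu> powr (1 - g) / g" using pg by (simp add: field_simps)
      finally have "32 * \<mu> + (16 + 2 * t\<^sup>2) * sparsity n \<theta> \<le> 48 * \<mu> powr (1 - g) + 16 * (\<mu> powr (1 - g) / g)" using le by linarith
      moreover have "min 1 (\<mu> powr (1 - g)) = \<mu> powr (1 - g)"
        using \<mu> True g powr_mono2[of "1 - g" \<mu> 1] by simp
      ultimately show "32 * \<mu> + (16 + 2 * t\<^sup>2) * sparsity n \<theta> \<le> R" by (simp add: R_def algebra_simps)
    qed simp
    finally show ?thesis by (intro bexI[of _ "soft_threshold t"]) (auto simp: ennreal_leI)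
  next
    case False
    have "min 1 (\<mu> powr (1 - g)) = 1" using False g ge_one_powr_ge_zero[of \<mu> "1 - g"] by simp
    then have R: "R \<ge> 8" unfolding R_def using g by simp
    have "(\<Sum>k=1..n. \<integral>\<^sup>+y. ennreal ((\<theta> k + y - \<theta> k)\<^sup>2) \<partial>std_normal_distribution) \<le> (\<Sum>k=1..n. ennreal 8)"
      using std_normal_moment2 by (intro sum_mono) simp
    also have "\<dots> = ennreal (n * 8)" by (subst sum_ennreal) auto
    also have "\<dots> \<le> ennreal (n * R)" using mult_left_mono[OF R, of "real n"] by (intro ennreal_leI) simp
    finally show ?thesis by (intro bexI[of _ "\<lambda>x. x"]) auto
  qed
  then obtain s where s: "s \<in> borel_measurable borel"
    "(\<Sum>k=1..n. \<integral>\<^sup>+y. ennreal ((s (\<theta> k + y) - \<theta> k)\<^sup>2) \<partial>std_normal_distribution) \<le> ennreal (n * R)" by blast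
  have "3 * R = (144 + 48 / g) * min 1 (\<mu> powr (1 - g))" by (simp add: R_def algebra_simps)
  then show ?thesis using order_trans[OF geb_part_le geb_risk_fine[OF T s R0]] by simp
qed

end

text \<open>With \<open>d = g / (k + 1)\<close>, the bound of \<open>ln x\<close> by
  \<open>x powr d / d\<close> is raised to the power \<open>k\<close>. It absorbs all logarithmic
  factors into small powers of \<open>n\<close>.\<close>

lemma bw_power_le:
  assumes "g > 0"
  shows "\<exists>K\<ge>1. \<forall>n\<ge>2. bw n ^ k \<le> K * real n powr g"
proof -
  define d where "d = g / (k + 1)"
  have d: "d > 0" "k * d \<le> g" using assms by (auto simp: d_def field_simps)
  define K where "K = (1 + 2 / d) ^ k"
  have "bw n ^ k \<le> K * real n powr g" if n: "n \<ge> 2" for n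
  proof -
    have n1: "1 \<le> real n powr d" using n d by (intro ge_one_powr_ge_zero) auto
    have "bw n \<le> (bw n)\<^sup>2" using bw_ge_1[OF n] by (simp add: power2_eq_square)
    also have "\<dots> = 2 * ln (real n)" using n by (intro bw_sq) simp
    also have "\<dots> \<le> 2 * (real n powr d / d)" using n d by (intro mult_left_mono ln_powr_bound) auto
    also have "\<dots> \<le> (1 + 2 / d) * real n powr d" using n1 by (simp add: distrib_right)
    finally have "bw n ^ k \<le> ((1 + 2 / d) * real n powr d) ^ k" using bw_ge_1[OF n] by (intro power_mono) auto
    also have "\<dots> = K * real n powr (k * d)"
      using n by (simp add: power_mult_distrib K_def powr_power mult.commute)
    also have "\<dots> \<le> K * real n powr g"
      using n d by (intro mult_left_mono powr_mono) (auto simp: K_def)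
    finally show ?thesis .
  qed
  moreover have "K \<ge> 1" unfolding K_def using d by (intro one_le_power) simp
  ultimately show ?thesis by blast
qed

section \<open>Level risk in terms of a bound for the moment of order \<open>pp\<close>\<close>

context gauss_level_geb
begin

context
  fixes \<theta> :: "nat \<Rightarrow> real" and \<mu> pp :: real
  assumes \<mu>: "\<mu> > 0" and mom: "(\<Sum>i=1..n. \<bar>\<theta> i\<bar> powr pp) / n \<le> \<mu>" and pp: "0 < pp" "pp \<le> 2"
begin

text \<open>By \<open>pp \<le> 2\<close>, the power \<open>\<bar>x\<bar> powr pp\<close> dominates
  \<open>min (x\<^sup>2) 1\<close> on both sides of \<open>\<bar>x\<bar> = 1\<close>.\<close>

lemma sparsity_le_moment: "sparsity n \<theta> \<le> \<mu>"
proof -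
  have "min (x\<^sup>2) 1 \<le> \<bar>x\<bar> powr pp" for x :: real
  proof (cases "\<bar>x\<bar> \<le> 1")
    case True
    have "\<bar>x\<bar> powr 2 \<le> \<bar>x\<bar> powr pp" using pp True by (intro powr_mono') auto
    moreover have "\<bar>x\<bar> powr 2 = x\<^sup>2" by (cases "x = 0") (auto simp: powr_numeral)
    ultimately show ?thesis by simp
  next
    case False
    then have "1 \<le> \<bar>x\<bar> powr pp" using pp by (intro ge_one_powr_ge_zero) auto
    then show ?thesis by simp
  qed
  then have "sparsity n \<theta> \<le> (\<Sum>i=1..n. \<bar>\<theta> i\<bar> powr pp) / n"
    unfolding sparsity_def by (intro divide_right_mono sum_mono) auto
  then show ?thesis using mom by linarith
qed

text \<open>Markov's inequality for the empirical distribution of \<theta>.\<close>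

lemma outlier_le_moment:
  assumes "T > 0" shows "(\<Sum>k=1..n. if \<bar>\<theta> k\<bar> > T / 2 then 1 else 0) / n \<le> (2 / T) powr pp * \<mu>"
proof -
  have "(if \<bar>x\<bar> > T / 2 then 1 else 0) \<le> (2 / T) powr pp * \<bar>x\<bar> powr pp" for x :: real
  proof -
    have "1 \<le> (2 / T * \<bar>x\<bar>) powr pp" if "\<bar>x\<bar> > T / 2"
      using that assms pp by (intro ge_one_powr_ge_zero) (auto simp: field_simps)
    then show ?thesis using assms by (auto simp: powr_mult[symmetric])
  qed
  then have "(\<Sum>k=1..n. if \<bar>\<theta> k\<bar> > T / 2 then 1 else 0) / n \<le> (\<Sum>k=1..n. (2 / T) powr pp * \<bar>\<theta> k\<bar> powr pp) / n"
    by (intro divide_right_mono sum_mono) auto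
  also have "\<dots> = (2 / T) powr pp * ((\<Sum>k=1..n. \<bar>\<theta> k\<bar> powr pp) / n)"
    by (simp add: sum_distrib_left)
  also have "\<dots> \<le> (2 / T) powr pp * \<mu>" using mom by (intro mult_left_mono) auto
  finally show ?thesis .
qed

text \<open>The truncation \<open>T = n powr (1/4)\<close> makes all remainders of
  \<open>geb_part_fine\<close> negative powers of \<open>n\<close>: \<open>T / sqrt n\<close> and
  the exponential have order \<open>n powr (- 1/4)\<close>, the proportion of large means
  \<open>n powr (- pp / 4) * \<mu>\<close>. After \<open>n powr (pp / 16)\<close> is spent on
  \<open>L ^ 4\<close>, each is still at most of order
  \<open>n powr (- pp / 16) * (1 + \<mu>)\<close>, thanks to \<open>pp \<le> 2\<close>.\<close>

lemma risk_sum_middle: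
  fixes g K :: real
  assumes g: "0 < g" "g < 1" and K: "L ^ 4 \<le> K * n powr (pp / 16)" "K \<ge> 1"
  shows "risk_sum \<theta> \<le> ennreal ((144 + 48 / g) * n * min 1 (\<mu> powr (1 - g)) +
    (1700 * (KK + C) + 8 + 90 * b0 + rare_const) * K * n powr (1 - pp / 16) * (1 + \<mu>))"
proof -
  define T where "T = real n powr (1/4)"
  define m where "m = min 1 (\<mu> powr (1 - g))"
  have n1: "1 \<le> real n" using n2 by simp
  have T: "T \<ge> 1" unfolding T_def using n1 by (intro ge_one_powr_ge_zero) auto
  have sq: "sqrt n = n powr (1/2)" by (simp add: powr_half_sqrt)
  have KK: "KK > 0" by (rule KK_pos)
  have KC: "KK + C > 0" using KK C by simp
  have t1: "T / sqrt n = n powr (- 1/4)"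
    unfolding T_def sq by (simp add: powr_diff[symmetric])
  have t2: "(2 / T) powr pp \<le> 4 * n powr (- pp / 4)"
  proof -
    have "(2 / T) powr pp = 2 powr pp / T powr pp" using T by (simp add: powr_divide)
    also have "T powr pp = n powr (pp / 4)" unfolding T_def by (simp add: powr_powr)
    also have "2 powr pp / n powr (pp / 4) \<le> 2 powr 2 / n powr (pp / 4)"
      using pp by (intro divide_right_mono powr_mono) auto
    also have "\<dots> = 4 * n powr (- pp / 4)" by (simp add: powr_minus_divide)
    finally show ?thesis .
  qed
  have t3: "exp (- T\<^sup>2 / 16) \<le> 16 * n powr (- 1/4)"
  proof -
    have "T\<^sup>2 = sqrt n" using n1 unfolding T_def sq by (simp add: powr_power)
    then have "exp (- T\<^sup>2 / 16) = inverse (exp (sqrt n / 16))" by (simp add: exp_minus)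
    also have "\<dots> \<le> inverse (sqrt n / 16)"
    proof (rule le_imp_inverse_le)
      show "sqrt n / 16 \<le> exp (sqrt n / 16)" using exp_ge_add_one_self[of "sqrt n / 16"] by linarith
    qed (use n2 in auto)
    also have "\<dots> = 16 * n powr (- 1/2)" unfolding sq by (simp add: powr_minus_divide)
    also have "\<dots> \<le> 16 * n powr (- 1/4)" using n1 by (intro mult_left_mono powr_mono) auto
    finally show ?thesis .
  qed
  have e: "L ^ 4 * n powr r \<le> K * n powr (- pp / 16)" if "r + pp / 16 \<le> - pp / 16" for r
  proof -
    have "L ^ 4 * n powr r \<le> K * n powr (pp / 16) * n powr r" using K by (intro mult_right_mono) auto
    also have "\<dots> = K * n powr (r + pp / 16)" by (simp add: powr_add)
    also have "\<dots> \<le> K * n powr (- pp / 16)" using that n1 K by (intro mult_left_mono powr_mono) auto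
    finally show ?thesis .
  qed
  have e1: "L ^ 4 * n powr (- 1/4) \<le> K * n powr (- pp / 16)" using pp by (intro e) auto
  have e2: "L ^ 4 * n powr (- pp/4) \<le> K * n powr (- pp / 16)" using pp by (intro e) auto
  have e3: "L ^ 4 * n powr (- 1/2) \<le> K * n powr (- pp / 16)" using pp by (intro e) auto
  define Q where "Q = K * n powr (- pp / 16)"
  have Q0: "Q > 0" unfolding Q_def using K n2 by simp
  have "L ^ 4 * (T / sqrt n + (\<Sum>k=1..n. if \<bar>\<theta> k\<bar> > T / 2 then 1 else 0) / n + exp (- T\<^sup>2 / 16)) \<le>
    L ^ 4 * (17 * n powr (- 1/4) + 4 * n powr (- pp / 4) * \<mu>)"
  proof (intro mult_left_mono)
    have "(2 / T) powr pp * \<mu> \<le> 4 * n powr (- pp / 4) * \<mu>" using t2 \<mu> by (intro mult_right_mono) auto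
    then show "T / sqrt n + (\<Sum>k=1..n. if \<bar>\<theta> k\<bar> > T / 2 then 1 else 0) / n + exp (- T\<^sup>2 / 16) \<le>
      17 * n powr (- 1/4) + 4 * n powr (- pp / 4) * \<mu>"
      using t1 t3 outlier_le_moment[of T] T by linarith
  qed simp
  also have "\<dots> = 17 * (L ^ 4 * n powr (- 1/4)) + 4 * (L ^ 4 * n powr (- pp / 4)) * \<mu>" by algebra
  also have "\<dots> \<le> 17 * Q + 4 * Q * \<mu>" unfolding Q_def
    using \<mu> by (intro add_mono mult_left_mono mult_right_mono e1 e2) auto
  also have "\<dots> \<le> 17 * (Q * (1 + \<mu>))" using Q0 \<mu> by (simp add: algebra_simps)
  finally have G: "L ^ 4 * (T / sqrt n + (\<Sum>k=1..n. if \<bar>\<theta> k\<bar> > T / 2 then 1 else 0) / n + exp (- T\<^sup>2 / 16)) \<le> 17 * (Q * (1 + \<mu>))" .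
  have g1: "geb_part \<theta> \<le> ennreal (n * ((144 + 48 / g) * m + 1700 * (KK + C) * (Q * (1 + \<mu>))))"
  proof (rule order_trans[OF geb_part_fine[OF \<mu> sparsity_le_moment g T]], intro ennreal_leI mult_left_mono)
    show "(144 + 48 / g) * min 1 (\<mu> powr (1 - g)) + 100 * (KK + C) * L ^ 4 *
        (T / sqrt n + (\<Sum>k=1..n. if \<bar>\<theta> k\<bar> > T / 2 then 1 else 0) / n + exp (- T\<^sup>2 / 16)) \<le>
      (144 + 48 / g) * m + 1700 * (KK + C) * (Q * (1 + \<mu>))"
    proof -
      have "100 * (KK + C) * L ^ 4 * (T / sqrt n + (\<Sum>k=1..n. if \<bar>\<theta> k\<bar> > T / 2 then 1 else 0) / n + exp (- T\<^sup>2 / 16)) \<le>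
          100 * (KK + C) * (17 * (Q * (1 + \<mu>)))"
        unfolding mult.assoc[of _ "L ^ 4"] using KC by (intro mult_left_mono G) auto
      also have "\<dots> = 1700 * (KK + C) * (Q * (1 + \<mu>))" by algebra
      finally show ?thesis unfolding m_def by (intro add_left_mono)
    qed
  qed simp
  have s1: "soft_part \<theta> \<le> ennreal (n * ((8 + 90 * b0 + rare_const) * (Q * (1 + \<mu>))))"
  proof (rule order_trans[OF soft_part_small], intro ennreal_leI mult_left_mono)
    have "L ^ 4 / sqrt n \<le> Q" using e3 unfolding sq Q_def by (simp add: powr_minus_divide)
    also have "\<dots> \<le> Q * (1 + \<mu>)" using Q0 \<mu> by simp
    finally have "(8 + 90 * b0 + rare_const) * (L ^ 4 / sqrt n) \<le> (8 + 90 * b0 + rare_const) * (Q * (1 + \<mu>))"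
      using rare_const_ge b0 by (intro mult_left_mono) auto
    then show "(8 + 90 * b0 + rare_const) * L ^ 4 / sqrt n \<le> (8 + 90 * b0 + rare_const) * (Q * (1 + \<mu>))" by simp
  qed simp
  have nQ: "n * Q = K * n powr (1 - pp / 16)"
    unfolding Q_def using n1 powr_add[of "real n" 1 "- pp / 16"] by simp
  have nn: "0 \<le> n * ((144 + 48 / g) * m + 1700 * (KK + C) * (Q * (1 + \<mu>)))" "0 \<le> n * ((8 + 90 * b0 + rare_const) * (Q * (1 + \<mu>)))"
    using g KC Q0 \<mu> rare_const_ge b0 by (auto simp: m_def intro!: mult_nonneg_nonneg add_nonneg_nonneg)
  have "risk_sum \<theta> \<le> ennreal (n * ((144 + 48 / g) * m + 1700 * (KK + C) * (Q * (1 + \<mu>)))) + ennreal (n * ((8 + 90 * b0 + rare_const) * (Q * (1 + \<mu>))))"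
    by (rule order_trans[OF risk_sum_le add_mono[OF g1 s1]])
  also have "\<dots> = ennreal (n * ((144 + 48 / g) * m + 1700 * (KK + C) * (Q * (1 + \<mu>))) + n * ((8 + 90 * b0 + rare_const) * (Q * (1 + \<mu>))))"
    using nn by (simp add: ennreal_plus[symmetric] del: ennreal_plus)
  also have "n * ((144 + 48 / g) * m + 1700 * (KK + C) * (Q * (1 + \<mu>))) + n * ((8 + 90 * b0 + rare_const) * (Q * (1 + \<mu>)))
    = (144 + 48 / g) * n * m + (1700 * (KK + C) + 8 + 90 * b0 + rare_const) * (n * Q) * (1 + \<mu>)" by algebra
  finally show ?thesis unfolding nQ m_def by (simp add: mult.assoc)
qed

text \<open>For \<open>\<mu> \<ge> 1\<close> the crude bound suffices. For \<open>\<mu> < 1\<close>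
  and \<open>kappa n \<theta> \<le> b / 2\<close> the empirical Bayes rule is selected with
  negligible probability. Otherwise \<open>b / 2 < kappa n \<theta> \<le> sparsity n \<theta> \<le>
  \<mu>\<close>, hence \<open>1 / sqrt n\<close> is at most a multiple of \<mu>, and the remainders
  of \<open>geb_part_fine\<close> become multiples of \<mu> up to powers of
  \<open>L\<close>.\<close>

lemma risk_sum_far:
  fixes g K :: real
  assumes g: "0 < g" "g < 1" and K: "L ^ 5 \<le> K * n powr g" "L ^ 3 \<le> K * n" "K \<ge> 1"
  shows "risk_sum \<theta> \<le> ennreal ((8 + rare_const * K) / L ^ 3 +
    (10 * KK + 26 + 144 + 48 / g + 100 * (KK + C) * (20 / b0 + 1)) * K * (n powr (1 + g) * \<mu> powr (1 - g)))"
    (is "_ \<le> ennreal (?a + ?b * K * ?p)")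
proof -
  have n1: "1 \<le> real n" using n2 by simp
  have KK: "KK > 0" by (rule KK_pos)
  have KC: "KK + C > 0" using KK C by simp
  have b1: "10 * KK + 26 \<le> ?b" "?b \<ge> 0" "0 \<le> 144 + 48 / g" "0 \<le> 100 * (KK + C) * (20 / b0 + 1)"
    using KK KC g b0 by (auto intro!: mult_nonneg_nonneg add_nonneg_nonneg)
  have p0: "?p \<ge> 0" by simp
  have a0: "?a \<ge> 0" using rare_const_ge K L1 by (intro divide_nonneg_nonneg add_nonneg_nonneg mult_nonneg_nonneg) auto
  have L2: "L\<^sup>2 \<le> K * n powr g" using power_increasing[OF _ L1, of 2 5] K by linarith
  have np: "real n * n powr g = n powr (1 + g)" using n1 powr_add[of "real n" 1 g] by simp
  show ?thesis
  proof (cases "\<mu> \<ge> 1")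
    case True
    have "1 \<le> \<mu> powr (1 - g)" using True g by (intro ge_one_powr_ge_zero) auto
    then have "n powr (1 + g) * 1 \<le> ?p" by (intro mult_left_mono) auto
    then have q: "K * n powr (1 + g) \<le> K * ?p" using K by (intro mult_left_mono) auto
    have "n * ((10 * KK + 26) * L\<^sup>2) \<le> n * ((10 * KK + 26) * (K * n powr g))"
      using L2 KK by (intro mult_left_mono) auto
    also have "\<dots> = (10 * KK + 26) * (K * n powr (1 + g))" unfolding np[symmetric] by algebra
    also have "\<dots> \<le> ?b * (K * ?p)" using b1 q K by (intro mult_mono) auto
    finally have "n * ((10 * KK + 26) * L\<^sup>2) \<le> ?a + ?b * K * ?p" using a0 by (simp add: mult.assoc)
    then show ?thesis by (intro order_trans[OF risk_sum_crude] ennreal_leI)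
  next
    case False
    have m: "\<mu> \<le> \<mu> powr (1 - g)" using \<mu> False g powr_mono'[of "1 - g" 1 \<mu>] by simp
    have LK: "L ^ 5 * \<mu> \<le> K * n powr g * \<mu> powr (1 - g)" using K m \<mu> by (intro mult_mono) auto
    have nLK: "n * (L ^ 5 * \<mu>) \<le> K * ?p"
      using mult_left_mono[OF LK, of "real n"] unfolding np[symmetric] by (simp add: mult_ac)
    have "n * L\<^sup>2 * sparsity n \<theta> \<le> n * L ^ 5 * \<mu>"
      using power_increasing[OF _ L1, of 2 5] sparsity_le_moment sparsity_nonneg[of n \<theta>] L1 by (intro mult_mono mult_left_mono) auto
    then have soft: "soft_part \<theta> \<le> ennreal (8 / L ^ 3 + 18 * (K * ?p))"
      using nLK by (intro order_trans[OF soft_part_le] ennreal_leI) (simp add: mult.assoc)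
    have nm: "n * \<mu> powr (1 - g) \<le> K * ?p"
    proof -
      have "1 \<le> K * n powr g" using K n1 g ge_one_powr_ge_zero[of "real n" g] mult_mono[of 1 K 1 "n powr g"] by simp
      then have "n * \<mu> powr (1 - g) * 1 \<le> n * \<mu> powr (1 - g) * (K * n powr g)" by (intro mult_left_mono) auto
      then show ?thesis unfolding np[symmetric] by (simp add: mult_ac)
    qed
    have geb: "geb_part \<theta> \<le> ennreal (rare_const * K / L ^ 3 + (144 + 48 / g + 100 * (KK + C) * (20 / b0 + 1)) * (K * ?p))"
    proof (cases "kappa n \<theta> \<le> b / 2")
      case True
      have "rare_const / n \<le> rare_const * (K / L ^ 3)"
        unfolding divide_inverse[of rare_const] using K(2) L1 n2 rare_const_ge by (intro mult_left_mono) (auto simp: field_simps)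
      moreover have "0 \<le> (144 + 48 / g + 100 * (KK + C) * (20 / b0 + 1)) * (K * ?p)"
        using b1 K by (intro mult_nonneg_nonneg add_nonneg_nonneg[OF b1(3,4)]) auto
      ultimately show ?thesis by (intro order_trans[OF geb_part_rare[OF True]] ennreal_leI) simp
    next
      case False
      have "ln 2 \<le> ln (real n)" using n2 by simp
      then have ln: "1 / 2 \<le> ln (real n)" using ln2_ge_two_thirds by linarith
      have "b0 * (1 / 2) / sqrt n / 2 \<le> b / 2"
        unfolding b_def geb_b_def using ln b0 by (intro divide_right_mono mult_left_mono) auto
      also have "\<dots> \<le> \<mu>" using False kappa_sparsity(2)[of n \<theta>] sparsity_le_moment by linarith
      finally have sn: "1 / sqrt n \<le> 4 / b0 * \<mu>" using b0 n2 by (simp add: field_simps)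
      \<comment> \<open>The truncation \<open>4 * L\<close> makes
        \<open>exp (- T\<^sup>2 / 16)\<close> equal to \<open>1 / n\<^sup>2\<close>, which is below
        \<open>1 / sqrt n\<close>, and keeps \<open>T / sqrt n\<close> within a logarithmic factor
        of \<open>1 / sqrt n\<close>.\<close>
      have T: "4 * L \<ge> 1" using L1 by simp
      have t1: "4 * L / sqrt n \<le> 16 * L / b0 * \<mu>" using mult_left_mono[OF sn, of "4 * L"] L1 by simp
      have t2: "(\<Sum>k=1..n. if \<bar>\<theta> k\<bar> > 4 * L / 2 then 1 else 0) / n \<le> \<mu>"
      proof -
        have "(2 / (4 * L)) powr pp \<le> 1" using L1 pp by (intro powr_le1) auto
        then have "(2 / (4 * L)) powr pp * \<mu> \<le> 1 * \<mu>" using \<mu> by (intro mult_right_mono) auto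
        then show ?thesis using outlier_le_moment[of "4 * L"] L1 by linarith
      qed
      have t3: "exp (- (4 * L)\<^sup>2 / 16) \<le> 4 / b0 * \<mu>"
      proof -
        have "exp (- (4 * L)\<^sup>2 / 16) = 1 / (real n)\<^sup>2" using exp_bw(3)[of n] n2 by (simp add: power_mult_distrib)
        also have "\<dots> \<le> 1 / sqrt n"
        proof (intro divide_left_mono)
          have "sqrt n \<le> n" using n1 by (simp add: real_le_lsqrt power2_eq_square)
          also have "\<dots> \<le> (real n)\<^sup>2" using n1 by (simp add: power2_eq_square)
          finally show "sqrt n \<le> (real n)\<^sup>2" .
        qed (use n2 in auto)
        finally show ?thesis using sn by linarith
      qed
      have "L ^ 4 * (4 * L / sqrt n + (\<Sum>k=1..n. if \<bar>\<theta> k\<bar> > 4 * L / 2 then 1 else 0) / n + exp (- (4 * L)\<^sup>2 / 16)) \<le>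
        L ^ 4 * ((20 / b0 + 1) * L * \<mu>)"
      proof (intro mult_left_mono)
        have "4 / b0 * \<mu> * 1 \<le> 4 / b0 * \<mu> * L" "\<mu> * 1 \<le> \<mu> * L" using L1 b0 \<mu> by (intro mult_left_mono; simp)+
        moreover have "(20 / b0 + 1) * L * \<mu> = 16 * L / b0 * \<mu> + 4 / b0 * \<mu> * L + \<mu> * L" using b0 by (simp add: field_simps)
        ultimately show "4 * L / sqrt n + (\<Sum>k=1..n. if \<bar>\<theta> k\<bar> > 4 * L / 2 then 1 else 0) / n + exp (- (4 * L)\<^sup>2 / 16) \<le> (20 / b0 + 1) * L * \<mu>"
          using t1 t2 t3 by linarith
      qed simp
      also have "\<dots> = (20 / b0 + 1) * (L ^ 5 * \<mu>)" by (simp add: power_numeral_reduce)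
      finally have G: "L ^ 4 * (4 * L / sqrt n + (\<Sum>k=1..n. if \<bar>\<theta> k\<bar> > 4 * L / 2 then 1 else 0) / n + exp (- (4 * L)\<^sup>2 / 16)) \<le> (20 / b0 + 1) * (L ^ 5 * \<mu>)" .
      have "n * ((144 + 48 / g) * min 1 (\<mu> powr (1 - g)) + 100 * (KK + C) * L ^ 4 *
          (4 * L / sqrt n + (\<Sum>k=1..n. if \<bar>\<theta> k\<bar> > 4 * L / 2 then 1 else 0) / n + exp (- (4 * L)\<^sup>2 / 16))) \<le>
        n * ((144 + 48 / g) * \<mu> powr (1 - g) + 100 * (KK + C) * ((20 / b0 + 1) * (L ^ 5 * \<mu>)))"
        unfolding mult.assoc[of _ "L ^ 4"] using KC g by (intro mult_left_mono add_mono G) auto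
      also have "\<dots> = (144 + 48 / g) * (n * \<mu> powr (1 - g)) + 100 * (KK + C) * (20 / b0 + 1) * (n * (L ^ 5 * \<mu>))" by algebra
      also have "\<dots> \<le> (144 + 48 / g) * (K * ?p) + 100 * (KK + C) * (20 / b0 + 1) * (K * ?p)"
        using b1 by (intro add_mono mult_left_mono nm nLK) auto
      also have "\<dots> \<le> rare_const * K / L ^ 3 + (144 + 48 / g + 100 * (KK + C) * (20 / b0 + 1)) * (K * ?p)"
        using rare_const_ge K L1 by (simp add: distrib_right)
      finally show ?thesis
        by (intro order_trans[OF geb_part_fine[OF \<mu> sparsity_le_moment g T]] ennreal_leI)
    qed
    have Kp: "K * ?p \<ge> 0" using K by simp
    have "risk_sum \<theta> \<le> ennreal (rare_const * K / L ^ 3 + (144 + 48 / g + 100 * (KK + C) * (20 / b0 + 1)) * (K * ?p)) + ennreal (8 / L ^ 3 + 18 * (K * ?p))"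
      by (rule order_trans[OF risk_sum_le add_mono[OF geb soft]])
    also have "\<dots> = ennreal ((rare_const * K / L ^ 3 + (144 + 48 / g + 100 * (KK + C) * (20 / b0 + 1)) * (K * ?p)) + (8 / L ^ 3 + 18 * (K * ?p)))"
    proof (rule ennreal_plus[symmetric])
      show "0 \<le> rare_const * K / L ^ 3 + (144 + 48 / g + 100 * (KK + C) * (20 / b0 + 1)) * (K * ?p)"
        using L1 rare_const_ge K by (intro add_nonneg_nonneg mult_nonneg_nonneg divide_nonneg_nonneg add_nonneg_nonneg[OF b1(3,4)] Kp[simplified]) auto
      show "0 \<le> 8 / L ^ 3 + 18 * (K * ?p)" using Kp L1 by simp
    qed
    also have "\<dots> \<le> ennreal (?a + ?b * K * ?p)"
    proof (intro ennreal_leI)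
      have "0 \<le> (10 * KK + 8) * (K * ?p)" using KK Kp by simp
      then show "(rare_const * K / L ^ 3 + (144 + 48 / g + 100 * (KK + C) * (20 / b0 + 1)) * (K * ?p)) + (8 / L ^ 3 + 18 * (K * ?p)) \<le> ?a + ?b * K * ?p"
        by (simp add: add_divide_distrib algebra_simps)
    qed
    finally show ?thesis .
  qed
qed

end

end

text \<open>The three bounds serve levels with \<open>n\<close> much smaller than, comparable to, and much larger than
  the effective sample size, respectively.\<close>

lemma level_bounds:
  fixes c C b0 pp g :: real
  assumes c: "0 < c" "c \<le> 1" and C: "C \<ge> 1" and b0: "b0 > 0" and pp: "0 < pp" "pp \<le> 2" and g: "0 < g" "g < 1"
  shows "\<exists>K\<ge>1. \<forall>(M :: 'w measure) Z n \<rho> \<theta>. gauss_level_geb M Z n \<rho> c C b0 \<longrightarrow>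
    gauss_level_geb.risk_sum M Z n \<rho> b0 \<theta> \<le> ennreal (K * n powr (1 + g)) \<and>
    (\<forall>\<mu>>0. (\<Sum>i=1..n. \<bar>\<theta> i\<bar> powr pp) / n \<le> \<mu> \<longrightarrow>
      gauss_level_geb.risk_sum M Z n \<rho> b0 \<theta> \<le> ennreal (K * (n * min 1 (\<mu> powr (1 - g)) + n powr (1 - pp / 16) * (1 + \<mu>))) \<and>
      gauss_level_geb.risk_sum M Z n \<rho> b0 \<theta> \<le> ennreal (K * (1 / bw n ^ 3 + n powr (1 + g) * \<mu> powr (1 - g))))"
proof -
  obtain Ka where Ka: "Ka \<ge> 1" "\<And>n. n \<ge> 2 \<Longrightarrow> bw n ^ 2 \<le> Ka * real n powr g" using bw_power_le[OF g(1), of 2] by blast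
  obtain Kb where Kb: "Kb \<ge> 1" "\<And>n. n \<ge> 2 \<Longrightarrow> bw n ^ 4 \<le> Kb * real n powr (pp / 16)" using bw_power_le[of "pp/16" 4] pp by auto
  obtain Kc where Kc: "Kc \<ge> 1" "\<And>n. n \<ge> 2 \<Longrightarrow> bw n ^ 5 \<le> Kc * real n powr g" using bw_power_le[OF g(1), of 5] by blast
  obtain Kd where Kd: "Kd \<ge> 1" "\<And>n. n \<ge> 2 \<Longrightarrow> bw n ^ 3 \<le> Kd * real n powr 1" using bw_power_le[of 1 3] by auto
  define K5 where "K5 = max Kc Kd"
  define k where "k = gauss_level_rho.KK c"
  define r where "r = gauss_level_geb.rare_const c b0"
  define A1 where "A1 = (10 * \<bar>k\<bar> + 26) * Ka"
  define A2 where "A2 = (1700 * (\<bar>k\<bar> + C) + 8 + 90 * b0 + \<bar>r\<bar>) * Kb"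
  define A3 where "A3 = 8 + \<bar>r\<bar> * K5"
  define A4 where "A4 = (10 * \<bar>k\<bar> + 26 + 144 + 48 / g + 100 * (\<bar>k\<bar> + C) * (20 / b0 + 1)) * K5"
  define K where "K = 1 + A1 + A2 + A3 + A4 + (144 + 48 / g)"
  have K5: "K5 \<ge> 1" using Kc by (simp add: K5_def)
  have A: "A1 \<ge> 0" "A2 \<ge> 0" "A3 \<ge> 0" "A4 \<ge> 0" "144 + 48 / g \<ge> 0"
    using Ka Kb K5 C b0 g unfolding A1_def A2_def A3_def A4_def by (auto intro!: mult_nonneg_nonneg add_nonneg_nonneg)
  have K: "K \<ge> 1" "A1 \<le> K" "A2 \<le> K" "A3 \<le> K" "A4 \<le> K" "144 + 48 / g \<le> K" using A unfolding K_def by linarith+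
  show ?thesis
  proof (rule exI[of _ K], rule conjI[OF K(1)], intro allI impI conjI)
    fix M :: "'w measure" and Z n \<rho> \<theta>
    assume "gauss_level_geb M Z n \<rho> c C b0"
    then interpret gauss_level_geb M Z n \<rho> c C b0 .
    have kr: "KK = k" "rare_const = r" by (auto simp: k_def r_def)
    have kr0: "\<bar>k\<bar> = k" "\<bar>r\<bar> = r"
      using KK_pos rare_const_ge unfolding kr by auto
    have n1: "1 \<le> real n" using n2 by simp
    have "n * ((10 * KK + 26) * L\<^sup>2) \<le> n * ((10 * KK + 26) * (Ka * n powr g))"
      using Ka(2)[OF n2] kr0 unfolding kr by (intro mult_left_mono) auto
    also have "\<dots> = A1 * n powr (1 + g)"
      using n1 powr_add[of "real n" 1 g] unfolding A1_def kr kr0 by simp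
    also have "\<dots> \<le> K * n powr (1 + g)" using K by (intro mult_right_mono) auto
    finally show "risk_sum \<theta> \<le> ennreal (K * n powr (1 + g))"
      by (intro order_trans[OF risk_sum_crude] ennreal_leI)
    fix \<mu> :: real assume \<mu>: "\<mu> > 0" "(\<Sum>i=1..n. \<bar>\<theta> i\<bar> powr pp) / n \<le> \<mu>"
    have "(144 + 48 / g) * n * min 1 (\<mu> powr (1 - g)) + (1700 * (KK + C) + 8 + 90 * b0 + rare_const) * Kb * n powr (1 - pp / 16) * (1 + \<mu>)
      = (144 + 48 / g) * (n * min 1 (\<mu> powr (1 - g))) + A2 * (n powr (1 - pp / 16) * (1 + \<mu>))"
      unfolding A2_def kr kr0 by (simp add: mult.assoc)
    also have "\<dots> \<le> K * (n * min 1 (\<mu> powr (1 - g))) + K * (n powr (1 - pp / 16) * (1 + \<mu>))"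
      using K \<mu> by (intro add_mono mult_right_mono) auto
    finally show "risk_sum \<theta> \<le> ennreal (K * (n * min 1 (\<mu> powr (1 - g)) + n powr (1 - pp / 16) * (1 + \<mu>)))"
      using risk_sum_middle[OF \<mu> pp g Kb(2)[OF n2] Kb(1)] by (elim order_trans) (simp add: distrib_left ennreal_leI)
    have "Kc * n powr g \<le> K5 * n powr g" "Kd * n \<le> K5 * n" unfolding K5_def by (intro mult_right_mono; simp)+
    then have K5a: "L ^ 5 \<le> K5 * n powr g" "L ^ 3 \<le> K5 * n"
      using order_trans[OF Kc(2)[OF n2]] order_trans[OF Kd(2)[OF n2]] n1 by auto
    have "(8 + rare_const * K5) / L ^ 3 + (10 * KK + 26 + 144 + 48 / g + 100 * (KK + C) * (20 / b0 + 1)) * K5 * (n powr (1 + g) * \<mu> powr (1 - g))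
      = A3 * (1 / L ^ 3) + A4 * (n powr (1 + g) * \<mu> powr (1 - g))"
      unfolding A3_def A4_def kr kr0 by simp
    also have "\<dots> \<le> K * (1 / L ^ 3) + K * (n powr (1 + g) * \<mu> powr (1 - g))"
      using K L1 by (intro add_mono mult_right_mono) auto
    finally show "risk_sum \<theta> \<le> ennreal (K * (1 / L ^ 3 + n powr (1 + g) * \<mu> powr (1 - g)))"
      using risk_sum_far[OF \<mu> pp g K5a K5] by (elim order_trans) (simp add: distrib_left ennreal_leI)
  qed
qed

section \<open>Besov balls and compact sets\<close>

definition block_norm :: "real \<Rightarrow> ereal \<Rightarrow> nat \<Rightarrow> coefs \<Rightarrow> real" where
  "block_norm \<alpha> p j \<beta> = 2 powr (real j * (\<alpha> + 1/2 - real_of_ereal (1 / p))) * lp_block p (2 ^ j) (\<beta> (int j))"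

lemma lp_block_nonneg: "n \<ge> 1 \<Longrightarrow> lp_block p n u \<ge> 0"
proof -
  assume n: "n \<ge> 1"
  have "0 \<le> \<bar>u 1\<bar>" by simp
  also have "\<bar>u 1\<bar> \<le> Max ((\<lambda>k. \<bar>u k\<bar>) ` {1..n})" using n by (intro Max_ge) auto
  finally show ?thesis unfolding lp_block_def by auto
qed

lemma block_norm_nonneg: "block_norm \<alpha> p j \<beta> \<ge> 0"
  unfolding block_norm_def by (intro mult_nonneg_nonneg lp_block_nonneg) auto

lemma besov_norm_finite_iff: "besov_norm \<alpha> p q \<beta> < \<infinity> \<longleftrightarrow> besov_sum \<alpha> p q \<beta> < \<infinity>"
  unfolding besov_norm_def by (auto simp: less_top)

lemma block_norm_le_besov:
  assumes "q > 0" and fin: "besov_norm \<alpha> p q \<beta> < \<infinity>"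
  shows "ennreal (block_norm \<alpha> p j \<beta>) \<le> besov_norm \<alpha> p q \<beta>"
proof -
  let ?S = "besov_sum \<alpha> p q \<beta>"
  have S: "?S < \<infinity>" using fin unfolding besov_norm_finite_iff .
  have "ennreal (block_norm \<alpha> p j \<beta> powr q) \<le> (\<Sum>j. ennreal (block_norm \<alpha> p j \<beta> powr q))"
  proof -
    define h where "h i = ennreal (block_norm \<alpha> p i \<beta> powr q)" for i
    have "sum h {j} \<le> suminf h" by (rule sum_le_suminf) (auto intro: summableI)
    then show ?thesis by (simp add: h_def[abs_def])
  qed
  also have "\<dots> \<le> ?S" unfolding besov_sum_def block_norm_def by (rule add_increasing) auto
  also have "?S = ennreal (enn2real ?S)" using S by simp
  finally have "block_norm \<alpha> p j \<beta> powr q \<le> enn2real ?S" by (simp add: ennreal_le_iff)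
  then have "(block_norm \<alpha> p j \<beta> powr q) powr (1 / q) \<le> enn2real ?S powr (1 / q)"
    using assms(1) by (intro powr_mono2) auto
  then have "block_norm \<alpha> p j \<beta> \<le> enn2real ?S powr (1 / q)"
    using assms(1) block_norm_nonneg by (simp add: powr_powr)
  then show ?thesis using S unfolding besov_norm_def by (auto intro: ennreal_leI)
qed

text \<open>The \<open>q\<close>-th powers are the terms of a convergent series. This is where the
  finiteness of \<open>q\<close> enters.\<close>

lemma block_norm_tendsto_0:
  assumes q: "q > 0" and fin: "besov_norm \<alpha> p q \<beta> < \<infinity>"
  shows "(\<lambda>j. block_norm \<alpha> p j \<beta>) \<longlonglongrightarrow> 0"
proof -
  have "(\<Sum>j. ennreal (block_norm \<alpha> p j \<beta> powr q)) \<le> besov_sum \<alpha> p q \<beta>"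
    unfolding besov_sum_def block_norm_def by (rule add_increasing) auto
  also have "\<dots> < \<infinity>" using fin unfolding besov_norm_finite_iff .
  finally have "summable (\<lambda>j. block_norm \<alpha> p j \<beta> powr q)"
    by (intro summable_suminf_not_top) auto
  then have "(\<lambda>j. block_norm \<alpha> p j \<beta> powr q) \<longlonglongrightarrow> 0" by (rule summable_LIMSEQ_zero)
  then have "(\<lambda>j. (block_norm \<alpha> p j \<beta> powr q) powr (1 / q)) \<longlonglongrightarrow> 0 powr (1 / q)"
    using q by (intro tendsto_powr') auto
  then show ?thesis using q block_norm_nonneg by (simp add: powr_powr)
qed

text \<open>Either \<open>\<bar>y\<bar> \<le> s * \<bar>x\<bar>\<close>, and the first term alone
  suffices, or \<open>\<bar>x\<bar>\<close> is less than \<open>\<bar>y\<bar> / s\<close>, and the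
  second does. No convexity is involved, so all \<open>r > 0\<close> are covered.\<close>

lemma abs_add_powr_le:
  fixes x y r s :: real
  assumes "r > 0" "s > 0"
  shows "\<bar>x + y\<bar> powr r \<le> ((1 + s) * \<bar>x\<bar>) powr r + ((1 + 1 / s) * \<bar>y\<bar>) powr r"
proof (cases "\<bar>y\<bar> \<le> s * \<bar>x\<bar>")
  case True
  then have "\<bar>x + y\<bar> \<le> (1 + s) * \<bar>x\<bar>" by (simp add: distrib_right)
  then have "\<bar>x + y\<bar> powr r \<le> ((1 + s) * \<bar>x\<bar>) powr r" using assms by (intro powr_mono2) auto
  then show ?thesis by (smt (verit) powr_ge_zero)
next
  case False
  then have "\<bar>x\<bar> \<le> 1 / s * \<bar>y\<bar>" using assms by (simp add: field_simps)
  then have "\<bar>x + y\<bar> \<le> (1 + 1 / s) * \<bar>y\<bar>" by (simp add: distrib_right)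
  then have "\<bar>x + y\<bar> powr r \<le> ((1 + 1 / s) * \<bar>y\<bar>) powr r" using assms by (intro powr_mono2) auto
  then show ?thesis by (smt (verit) powr_ge_zero)
qed

text \<open>The exponent at which block norms are compared: the \<open>p\<close>-th power turns
  \<open>lp_block\<close> into a plain sum, while for \<open>p = \<infinity>\<close> the maximum
  obeys the triangle inequality as it stands.\<close>

definition pow_index :: "ereal \<Rightarrow> real" where
  "pow_index p = (if p = \<infinity> then 1 else real_of_ereal p)"

lemma pow_index_pos: "p > 0 \<Longrightarrow> pow_index p > 0"
  unfolding pow_index_def by (cases p) auto

text \<open>Replaces the triangle inequality, which fails for \<open>p < 1\<close>: the factor of the first summand can be
  taken arbitrarily close to \<open>1\<close>.\<close>

lemma lp_block_add_powr_le:
  assumes n: "n \<ge> 1" and p: "p > 0" and s: "s > 0"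
  shows "lp_block p n (\<lambda>k. u k + v k) powr pow_index p \<le>
    ((1 + s) * lp_block p n u) powr pow_index p + ((1 + 1 / s) * lp_block p n v) powr pow_index p"
proof (cases "p = \<infinity>")
  case True
  let ?M = "\<lambda>u :: nat \<Rightarrow> real. Max ((\<lambda>k. \<bar>u k\<bar>) ` {1..n})"
  have M: "\<bar>u k\<bar> \<le> ?M u" if "k \<in> {1..n}" for u k using that by (intro Max_ge) auto
  have M0: "?M u \<ge> 0" for u using lp_block_nonneg[OF n, of p u] True by (simp add: lp_block_def)
  have "?M (\<lambda>k. u k + v k) \<le> (1 + s) * ?M u + (1 + 1 / s) * ?M v"
  proof (rule Max.boundedI)
    fix a assume "a \<in> (\<lambda>k. \<bar>u k + v k\<bar>) ` {1..n}"
    then obtain k where k: "k \<in> {1..n}" "a = \<bar>u k + v k\<bar>" by auto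
    have "a \<le> ?M u + ?M v" using M[OF k(1), of u] M[OF k(1), of v] k(2) by linarith
    moreover have "0 \<le> s * ?M u" "0 \<le> 1 / s * ?M v" using s M0 by auto
    ultimately show "a \<le> (1 + s) * ?M u + (1 + 1 / s) * ?M v" by (simp add: distrib_right)
  qed (use n in auto)
  moreover have "0 \<le> (1 + s) * ?M u" "0 \<le> (1 + 1 / s) * ?M v" using s M0 by (auto intro!: mult_nonneg_nonneg)
  ultimately show ?thesis using True M0 by (simp add: lp_block_def pow_index_def)
next
  case False
  then obtain r where r: "p = ereal r" "r > 0" using p by (cases p) auto
  have e: "(a * lp_block p n u) powr r = (\<Sum>k=1..n. (a * \<bar>u k\<bar>) powr r)" if "a > 0" for a u
  proof -
    have "lp_block p n u powr r = (\<Sum>k=1..n. \<bar>u k\<bar> powr r)"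
      using r by (simp add: lp_block_def powr_powr sum_nonneg)
    then show ?thesis using that lp_block_nonneg[OF n, of p u] by (simp add: powr_mult sum_distrib_left)
  qed
  have "lp_block p n (\<lambda>k. u k + v k) powr r = (\<Sum>k=1..n. \<bar>u k + v k\<bar> powr r)"
    using e[of 1 "\<lambda>k. u k + v k"] by simp
  also have "\<dots> \<le> (\<Sum>k=1..n. ((1 + s) * \<bar>u k\<bar>) powr r + ((1 + 1 / s) * \<bar>v k\<bar>) powr r)"
    using r s by (intro sum_mono abs_add_powr_le) auto
  also have "\<dots> = ((1 + s) * lp_block p n u) powr r + ((1 + 1 / s) * lp_block p n v) powr r"
    using s by (simp add: e sum.distrib add_pos_pos)
  finally show ?thesis using False r by (simp add: pow_index_def)
qed

lemma block_norm_perturb: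
  assumes p: "p > 0" and s: "s > 0"
  shows "block_norm \<alpha> p j \<beta>' powr pow_index p \<le>
    ((1 + s) * block_norm \<alpha> p j \<beta>) powr pow_index p + ((1 + 1 / s) * block_norm \<alpha> p j (\<lambda>j k. \<beta>' j k - \<beta> j k)) powr pow_index p"
proof -
  let ?w = "2 powr (real j * (\<alpha> + 1/2 - real_of_ereal (1 / p)))" and ?P = "pow_index p"
  have n: "(2::nat) ^ j \<ge> 1" by simp
  let ?a = "lp_block p (2 ^ j) (\<beta> (int j))" and ?b = "lp_block p (2 ^ j) (\<lambda>k. \<beta>' (int j) k - \<beta> (int j) k)"
  have nn: "?a \<ge> 0" "?b \<ge> 0" "lp_block p (2 ^ j) (\<beta>' (int j)) \<ge> 0" by (intro lp_block_nonneg n)+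
  have "lp_block p (2 ^ j) (\<beta>' (int j)) powr ?P \<le> ((1 + s) * ?a) powr ?P + ((1 + 1 / s) * ?b) powr ?P"
    using lp_block_add_powr_le[OF n p s, of "\<beta> (int j)" "\<lambda>k. \<beta>' (int j) k - \<beta> (int j) k"] by simp
  then have "?w powr ?P * lp_block p (2 ^ j) (\<beta>' (int j)) powr ?P \<le> ?w powr ?P * (((1 + s) * ?a) powr ?P + ((1 + 1 / s) * ?b) powr ?P)"
    by (intro mult_left_mono) auto
  moreover have "(1 + s) * block_norm \<alpha> p j \<beta> = ?w * ((1 + s) * ?a)"
    "(1 + 1 / s) * block_norm \<alpha> p j (\<lambda>j k. \<beta>' j k - \<beta> j k) = ?w * ((1 + 1 / s) * ?b)"
    by (simp_all add: block_norm_def)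
  ultimately show ?thesis using nn s by (simp add: block_norm_def powr_mult distrib_left mult_ac)
qed

text \<open>The bound \<open>d' < d\<close>, uniform in \<open>j\<close>, provides the margin that
  the openness proof spends on perturbations.\<close>

definition tail_small :: "real \<Rightarrow> ereal \<Rightarrow> real \<Rightarrow> real \<Rightarrow> nat \<Rightarrow> coefs set" where
  "tail_small \<alpha> p q d m = {\<beta> \<in> besov_space \<alpha> p q. \<exists>d'<d. \<forall>j\<ge>m. block_norm \<alpha> p j \<beta> \<le> d'}"

text \<open>A perturbation that is small in the quasi-norm is small in every block norm. Between the
  bound \<open>d0\<close> of the centre and \<open>d\<close> two levels are inserted,
  \<open>d0 < d2 < d1 < d\<close>. The parameter \<open>s\<close> is so small that the factor
  \<open>1 + s\<close> takes \<open>d0\<close> at most to \<open>d2\<close>, and the radius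
  \<open>e\<close> so small that a perturbation enlarged by \<open>1 + 1 / s\<close> fills at most
  the gap between the powers of \<open>d2\<close> and \<open>d1\<close>.\<close>

lemma besov_open_tail_small:
  assumes p: "p > 0" and q: "q > 0"
  shows "besov_open \<alpha> p q (tail_small \<alpha> p q d m)"
  unfolding besov_open_def
proof (intro conjI ballI)
  show "tail_small \<alpha> p q d m \<subseteq> besov_space \<alpha> p q" by (auto simp: tail_small_def)
  fix \<beta> assume \<beta>: "\<beta> \<in> tail_small \<alpha> p q d m"
  then obtain d0 where d0: "d0 < d" "\<And>j. j \<ge> m \<Longrightarrow> block_norm \<alpha> p j \<beta> \<le> d0" by (auto simp: tail_small_def)
  let ?P = "pow_index p"
  have P: "?P > 0" by (rule pow_index_pos[OF p])
  have d00: "d0 \<ge> 0" using d0(2)[of m] block_norm_nonneg[of \<alpha> p m \<beta>] by simp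
  define d1 where "d1 = (d0 + d) / 2"
  have d1: "d0 < d1" "d1 < d" "d1 > 0" using d0 d00 by (auto simp: d1_def)
  define d2 where "d2 = (d0 + d1) / 2"
  have d2: "d0 < d2" "d2 < d1" "d2 > 0" using d1 d00 by (auto simp: d2_def)
  define s where "s = (d2 - d0) / (d0 + 1)"
  have s: "s > 0" using d2 d00 by (auto simp: s_def)
  have sd: "(1 + s) * d0 \<le> d2"
  proof -
    have "s * d0 \<le> s * (d0 + 1)" using s by (intro mult_left_mono) auto
    also have "\<dots> = d2 - d0" using d00 by (simp add: s_def)
    finally show ?thesis by (simp add: distrib_right)
  qed
  define e where "e = (d1 powr ?P - d2 powr ?P) powr (1 / ?P) / (1 + 1 / s)"
  have "d2 powr ?P < d1 powr ?P" using d2 P by (intro powr_less_mono2) auto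
  then have e0: "d1 powr ?P - d2 powr ?P > 0" by simp
  have s1: "1 + 1 / s > 0" using s by (simp add: add_pos_pos)
  have e: "e > 0" unfolding e_def using e0 s1 by simp
  have ee: "((1 + 1 / s) * e) powr ?P = d1 powr ?P - d2 powr ?P"
    using e0 s1 P by (simp add: e_def powr_powr)
  show "\<exists>r>0. \<forall>\<beta>'\<in>besov_space \<alpha> p q. besov_norm \<alpha> p q (\<lambda>j k. \<beta>' j k - \<beta> j k) < r \<longrightarrow> \<beta>' \<in> tail_small \<alpha> p q d m"
  proof (intro exI[of _ "ennreal e"] conjI ballI impI)
    show "0 < ennreal e" using e by simp
    fix \<beta>' assume \<beta>': "\<beta>' \<in> besov_space \<alpha> p q" and r: "besov_norm \<alpha> p q (\<lambda>j k. \<beta>' j k - \<beta> j k) < ennreal e"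
    have fin: "besov_norm \<alpha> p q (\<lambda>j k. \<beta>' j k - \<beta> j k) < \<infinity>" using r by (rule order_less_trans) simp
    have "block_norm \<alpha> p j \<beta>' \<le> d1" if j: "j \<ge> m" for j
    proof -
      let ?b = "block_norm \<alpha> p j (\<lambda>j k. \<beta>' j k - \<beta> j k)"
      have "ennreal ?b < ennreal e" using block_norm_le_besov[OF q fin] r by (rule order_le_less_trans)
      then have b: "?b \<le> e" using e by (simp add: ennreal_less_iff block_norm_nonneg)
      have "block_norm \<alpha> p j \<beta>' powr ?P \<le> ((1 + s) * block_norm \<alpha> p j \<beta>) powr ?P + ((1 + 1 / s) * ?b) powr ?P"
        by (rule block_norm_perturb[OF p s])
      also have "((1 + s) * block_norm \<alpha> p j \<beta>) powr ?P \<le> ((1 + s) * d0) powr ?P"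
        using d0(2)[OF j] s P block_norm_nonneg by (intro powr_mono2 mult_left_mono mult_nonneg_nonneg) auto
      also have "((1 + s) * d0) powr ?P \<le> d2 powr ?P"
        using sd s P d00 by (intro powr_mono2) auto
      also have "((1 + 1 / s) * ?b) powr ?P \<le> ((1 + 1 / s) * e) powr ?P"
        using b s1 P block_norm_nonneg by (intro powr_mono2 mult_left_mono mult_nonneg_nonneg) auto
      finally have "block_norm \<alpha> p j \<beta>' powr ?P \<le> d1 powr ?P" unfolding ee by simp
      then show ?thesis using P d1 block_norm_nonneg[of \<alpha> p j \<beta>'] powr_less_mono2[of ?P d1 "block_norm \<alpha> p j \<beta>'"] by fastforce
    qed
    then show "\<beta>' \<in> tail_small \<alpha> p q d m" using \<beta>' d1 by (auto simp: tail_small_def)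
  qed
qed

text \<open>The sets \<open>tail_small \<alpha> p q d m\<close> are open, and they cover
  \<open>B\<close> because the block norms of each element tend to \<open>0\<close>. The largest
  \<open>m\<close> in a finite subcover works for all of \<open>B\<close>.\<close>

lemma compact_tail_small:
  assumes p: "p > 0" and q: "q > 0" and B: "compactin (besov_topology \<alpha> p q) B" and d: "d > 0"
  shows "\<exists>m. \<forall>\<beta>\<in>B. \<forall>j\<ge>m. block_norm \<alpha> p j \<beta> \<le> d"
proof -
  have sub: "B \<subseteq> besov_space \<alpha> p q"
    using compactin_subset_topspace[OF B] by (simp add: topspace_besov_topology)
  let ?U = "range (tail_small \<alpha> p q d)"
  have "B \<subseteq> \<Union>?U"
  proof
    fix \<beta> assume "\<beta> \<in> B"
    then have \<beta>: "\<beta> \<in> besov_space \<alpha> p q" using sub by auto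
    then have "(\<lambda>j. block_norm \<alpha> p j \<beta>) \<longlonglongrightarrow> 0" using q by (intro block_norm_tendsto_0) (auto simp: besov_space_def)
    then have "\<forall>\<^sub>F j in sequentially. block_norm \<alpha> p j \<beta> < d / 2" using d by (intro order_tendstoD) auto
    then obtain m where "\<And>j. j \<ge> m \<Longrightarrow> block_norm \<alpha> p j \<beta> < d / 2" by (auto simp: eventually_sequentially)
    then have "\<beta> \<in> tail_small \<alpha> p q d m" using \<beta> d unfolding tail_small_def by (auto intro!: exI[of _ "d/2"] less_imp_le)
    then show "\<beta> \<in> \<Union>?U" by auto
  qed
  moreover have "\<forall>U\<in>?U. openin (besov_topology \<alpha> p q) U"
    using besov_open_tail_small[OF p q] by (auto simp: openin_besov_topology)
  ultimately obtain \<F> where \<F>: "finite \<F>" "\<F> \<subseteq> ?U" "B \<subseteq> \<Union>\<F>"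
    using B unfolding compactin_def by meson
  obtain S where S: "finite S" "\<F> = tail_small \<alpha> p q d ` S" using finite_subset_image[OF \<F>(1,2)] by auto
  show ?thesis
  \<comment> \<open>Inserting \<open>0\<close> keeps the maximum meaningful when the subcover is
    empty.\<close>
  proof (intro exI[of _ "Max (insert 0 S)"] ballI allI impI)
    fix \<beta> j assume "\<beta> \<in> B" and j: "Max (insert 0 S) \<le> j"
    then obtain m where m: "m \<in> S" "\<beta> \<in> tail_small \<alpha> p q d m" using \<F>(3) S by auto
    have "m \<le> j" using j m S by (meson Max_ge finite_insert insertI2 le_trans)
    then show "block_norm \<alpha> p j \<beta> \<le> d" using m by (force simp: tail_small_def)
  qed
qed

text \<open>For \<open>p > 2\<close> this is the comparison of power means, up to the factor \<open>2\<close>.\<close>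

lemma moment_le_lp_block:
  assumes n: "n \<ge> 1" and p: "p > 0"
  defines "r \<equiv> (if p \<le> 2 then real_of_ereal p else 2)"
  shows "(\<Sum>k=1..n. \<bar>u k\<bar> powr r) / n \<le> 2 * (n powr (- real_of_ereal (1 / p)) * lp_block p n u) powr r"
proof (cases p)
  case PInf
  let ?M = "Max ((\<lambda>k. \<bar>u k\<bar>) ` {1..n})"
  have lp: "lp_block p n u = ?M" "r = 2" using PInf by (auto simp: lp_block_def r_def)
  have "(\<Sum>k=1..n. \<bar>u k\<bar> powr r) \<le> real (card {1..n}) * (?M powr r)"
    unfolding lp(2) by (intro sum_bounded_above powr_mono2 Max_ge) auto
  then have "(\<Sum>k=1..n. \<bar>u k\<bar> powr r) / n \<le> ?M powr r" using n by (simp add: field_simps)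
  also have "\<dots> \<le> 2 * ?M powr r" by simp
  finally show ?thesis using PInf n unfolding lp(1) by simp
next
  case (real t)
  then have t: "t > 0" using p by simp
  have inv: "real_of_ereal (1 / p) = 1 / t" using real t by (simp add: divide_ereal_def inverse_eq_divide)
  define S where "S = (\<Sum>k=1..n. \<bar>u k\<bar> powr t)"
  have S0: "S \<ge> 0" unfolding S_def by (intro sum_nonneg) auto
  have lp: "lp_block p n u = S powr (1 / t)" using real by (simp add: lp_block_def S_def)
  define c where "c = n powr (- (1 / t)) * S powr (1 / t)"
  have c: "c = (S / n) powr (1 / t)" unfolding c_def using S0 n by (simp add: powr_divide powr_minus_divide)
  have ct: "c powr t = S / n" unfolding c using S0 n t by (simp add: powr_powr)
  show ?thesis
  proof (cases "p \<le> 2")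
    case True
    then have "r = t" using real by (simp add: r_def)
    moreover have "1 * (S / n) \<le> 2 * (S / n)" using S0 by (intro mult_right_mono) auto
    ultimately show ?thesis unfolding inv lp c_def[symmetric] using ct by (simp only: S_def mult_1)
  next
    case False
    then have r: "r = 2" "t > 2" using real by (auto simp: r_def)
    show ?thesis
    proof (cases "c = 0")
      case True
      then have "S / n = 0" using ct t by simp
      then have "S = 0" using n by simp
      then have "\<bar>u k\<bar> powr t = 0" if "k \<in> {1..n}" for k
        using that unfolding S_def by (subst (asm) sum_nonneg_eq_0_iff) auto
      then have "(\<Sum>k=1..n. \<bar>u k\<bar> powr r) = 0" by (intro sum.neutral) auto
      then show ?thesis by simp
    next
      case False
      then have c0: "c > 0" using S0 by (simp add: c)
      \<comment> \<open>\<open>c\<close> is the power mean of order \<open>t\<close>. Entries up to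
        \<open>c\<close> are bounded by \<open>c\<close>; for larger ones the exponent
        \<open>2\<close> is raised to \<open>t\<close> at the price \<open>c powr (2 - t)\<close>.
        Each term sums to \<open>n * c powr 2\<close>, whence the factor \<open>2\<close>.\<close>
      have "\<bar>u k\<bar> powr 2 \<le> c powr 2 + \<bar>u k\<bar> powr t * c powr (2 - t)" for k
      proof (cases "\<bar>u k\<bar> \<le> c")
        case True
        then have "\<bar>u k\<bar> powr 2 \<le> c powr 2" by (intro powr_mono2) auto
        then show ?thesis by (smt (verit) mult_nonneg_nonneg powr_ge_zero)
      next
        case False
        then have "\<bar>u k\<bar> powr (2 - t) \<le> c powr (2 - t)" using c0 r by (intro powr_mono2') auto
        then have "\<bar>u k\<bar> powr t * \<bar>u k\<bar> powr (2 - t) \<le> \<bar>u k\<bar> powr t * c powr (2 - t)" by (intro mult_left_mono) auto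
        moreover have "\<bar>u k\<bar> powr t * \<bar>u k\<bar> powr (2 - t) = \<bar>u k\<bar> powr 2" by (simp add: powr_add[symmetric])
        ultimately show ?thesis by (smt (verit) powr_ge_zero)
      qed
      then have "(\<Sum>k=1..n. \<bar>u k\<bar> powr 2) \<le> (\<Sum>k=1..n. c powr 2 + \<bar>u k\<bar> powr t * c powr (2 - t))"
        by (intro sum_mono)
      also have "\<dots> = n * c powr 2 + S * c powr (2 - t)" by (simp add: sum.distrib S_def sum_distrib_right)
      also have "S = n * c powr t" using ct n by simp
      also have "n * c powr 2 + n * c powr t * c powr (2 - t) = n * (2 * c powr 2)"
        by (simp add: powr_add[symmetric] mult.assoc)
      finally have "(\<Sum>k=1..n. \<bar>u k\<bar> powr 2) / n \<le> 2 * c powr 2" using n by (simp add: field_simps)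
      then show ?thesis unfolding inv lp c_def[symmetric] r .
    qed
  qed
qed (use p in auto)

section \<open>Summation over the levels\<close>

text \<open>\<open>GREATEST\<close> is meaningful only once a maximum is known to exist; the
  condition on \<open>j\<close> is equivalent to \<open>j \<le> log 2 n\<^sub>s\<close>, whose
  largest integer solution is the floor.\<close>

lemma j_star_eq: assumes "n\<^sub>s > 0" shows "j_star n\<^sub>s = \<lfloor>log 2 n\<^sub>s\<rfloor>"
proof -
  have "2 powi j \<le> n\<^sub>s \<longleftrightarrow> j \<le> \<lfloor>log 2 n\<^sub>s\<rfloor>" for j :: int
  proof -
    have "2 powi j = 2 powr (real_of_int j)" by (simp add: powr_real_of_int')
    then have "2 powi j \<le> n\<^sub>s \<longleftrightarrow> real_of_int j \<le> log 2 n\<^sub>s" using assms by (simp add: le_log_iff)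
    then show ?thesis by (simp add: le_floor_iff)
  qed
  then show ?thesis unfolding j_star_def by (intro Greatest_equality) auto
qed

text \<open>Guarantees that each level treated by the empirical Bayes rule has at least two
  coefficients, so that \<open>ln n > 0\<close> there.\<close>

lemma j_star_ge_1: assumes "n\<^sub>s > 2" shows "j_star n\<^sub>s \<ge> 1"
proof -
  have "1 \<le> log 2 n\<^sub>s" using assms by (simp add: le_log_iff)
  then show ?thesis using assms by (simp add: j_star_eq le_floor_iff)
qed

text \<open>From some index on the sequence stays between \<open>l / 2\<close> and
  \<open>2 * l\<close>; the finitely many earlier indices in \<open>S\<close> enter a minimum and a
  maximum. It is meant for \<open>(1 + \<eta> n) * \<rho>\<^sub>0\<close>, whose positivity is known
  on the level sizes in use.\<close>

lemma tendsto_pos_bounds: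
  fixes a :: "nat \<Rightarrow> real"
  assumes a: "a \<longlonglongrightarrow> l" "l > 0" and pos: "\<And>n. n \<in> S \<Longrightarrow> a n > 0"
  shows "\<exists>c C. 0 < c \<and> c \<le> 1 \<and> 1 \<le> C \<and> (\<forall>n\<in>S. c \<le> a n \<and> a n \<le> C)"
proof -
  have "\<forall>\<^sub>F n in sequentially. l / 2 < a n" "\<forall>\<^sub>F n in sequentially. a n < 2 * l"
    using order_tendstoD(1)[OF a(1), of "l / 2"] order_tendstoD(2)[OF a(1), of "2 * l"] a(2) by auto
  then have "\<forall>\<^sub>F n in sequentially. l / 2 < a n \<and> a n < 2 * l" by (rule eventually_conj)
  then obtain m where m: "\<And>n. n \<ge> m \<Longrightarrow> l / 2 < a n \<and> a n < 2 * l" by (auto simp: eventually_sequentially)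
  let ?A = "a ` {n \<in> S. n < m}"
  define c where "c = Min (insert 1 (insert (l / 2) ?A))"
  define C where "C = Max (insert 1 (insert (2 * l) ?A))"
  have fin: "finite (insert 1 (insert (l / 2) ?A))" "finite (insert 1 (insert (2 * l) ?A))" by auto
  have "c > 0" unfolding c_def using a(2) pos fin by (subst Min_gr_iff) auto
  moreover have "c \<le> 1" "c \<le> l / 2" unfolding c_def by (rule Min_le[OF fin(1)], simp)+
  moreover have "1 \<le> C" "2 * l \<le> C" unfolding C_def by (rule Max_ge[OF fin(2)], simp)+
  moreover have "c \<le> a n \<and> a n \<le> C" if "n \<in> S" for n
  proof (cases "n < m")
    case True
    then have "a n \<in> ?A" using that by auto
    then show ?thesis unfolding c_def C_def by (intro conjI Min_le[OF fin(1)] Max_ge[OF fin(2)]) auto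
  next
    case False
    then show ?thesis using m[of n] calculation by simp
  qed
  ultimately show ?thesis by blast
qed

text \<open>Decay profile in the ratio \<open>x\<close> of level size to effective sample size,
  geometric in the level number on both sides of \<open>x = 1\<close>.\<close>

definition peak :: "real \<Rightarrow> real \<Rightarrow> real" where
  "peak e x = min (x powr e) (x powr (- e))"

lemma peak_nonneg: "peak e x \<ge> 0" by (simp add: peak_def)

text \<open>With \<open>j0\<close> the floor of \<open>log 2 N\<close>, the terms on either side of
  \<open>j0\<close> are dominated by a geometric series of ratio \<open>2 powr (- e)\<close>,
  independently of \<open>N\<close>.\<close>

lemma sum_peak_bounded:
  assumes e: "e > 0"
  shows "\<exists>C. \<forall>N\<ge>1. summable (\<lambda>j. peak e (2 ^ j / N)) \<and> (\<Sum>j. peak e (2 ^ j / N)) \<le> C"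
proof -
  define r :: real where "r = 2 powr (- e)"
  have r: "0 < r" "r < 1" using e by (auto simp: r_def powr_less_one)
  have main: "summable (\<lambda>j. peak e (2 ^ j / N)) \<and> (\<Sum>j. peak e (2 ^ j / N)) \<le> 2 powr e * (2 / (1 - r))" if N: "N \<ge> 1" for N
  proof -
    define j0 where "j0 = nat \<lfloor>log 2 N\<rfloor>"
    have l0: "0 \<le> log 2 N" using N by simp
    then have "real j0 = real_of_int \<lfloor>log 2 N\<rfloor>" by (simp add: j0_def)
    then have j0: "real j0 \<le> log 2 N" "log 2 N < real j0 + 1" by linarith+
    have N1: "2 ^ j0 \<le> N" using j0(1) N by (simp add: le_log_iff powr_realpow)
    have N2: "N < 2 ^ (j0 + 1)"
    proof -
      have "N = 2 powr (log 2 N)" using N by simp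
      also have "\<dots> < 2 powr (real (j0 + 1))" using j0(2) by (intro powr_less_mono) auto
      also have "\<dots> = 2 ^ (j0 + 1)" by (rule powr_realpow) simp
      finally show ?thesis .
    qed
    have up: "peak e (2 ^ (j + j0) / N) \<le> 2 powr e * r ^ j" for j
    proof -
      have "2 ^ j * N \<le> 2 ^ j * 2 ^ (j0 + 1)" using N2 by (intro mult_left_mono) auto
      then have "2 ^ j / 2 \<le> 2 ^ (j + j0) / N" using N by (simp add: pos_le_divide_eq power_add mult_ac)
      then have "(2 ^ (j + j0) / N) powr (- e) \<le> (2 ^ j / 2) powr (- e)" using e by (intro powr_mono2') auto
      also have "2 ^ j / 2 = 2 powr (real j - 1)" by (simp add: powr_diff powr_realpow)
      also have "\<dots> powr (- e) = 2 powr (e + (- e) * real j)" by (simp add: powr_powr algebra_simps)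
      also have "\<dots> = 2 powr e * r ^ j"
        unfolding powr_add powr_powr[symmetric] r_def[symmetric] powr_realpow[OF r(1)] ..
      finally show ?thesis by (simp add: peak_def)
    qed
    have low: "peak e (2 ^ j / N) \<le> 2 powr e * r ^ (j0 - Suc j)" if "j < j0" for j
    proof -
      have "2 ^ j / N \<le> 2 ^ j / 2 ^ j0" using N1 by (intro divide_left_mono) (auto simp: N less_le_trans[OF _ N])
      also have "\<dots> = 2 powr (real j - real j0)" by (simp add: powr_diff powr_realpow)
      also have "\<dots> = 2 powr (- real (j0 - j))" using that by (simp add: of_nat_diff)
      finally have "(2 ^ j / N) powr e \<le> (2 powr (- real (j0 - j))) powr e" using e N by (intro powr_mono2) auto
      also have "\<dots> = (2 powr (- e)) powr (real (j0 - j))" by (simp only: powr_powr) (simp add: mult.commute)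
      also have "\<dots> = r ^ (j0 - j)" unfolding r_def[symmetric] powr_realpow[OF r(1)] ..
      also have "\<dots> \<le> r ^ (j0 - Suc j)" using r by (intro power_decreasing) auto
      also have "\<dots> \<le> 2 powr e * r ^ (j0 - Suc j)" using r e ge_one_powr_ge_zero[of 2 e] by (simp add: mult_le_cancel_right1)
      finally show ?thesis by (simp add: peak_def)
    qed
    have gs: "summable (\<lambda>j. 2 powr e * r ^ j)" using r by (intro summable_mult summable_geometric) auto
    have s0: "summable (\<lambda>j. peak e (2 ^ (j + j0) / N))"
      by (rule summable_comparison_test[OF _ gs]) (use up peak_nonneg in auto)
    then have s: "summable (\<lambda>j. peak e (2 ^ j / N))" by (subst (asm) summable_iff_shift)
    have "(\<Sum>j. peak e (2 ^ (j + j0) / N)) \<le> (\<Sum>j. 2 powr e * r ^ j)" using up by (intro suminf_le s0 gs)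
    also have "\<dots> = 2 powr e * (1 / (1 - r))" using r by (subst suminf_mult) (auto simp: suminf_geometric)
    finally have 1: "(\<Sum>j. peak e (2 ^ (j + j0) / N)) \<le> 2 powr e * (1 / (1 - r))" .
    have "(\<Sum>j<j0. peak e (2 ^ j / N)) \<le> (\<Sum>j<j0. 2 powr e * r ^ (j0 - Suc j))" using low by (intro sum_mono) auto
    also have "\<dots> = (\<Sum>j<j0. 2 powr e * r ^ j)" by (rule sum.nat_diff_reindex)
    also have "\<dots> \<le> (\<Sum>j. 2 powr e * r ^ j)" using r by (intro sum_le_suminf gs) auto
    also have "\<dots> = 2 powr e * (1 / (1 - r))" using r by (subst suminf_mult) (auto simp: suminf_geometric)
    finally have 2: "(\<Sum>j<j0. peak e (2 ^ j / N)) \<le> 2 powr e * (1 / (1 - r))" .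
    have "(\<Sum>j. peak e (2 ^ j / N)) = (\<Sum>j. peak e (2 ^ (j + j0) / N)) + (\<Sum>j<j0. peak e (2 ^ j / N))"
      by (rule suminf_split_initial_segment[OF s])
    then show ?thesis using 1 2 s by (simp add: field_simps)
  qed
  then show ?thesis by blast
qed

lemma powr_le_peak:
  assumes "0 < e" "e \<le> a" "e \<le> b" "x > 0"
  shows "min (x powr a) (x powr (- b)) \<le> peak e x"
proof (cases "x \<le> 1")
  case True
  then have "x powr a \<le> x powr e" "x powr e \<le> x powr (- e)" using assms by (auto intro!: powr_mono')
  then show ?thesis by (simp add: peak_def)
next
  case False
  then have "x powr (- b) \<le> x powr (- e)" "x powr (- e) \<le> x powr e" using assms by (auto intro!: powr_mono)
  then show ?thesis by (simp add: peak_def)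
qed

lemma min_le_powr:
  fixes u v t :: real
  assumes "u > 0" "v > 0" "0 \<le> t" "t \<le> 1"
  shows "min u v \<le> u powr (1 - t) * v powr t"
proof -
  have "min u v = (min u v) powr (1 - t) * (min u v) powr t" using assms by (simp add: powr_add[symmetric])
  also have "\<dots> \<le> u powr (1 - t) * v powr t" using assms by (intro mult_mono powr_mono2) auto
  finally show ?thesis .
qed

text \<open>In the following lemma, \<open>x\<close> is the ratio of the level size to the effective sample size \<open>N\<close>, and
  \<open>D * x powr - (s * (1 - g))\<close> is \<open>\<mu> powr (1 - g)\<close>.\<close>

lemma level_combine:
  fixes s c :: real
  assumes s: "s > 1" and c: "0 < c" "c \<le> 1"
  obtains g k e t h where "0 < g" "g < 1" "0 < k" "k \<le> 1/2" "0 < e" "0 < t" "0 < h"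
    and "\<And>N x. N \<ge> 1 \<Longrightarrow> x > 0 \<Longrightarrow> x < N powr (- k) \<Longrightarrow> (N * x) powr (1 + g) \<le> N * (N powr (- h) * peak e x)"
    and "\<And>N x D \<mu>. N \<ge> 1 \<Longrightarrow> x > 0 \<Longrightarrow> N powr (- k) \<le> x \<Longrightarrow> x \<le> N powr k \<Longrightarrow> 0 < D \<Longrightarrow> D \<le> 1 \<Longrightarrow>
      0 \<le> \<mu> \<Longrightarrow> \<mu> \<le> 2 * x powr (- s) \<Longrightarrow>
      N * x * min 1 (D * x powr (- (s * (1 - g)))) + (N * x) powr (1 - c) * (1 + \<mu>) \<le> N * ((D powr t + 3 * N powr (- h)) * peak e x)"
    and "\<And>N x D. N \<ge> 1 \<Longrightarrow> x > 0 \<Longrightarrow> x > N powr k \<Longrightarrow> 0 < D \<Longrightarrow> D \<le> 1 \<Longrightarrow>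
      (N * x) powr (1 + g) * (D * x powr (- (s * (1 - g)))) \<le> N * (N powr (- h) * peak e x)"
proof -
  \<comment> \<open>The margin \<open>s - 1 > 0\<close> is divided up. \<open>e\<close> is the decay
    exponent of the peak. \<open>k\<close> fixes the middle range by
    \<open>k * (3 + s) = c / 2\<close>, so that the powers of \<open>x\<close> and \<mu> there cost
    less than the gain \<open>N powr (- c)\<close>. \<open>g\<close> is so small that
    \<open>s * (1 - g) > 1\<close> and that \<open>N powr g\<close> loses against
    \<open>N powr (- k / 2)\<close> and \<open>N powr (- (k * e))\<close>. \<open>h\<close> is what
    remains of these gains.\<close>
  define e where "e = min (1/2) ((s - 1) / 4)"
  define k where "k = c / (2 * (3 + s))"
  define g where "g = Min {(s - 1) / (4 * s), (s - 1) / 8, k / 4, k * e / 2, 1/2}"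
  define s' where "s' = s * (1 - g)"
  define t where "t = 1 / (2 * s')"
  define h where "h = Min {k / 4, c / 2, k * e / 2}"
  have e: "0 < e" "e \<le> 1/2" "e \<le> (s - 1) / 4" using s unfolding e_def by (auto intro: min.cobounded1 min.cobounded2 simp del: le_divide_eq_numeral1)
  have k: "0 < k" "k \<le> 1/2" using s c by (auto simp: k_def field_simps)
  have g: "g \<le> (s - 1) / (4 * s)" "g \<le> (s - 1) / 8" "g \<le> k / 4" "g \<le> k * e / 2" "g \<le> 1/2"
    unfolding g_def by (rule Min_le; simp)+
  have g0: "0 < g" using s k e by (auto simp: g_def)
  have h: "h \<le> k / 4" "h \<le> c / 2" "h \<le> k * e / 2" unfolding h_def by (rule Min_le; simp)+
  have h0: "0 < h" using c k e by (auto simp: h_def)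
  have "s * g \<le> s * ((s - 1) / (4 * s))" using g s by (intro mult_left_mono) auto
  also have "\<dots> = (s - 1) / 4" using s by simp
  finally have s'2: "s' - 1 \<ge> 3 * (s - 1) / 4" by (simp add: s'_def right_diff_distrib)
  then have s': "s' > 1" using s by simp
  have t: "0 < t" "t \<le> 1" using s' by (auto simp: t_def field_simps)
  have kk: "k + k * c + k * s + k * e - c \<le> - h"
  proof -
    have "k * e \<le> k * 1" using e k by (intro mult_left_mono) auto
    moreover have "k * c \<le> k * 1" using c k by (intro mult_left_mono) auto
    moreover have "k * (3 + s) = c / 2" using s by (simp add: k_def field_simps)
    ultimately show ?thesis using h(2) by (simp add: distrib_left)
  qed
  have A: "(N * x) powr (1 + g) \<le> N * (N powr (- h) * peak e x)"
    if N: "N \<ge> 1" and x: "x > 0" "x < N powr (- k)" for N x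
  proof -
    have "N powr (- k) \<le> N powr 0" using N k by (intro powr_mono) auto
    then have x1: "x \<le> 1" using x N by simp
    have "x powr (1/2 + g) \<le> x powr (1/2)" using x x1 g0 by (intro powr_mono') auto
    also have "\<dots> \<le> (N powr (- k)) powr (1/2)" using x by (intro powr_mono2) auto
    also have "\<dots> = N powr (- k / 2)" by (simp add: powr_powr)
    finally have 1: "x powr (1/2 + g) \<le> N powr (- k / 2)" .
    have 2: "x powr (1/2) \<le> peak e x"
    proof -
      have "x powr (1/2) \<le> x powr e" "x powr (1/2) \<le> x powr (- e)" using x x1 e by (auto intro!: powr_mono')
      then show ?thesis by (simp add: peak_def)
    qed
    have "(N * x) powr (1 + g) = N * N powr g * (x powr (1/2) * x powr (1/2 + g))"
      using N x by (simp add: powr_mult powr_add[symmetric]) (simp add: powr_add)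
    also have "\<dots> \<le> N * N powr g * (peak e x * N powr (- k / 2))"
      using N 1 2 by (intro mult_left_mono mult_mono) (auto simp: peak_nonneg)
    also have "\<dots> = N * (N powr (g - k / 2) * peak e x)" using N by (simp add: powr_add[symmetric] mult_ac)
    also have "\<dots> \<le> N * (N powr (- h) * peak e x)"
      using N g h by (intro mult_left_mono mult_right_mono powr_mono) (auto simp: peak_nonneg)
    finally show ?thesis .
  qed
  have B: "N * x * min 1 (D * x powr (- s')) + (N * x) powr (1 - c) * (1 + \<mu>) \<le> N * ((D powr t + 3 * N powr (- h)) * peak e x)"
    if N: "N \<ge> 1" and x: "x > 0" "N powr (- k) \<le> x" "x \<le> N powr k" and D: "0 < D" "D \<le> 1" and \<mu>: "\<mu> \<ge> 0" "\<mu> \<le> 2 * x powr (- s)" for N x D \<mu>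
  proof -
    define P where "P = D * x powr (- s')"
    have P: "P > 0" using D x by (simp add: P_def)
    \<comment> \<open>The same minimum is interpolated twice: weight \<open>t\<close> leads to
      \<open>x powr (1/2)\<close>, good for small \<open>x\<close>, and weight \<open>u\<close> to
      \<open>x powr (- ((s' - 1) / 2))\<close>, good for large \<open>x\<close>. Both keep the
      factor \<open>D powr t\<close>, as \<open>t \<le> u\<close> and
      \<open>D \<le> 1\<close>.\<close>
    have "x * min 1 P \<le> D powr t * x powr (1/2)"
    proof -
      have "min 1 P \<le> 1 powr (1 - t) * P powr t" using P t by (intro min_le_powr) auto
      also have "\<dots> = D powr t * x powr (- s' * t)" using D x by (simp add: P_def powr_mult powr_powr)
      also have "- s' * t = - (1/2)" using s' by (simp add: t_def)
      finally have "x * min 1 P \<le> x * (D powr t * x powr (- (1/2)))" using x by (intro mult_left_mono) (auto simp: mult.commute)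
      also have "\<dots> = D powr t * (x powr 1 * x powr (- (1/2)))" using x by simp
      also have "\<dots> = D powr t * x powr (1/2)" unfolding powr_add[symmetric] by simp
      finally show ?thesis .
    qed
    moreover have "x * min 1 P \<le> D powr t * x powr (- ((s' - 1) / 2))"
    proof -
      define u where "u = (s' + 1) / (2 * s')"
      have u: "t \<le> u" "u \<le> 1" "0 \<le> u" using s' by (auto simp: t_def u_def field_simps)
      have "min 1 P \<le> 1 powr (1 - u) * P powr u" using P u by (intro min_le_powr) auto
      also have "\<dots> = D powr u * x powr (- s' * u)" using D x by (simp add: P_def powr_mult powr_powr)
      also have "\<dots> \<le> D powr t * x powr (- s' * u)" using D u by (intro mult_right_mono powr_mono') auto
      also have "- s' * u = - (s' + 1) / 2" using s' by (simp add: u_def field_simps)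
      finally have "x * min 1 P \<le> x * (D powr t * x powr (- (s' + 1) / 2))" using x by (intro mult_left_mono) auto
      also have "\<dots> = D powr t * (x powr 1 * x powr (- (s' + 1) / 2))" using x by simp
      also have "\<dots> = D powr t * x powr (1 + - (s' + 1) / 2)" unfolding powr_add ..
      also have "1 + - (s' + 1) / 2 = - ((s' - 1) / 2)" by (simp add: field_simps)
      finally show ?thesis .
    qed
    ultimately have "x * min 1 P \<le> D powr t * min (x powr (1/2)) (x powr (- ((s' - 1) / 2)))" by (simp add: min_def)
    also have "\<dots> \<le> D powr t * peak e x"
      using e s'2 s x by (intro mult_left_mono powr_le_peak) auto
    finally have 1: "x * min 1 P \<le> D powr t * peak e x" .
    \<comment> \<open>On the middle range the peak is at least a small negative power of
      \<open>N\<close>, so an error that is a larger negative power of \<open>N\<close> can be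
      charged to the peak.\<close>
    have pk: "N powr (- (k * e)) \<le> peak e x"
    proof -
      have "(N powr (- k)) powr e \<le> x powr e" using x e by (intro powr_mono2) auto
      moreover have "(N powr k) powr (- e) \<le> x powr (- e)" using x e by (intro powr_mono2') auto
      ultimately show ?thesis by (simp add: peak_def powr_powr)
    qed
    have x2: "x powr (1 - c) \<le> N powr (k + k * c)"
    proof -
      have "x powr (1 - c) \<le> (N powr k) powr (1 - c)" using x c by (intro powr_mono2) auto
      also have "\<dots> = N powr (k * (1 - c))" by (simp add: powr_powr)
      also have "\<dots> \<le> N powr (k + k * c)" using N k c by (intro powr_mono) (auto simp: algebra_simps)
      finally show ?thesis .
    qed
    have m3: "1 + \<mu> \<le> 3 * N powr (k * s)"
    proof -
      have "x powr (- s) \<le> (N powr (- k)) powr (- s)" using x s N by (intro powr_mono2') auto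
      then have "x powr (- s) \<le> N powr (k * s)" by (simp add: powr_powr)
      moreover have "1 \<le> N powr (k * s)" using N k s by (intro ge_one_powr_ge_zero) auto
      ultimately show ?thesis using \<mu> by linarith
    qed
    have "(N * x) powr (1 - c) * (1 + \<mu>) = N * (N powr (- c)) * x powr (1 - c) * (1 + \<mu>)"
      using N x by (simp add: powr_mult powr_diff powr_minus divide_inverse)
    also have "\<dots> \<le> N * (N powr (- c)) * N powr (k + k * c) * (3 * N powr (k * s))"
      using N x2 m3 \<mu> by (intro mult_mono mult_left_mono) auto
    also have "\<dots> = N * (3 * (N powr (k + k * c + k * s + k * e - c) * N powr (- (k * e))))"
    proof -
      have "N powr (- c) * N powr (k + k * c) * N powr (k * s) = N powr (k + k * c + k * s + k * e - c) * N powr (- (k * e))"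
        unfolding powr_add[symmetric] by (simp add: algebra_simps)
      then show ?thesis by (simp add: mult_ac)
    qed
    also have "\<dots> \<le> N * (3 * (N powr (- h) * peak e x))"
      using N kk pk by (intro mult_left_mono mult_mono powr_mono) auto
    finally have 2: "(N * x) powr (1 - c) * (1 + \<mu>) \<le> N * (3 * (N powr (- h) * peak e x))" .
    have "N * x * min 1 P \<le> N * (D powr t * peak e x)" using mult_left_mono[OF 1, of N] N by (simp add: mult.assoc)
    then show ?thesis using 2 unfolding P_def by (simp add: algebra_simps)
  qed
  have C: "(N * x) powr (1 + g) * (D * x powr (- s')) \<le> N * (N powr (- h) * peak e x)"
    if N: "N \<ge> 1" and x: "x > 0" "x > N powr k" and D: "0 < D" "D \<le> 1" for N x D
  proof -
    have "N powr 0 \<le> N powr k" using N k by (intro powr_mono) auto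
    then have x1: "x \<ge> 1" using x N by simp
    have "x powr (1 + g) * x powr (- s') = x powr (1 + g - s')" by (simp add: powr_add[symmetric])
    also have "\<dots> \<le> x powr (- e + - e)" using x1 g s'2 e by (intro powr_mono) auto
    also have "\<dots> = x powr (- e) * x powr (- e)" by (rule powr_add)
    also have "\<dots> \<le> x powr (- e) * (N powr k) powr (- e)" using x e N by (intro mult_left_mono powr_mono2') auto
    also have "\<dots> = x powr (- e) * N powr (- (k * e))" by (simp add: powr_powr)
    also have "x powr (- e) = peak e x" using x1 e powr_mono[of "- e" e x] by (simp add: peak_def)
    finally have 1: "x powr (1 + g) * x powr (- s') \<le> peak e x * N powr (- (k * e))" .
    have "(N * x) powr (1 + g) * (D * x powr (- s')) = N * N powr g * D * (x powr (1 + g) * x powr (- s'))"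
      using N x by (simp add: powr_mult powr_add)
    also have "\<dots> \<le> N * N powr g * 1 * (peak e x * N powr (- (k * e)))"
      by (intro mult_mono[OF mult_left_mono 1]) (use N D in \<open>auto simp: peak_nonneg\<close>)
    also have "\<dots> = N * (N powr (g - k * e) * peak e x)" using N by (simp add: powr_add[symmetric] mult_ac)
    also have "\<dots> \<le> N * (N powr (- h) * peak e x)"
      using N g h by (intro mult_left_mono mult_right_mono powr_mono) (auto simp: peak_nonneg)
    finally show ?thesis .
  qed
  have g1: "g < 1" using g by simp
  show thesis by (rule that[OF g0 g1 k e(1) t(1) h0 A B[unfolded s'_def] C[unfolded s'_def]])
qed

section \<open>Risk of the estimator\<close>

text \<open>Independence of a row follows by grouping the array into the disjoint singleton blocks
  \<open>{(j, k)}\<close> and evaluating each block at its only index.\<close>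

lemma gauss_level_of_array:
  assumes "prob_space M"
    and ind: "prob_space.indep_vars M (\<lambda>_. borel) (\<lambda>(j, k). z j k) coef_index"
    and dist: "\<And>j k. (j, k) \<in> coef_index \<Longrightarrow> distributed M lborel (z j k) std_normal_density"
    and j: "j \<ge> 1"
  shows "gauss_level M (z j) (level_size j)"
proof -
  interpret prob_space M by fact
  have sub: "(j, k) \<in> coef_index" if "k \<in> {1..level_size j}" for k using j that by (auto simp: coef_index_def)
  have "indep_vars (\<lambda>k. PiM {(j, k)} (\<lambda>_. borel)) (\<lambda>k \<omega>. restrict (\<lambda>i. (case i of (j, k) \<Rightarrow> z j k) \<omega>) {(j, k)}) {1..level_size j}"
    using sub by (intro indep_vars_restrict[OF ind]) (auto simp: disjoint_family_on_def)
  then have "indep_vars (\<lambda>_. borel) (\<lambda>k \<omega>. (restrict (\<lambda>i. (case i of (j, k) \<Rightarrow> z j k) \<omega>) {(j, k)}) (j, k)) {1..level_size j}"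
    by (rule indep_vars_compose2) (auto intro: measurable_component_singleton)
  then have "indep_vars (\<lambda>_. borel) (z j) {1..level_size j}" by simp
  moreover have "level_size j \<ge> 2"
  proof -
    have "(2::nat) ^ 1 \<le> 2 ^ nat j" using j by (intro power_increasing) auto
    then show ?thesis by (simp add: level_size_def)
  qed
  ultimately show ?thesis using dist sub by unfold_locales auto
qed

text \<open>Division by \<epsilon> turns the level into unit-variance observations with means
  \<open>\<beta> j k / \<epsilon>\<close>, and squared loss scales by
  \<open>\<epsilon>\<^sup>2\<close>.\<close>

lemma (in gauss_level_geb) risk_level_eq:
  assumes \<rho>: "\<rho> = geb_rho \<eta> \<rho>\<^sub>0 n" and n: "n = level_size j" and j: "j \<ge> j_star n\<^sub>s" and \<epsilon>: "\<epsilon> > 0"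
    and z: "\<And>k. Z k = z j k"
  shows "(\<Sum>k=1..level_size j. \<integral>\<^sup>+\<omega>. ennreal ((geb_estimator n\<^sub>s \<eta> \<rho>\<^sub>0 b0 \<epsilon> (observation z \<epsilon> \<beta> \<omega>) j k - \<beta> j k)\<^sup>2) \<partial>M) =
    ennreal (\<epsilon>\<^sup>2) * risk_sum (\<lambda>k. \<beta> j k / \<epsilon>)"
proof -
  let ?\<theta> = "\<lambda>k. \<beta> j k / \<epsilon>"
  have "(\<integral>\<^sup>+\<omega>. ennreal ((geb_estimator n\<^sub>s \<eta> \<rho>\<^sub>0 b0 \<epsilon> (observation z \<epsilon> \<beta> \<omega>) j k - \<beta> j k)\<^sup>2) \<partial>M) =
    ennreal (\<epsilon>\<^sup>2) * (\<integral>\<^sup>+\<omega>. ennreal ((hybrid ?\<theta> \<omega> k - ?\<theta> k)\<^sup>2) \<partial>M)" if k: "k \<in> {1..n}" for k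
  proof -
    note [measurable] = geb_shrink_measurable[OF k] Z_measurable[OF k]
    have e: "ennreal ((geb_estimator n\<^sub>s \<eta> \<rho>\<^sub>0 b0 \<epsilon> (observation z \<epsilon> \<beta> \<omega>) j k - \<beta> j k)\<^sup>2) =
      ennreal (\<epsilon>\<^sup>2) * ennreal ((hybrid ?\<theta> \<omega> k - ?\<theta> k)\<^sup>2)" if \<omega>: "\<omega> \<in> space M" for \<omega>
    proof -
      have y: "observation z \<epsilon> \<beta> \<omega> j k / \<epsilon> = X ?\<theta> \<omega> k" for k
        using \<epsilon> by (simp add: observation_def z add_divide_distrib)
      have "geb_rule \<eta> \<rho>\<^sub>0 b0 n (X ?\<theta> \<omega>) (X ?\<theta> \<omega> k) = hybrid ?\<theta> \<omega> k"
        using \<omega> unfolding geb_rule_def hybrid_def gebE_def b_def bw_def geb_shrink_def \<rho>[symmetric] by simp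
      then have "geb_estimator n\<^sub>s \<eta> \<rho>\<^sub>0 b0 \<epsilon> (observation z \<epsilon> \<beta> \<omega>) j k = \<epsilon> * hybrid ?\<theta> \<omega> k"
        using j by (simp add: geb_estimator_def y n[symmetric])
      then have "geb_estimator n\<^sub>s \<eta> \<rho>\<^sub>0 b0 \<epsilon> (observation z \<epsilon> \<beta> \<omega>) j k - \<beta> j k = \<epsilon> * (hybrid ?\<theta> \<omega> k - ?\<theta> k)"
        using \<epsilon> by (simp add: right_diff_distrib)
      then show ?thesis by (simp add: power_mult_distrib ennreal_mult)
    qed
    have [measurable]: "(\<lambda>\<omega>. hybrid ?\<theta> \<omega> k) \<in> borel_measurable M" unfolding hybrid_def by measurable
    show ?thesis by (subst nn_integral_cmult[symmetric]) (auto intro!: nn_integral_cong e)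
  qed
  then show ?thesis unfolding risk_sum_def n[symmetric] by (simp add: sum_distrib_left)
qed

lemma risk_low_level:
  assumes dist: "\<And>k. k \<in> {1..level_size j} \<Longrightarrow> distributed M lborel (z j k) std_normal_density"
    and j: "j < j_star n\<^sub>s" and \<epsilon>: "\<epsilon> > 0"
  shows "(\<Sum>k=1..level_size j. \<integral>\<^sup>+\<omega>. ennreal ((geb_estimator n\<^sub>s \<eta> \<rho>\<^sub>0 b0 \<epsilon> (observation z \<epsilon> \<beta> \<omega>) j k - \<beta> j k)\<^sup>2) \<partial>M)
    \<le> ennreal (\<epsilon>\<^sup>2 * (8 * level_size j))"
proof -
  have "(\<integral>\<^sup>+\<omega>. ennreal ((geb_estimator n\<^sub>s \<eta> \<rho>\<^sub>0 b0 \<epsilon> (observation z \<epsilon> \<beta> \<omega>) j k - \<beta> j k)\<^sup>2) \<partial>M) \<le> ennreal (\<epsilon>\<^sup>2 * 8)"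
    if k: "k \<in> {1..level_size j}" for k
  proof -
    have "(\<integral>\<^sup>+\<omega>. ennreal ((geb_estimator n\<^sub>s \<eta> \<rho>\<^sub>0 b0 \<epsilon> (observation z \<epsilon> \<beta> \<omega>) j k - \<beta> j k)\<^sup>2) \<partial>M) =
      (\<integral>\<^sup>+\<omega>. ennreal (\<epsilon>\<^sup>2 * (z j k \<omega>)\<^sup>2) \<partial>M)"
      using j by (simp add: geb_estimator_def observation_def power_mult_distrib)
    also have "\<dots> = (\<integral>\<^sup>+x. ennreal (\<epsilon>\<^sup>2 * x\<^sup>2) \<partial>std_normal_distribution)"
      using distributed_nn_integral[OF dist[OF k], of "\<lambda>x. ennreal (\<epsilon>\<^sup>2 * x\<^sup>2)"] by (simp add: nn_integral_density)
    also have "\<dots> = ennreal (\<epsilon>\<^sup>2) * (\<integral>\<^sup>+x. ennreal (x\<^sup>2) \<partial>std_normal_distribution)"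
      by (subst nn_integral_cmult[symmetric]) (auto simp: ennreal_mult)
    also have "\<dots> \<le> ennreal (\<epsilon>\<^sup>2) * ennreal 8" using std_normal_moment2 by (intro mult_left_mono) auto
    also have "\<dots> = ennreal (\<epsilon>\<^sup>2 * 8)" by (rule ennreal_mult[symmetric]) auto
    finally show ?thesis .
  qed
  then have "(\<Sum>k=1..level_size j. \<integral>\<^sup>+\<omega>. ennreal ((geb_estimator n\<^sub>s \<eta> \<rho>\<^sub>0 b0 \<epsilon> (observation z \<epsilon> \<beta> \<omega>) j k - \<beta> j k)\<^sup>2) \<partial>M)
    \<le> (\<Sum>k=1..level_size j. ennreal (\<epsilon>\<^sup>2 * 8))" by (intro sum_mono)
  also have "\<dots> = ennreal (\<epsilon>\<^sup>2 * (8 * level_size j))"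
    by (subst sum_ennreal) (auto simp: mult_ac)
  finally show ?thesis .
qed

text \<open>The Besov weight is such that \<open>n powr (- 1 / p)\<close> times the block
  \<open>p\<close>-norm equals \<open>n powr (- (\<alpha> + 1/2))\<close> times
  \<open>block_norm\<close>, and \<epsilon> is the effective sample size to the power
  \<open>- (\<alpha> + 1/2)\<close>. Only the ratio of the two sizes is left.\<close>

lemma moment_le_scale:
  assumes p: "p > 0" and \<epsilon>: "\<epsilon> > 0" and a: "\<alpha> + 1/2 > 0" and d: "block_norm \<alpha> p J \<beta> \<le> d"
  defines "r \<equiv> (if p \<le> 2 then real_of_ereal p else 2)"
  shows "(\<Sum>k=1..2 ^ J. \<bar>\<beta> (int J) k / \<epsilon>\<bar> powr r) / real (2 ^ J) \<le>
    2 * d powr r * (2 ^ J / \<epsilon> powr (- 1 / (\<alpha> + 1/2))) powr (- (r * (\<alpha> + 1/2)))"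
proof -
  let ?n = "2 ^ J :: nat" and ?A = "\<alpha> + 1/2" and ?lp = "lp_block p (2 ^ J) (\<beta> (int J))"
  have r: "r > 0" using p unfolding r_def by (cases p) auto
  have d0: "d \<ge> 0" using d block_norm_nonneg[of \<alpha> p J \<beta>] by linarith
  have lp0: "?lp \<ge> 0" by (rule lp_block_nonneg) simp
  have n: "real ?n = 2 powr real J" by (simp add: powr_realpow)
  have "real ?n powr (- real_of_ereal (1 / p)) * ?lp = real ?n powr (- ?A) * block_norm \<alpha> p J \<beta>"
    unfolding n block_norm_def powr_powr mult.assoc[symmetric] powr_add[symmetric] by (simp add: algebra_simps)
  also have "\<dots> \<le> real ?n powr (- ?A) * d" using d by (intro mult_left_mono) auto
  finally have le: "real ?n powr (- real_of_ereal (1 / p)) * ?lp \<le> real ?n powr (- ?A) * d" .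
  have "(\<Sum>k=1..?n. \<bar>\<beta> (int J) k / \<epsilon>\<bar> powr r) / real ?n = (\<Sum>k=1..?n. \<bar>\<beta> (int J) k\<bar> powr r) / real ?n / \<epsilon> powr r"
    using \<epsilon> by (simp add: abs_divide powr_divide sum_divide_distrib[symmetric])
  also have "\<dots> \<le> 2 * (real ?n powr (- real_of_ereal (1 / p)) * ?lp) powr r / \<epsilon> powr r"
    unfolding r_def using p by (intro divide_right_mono moment_le_lp_block) auto
  also have "\<dots> \<le> 2 * (real ?n powr (- ?A) * d) powr r / \<epsilon> powr r"
    using le lp0 r by (intro divide_right_mono mult_left_mono powr_mono2 mult_nonneg_nonneg) auto
  also have "\<dots> = 2 * d powr r * (real ?n / \<epsilon> powr (- 1 / ?A)) powr (- (r * ?A))"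
  proof -
    have "(\<epsilon> powr (- 1 / ?A)) powr (- (r * ?A)) = \<epsilon> powr r" using a by (simp add: powr_powr)
    then have "(real ?n / \<epsilon> powr (- 1 / ?A)) powr (- (r * ?A)) = (real ?n) powr (- (r * ?A)) / \<epsilon> powr r"
      using \<epsilon> by (simp add: powr_divide)
    moreover have "(real ?n powr (- ?A) * d) powr r = real ?n powr (- (r * ?A)) * d powr r"
    proof -
      have "(real ?n powr (- ?A) * d) powr r = (real ?n powr (- ?A)) powr r * d powr r"
        using d0 by (simp add: powr_mult)
      also have "(real ?n powr (- ?A)) powr r = real ?n powr (- ?A * r)" by (rule powr_powr)
      also have "- ?A * r = - (r * ?A)" by algebra
      finally show ?thesis .
    qed
    ultimately show ?thesis by simp
  qed
  finally show ?thesis by simp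
qed

text \<open>For \<open>n = 2 ^ J\<close> the square of \<open>bw n\<close> is
  \<open>2 * J * ln 2\<close>, so the cube has order \<open>J powr (3/2)\<close>. The exponent
  exceeds \<open>1\<close>, which makes these terms summable over the levels; \<open>Suc J\<close>
  is the index of the level in \<open>risk\<close>.\<close>

lemma inverse_bw_cube:
  assumes "J \<ge> 1" shows "1 / bw (2 ^ J) ^ 3 \<le> 4 * real (Suc J) powr (- 3/2)"
proof -
  let ?L = "bw (2 ^ J)"
  have n: "(2::nat) ^ J \<ge> 2" using assms self_le_power[of 2 J] by simp
  have L: "?L \<ge> 1" by (rule bw_ge_1[OF n])
  have "ln (real (2 ^ J)) = J * ln 2" by (simp add: ln_realpow)
  then have L2: "?L\<^sup>2 = J * (2 * ln 2)" using bw_sq[of "2 ^ J"] by simp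
  have "Suc J / 2 \<le> real J * 1" using assms by simp
  also have "\<dots> \<le> J * (2 * ln 2)" using ln2_ge_two_thirds by (intro mult_left_mono) auto
  finally have "?L\<^sup>2 \<ge> Suc J / 2" unfolding L2 .
  then have "(?L\<^sup>2) powr (- 3/2) \<le> (real (Suc J) / 2) powr (- 3/2)" by (intro powr_mono2') auto
  moreover have "(?L\<^sup>2) powr (- 3/2) = 1 / ?L ^ 3"
  proof -
    have "?L\<^sup>2 = ?L powr 2" using L by (simp add: powr_numeral)
    then have "(?L\<^sup>2) powr (- 3/2) = ?L powr (- 3)" by (simp add: powr_powr)
    then show ?thesis using L by (simp add: powr_minus_divide powr_numeral)
  qed
  moreover have "(real (Suc J) / 2) powr (- 3/2) \<le> 4 * real (Suc J) powr (- 3/2)"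
  proof -
    have "(real (Suc J) / 2) powr (- 3/2) = real (Suc J) powr (- 3/2) * 2 powr (3/2)"
      using powr_minus_divide[of "2::real" "3/2"] by (simp add: powr_divide del: of_nat_Suc)
    also have "2 powr (3/2) \<le> (2::real) powr 2" by (intro powr_mono) auto
    finally show ?thesis by (simp add: mult.commute mult_right_mono)
  qed
  ultimately show ?thesis by linarith
qed

text \<open>The common core of both claims: all that is asked of \<open>B\<close> is that the block
  norms are uniformly small from some level on, which covers single arrays and compact sets alike.
  The risk of the level with index \<open>i\<close> is bounded by
  \<open>\<epsilon>\<^sup>2 * U i\<close> with \<open>U\<close> independent of \<beta>.\<close>

lemma risk_eventually_small:
  fixes M :: "'w measure"
    and z :: "int \<Rightarrow> nat \<Rightarrow> 'w \<Rightarrow> real"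
    and n\<^sub>s \<rho>\<^sub>0 b\<^sub>0 \<alpha> \<tau> :: real
    and \<eta> :: "nat \<Rightarrow> real"
    and p :: ereal
  assumes M: "prob_space M"
    and ind: "prob_space.indep_vars M (\<lambda>_. borel) (\<lambda>(j, k). z j k) coef_index"
    and dist: "\<And>j k. (j, k) \<in> coef_index \<Longrightarrow> distributed M lborel (z j k) std_normal_density"
    and ns: "n\<^sub>s > 2" and \<rho>: "\<rho>\<^sub>0 > 0" and b0: "b\<^sub>0 > 0"
    and \<eta>: "\<eta> \<longlonglongrightarrow> 0"
    and pos: "\<And>j. j \<ge> j_star n\<^sub>s \<Longrightarrow> geb_rho \<eta> \<rho>\<^sub>0 (level_size j) > 0"
    and \<alpha>: "\<alpha> > 0" and p: "ereal (1 / (\<alpha> + 1/2)) < p"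
    and tail: "\<And>d. d > 0 \<Longrightarrow> \<exists>m. \<forall>\<beta>\<in>B. \<forall>j\<ge>m. block_norm \<alpha> p j \<beta> \<le> d"
    and \<tau>: "\<tau> > 0"
  shows "\<forall>\<^sub>F \<epsilon> in at_right 0. \<forall>\<beta>\<in>B.
    ennreal (\<epsilon> powr (- 2 * \<alpha> / (\<alpha> + 1/2))) * risk M z \<epsilon> (geb_estimator n\<^sub>s \<eta> \<rho>\<^sub>0 b\<^sub>0 \<epsilon>) \<beta> \<le> ennreal \<tau>"
proof -
  let ?A = "\<alpha> + 1/2"
  have p0: "p > 0" using p \<alpha> by (cases p) (auto intro: less_trans[of 0 "1/(\<alpha>+1/2)"])
  \<comment> \<open>The moment order is \<open>p\<close> capped at \<open>2\<close>, so that the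
    moment dominates the sparsity. In the uncapped case \<open>s > 1\<close> is the assumed lower
    bound on \<open>p\<close>; in the other it is \<open>\<alpha> > 0\<close>.\<close>
  define pp where "pp = (if p \<le> 2 then real_of_ereal p else 2)"
  have pp: "0 < pp" "pp \<le> 2" using p0 unfolding pp_def by (cases p; auto)+
  define s where "s = pp * ?A"
  have s: "s > 1"
  proof (cases "p \<le> 2")
    case True
    then obtain t where t: "p = ereal t" using p0 by (cases p) auto
    then show ?thesis using p \<alpha> True by (simp add: s_def pp_def field_simps)
  next
    case False
    then show ?thesis using \<alpha> by (simp add: s_def pp_def)
  qed
  have js: "j_star n\<^sub>s \<ge> 1" by (rule j_star_ge_1[OF ns])
  have lev: "gauss_level M (z j) (level_size j)" if "j \<ge> j_star n\<^sub>s" for j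
    using that js by (intro gauss_level_of_array[OF M ind dist]) auto
  have rho_eq: "geb_rho \<eta> \<rho>\<^sub>0 n = (1 + \<eta> n) * \<rho>\<^sub>0 * bw n / sqrt n" for n
    by (simp add: geb_rho_def bw_def real_sqrt_divide)
  have "\<exists>c C. 0 < c \<and> c \<le> 1 \<and> 1 \<le> C \<and> (\<forall>n\<in>level_size ` {j. j \<ge> j_star n\<^sub>s}. c \<le> (1 + \<eta> n) * \<rho>\<^sub>0 \<and> (1 + \<eta> n) * \<rho>\<^sub>0 \<le> C)"
  proof (rule tendsto_pos_bounds)
    show "(\<lambda>n. (1 + \<eta> n) * \<rho>\<^sub>0) \<longlonglongrightarrow> \<rho>\<^sub>0"
      using tendsto_mult_right[OF tendsto_add[OF tendsto_const[of 1] \<eta>], of \<rho>\<^sub>0] by simp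
    fix n assume "n \<in> level_size ` {j. j \<ge> j_star n\<^sub>s}"
    then obtain j where j: "j \<ge> j_star n\<^sub>s" "n = level_size j" by auto
    interpret gauss_level M "z j" n using lev j by simp
    have "0 < L / sqrt n" using L1 n2 by simp
    moreover have "0 < (1 + \<eta> n) * \<rho>\<^sub>0 * (L / sqrt n)" using pos[OF j(1)] j(2) rho_eq by simp
    ultimately show "(1 + \<eta> n) * \<rho>\<^sub>0 > 0" by (rule zero_less_mult_pos2[rotated])
  qed (use \<rho> in auto)
  then obtain c C where cC: "0 < c" "c \<le> 1" "1 \<le> C"
    "\<And>j. j \<ge> j_star n\<^sub>s \<Longrightarrow> c \<le> (1 + \<eta> (level_size j)) * \<rho>\<^sub>0 \<and> (1 + \<eta> (level_size j)) * \<rho>\<^sub>0 \<le> C" by blast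
  have geb: "gauss_level_geb M (z j) (level_size j) (geb_rho \<eta> \<rho>\<^sub>0 (level_size j)) c C b\<^sub>0" if j: "j \<ge> j_star n\<^sub>s" for j
  proof -
    interpret gauss_level M "z j" "level_size j" by (rule lev[OF j])
    show ?thesis
      by unfold_locales (use cC cC(4)[OF j] b0 L1 in \<open>auto simp: rho_eq intro!: divide_right_mono mult_right_mono\<close>)
  qed
  have pp16: "0 < pp / 16" "pp / 16 \<le> 1" using pp by auto
  obtain g k e t h where gk: "0 < g" "g < 1" "0 < k" "k \<le> 1/2" "0 < e" "0 < t" "0 < h"
    and near: "\<And>N x. N \<ge> 1 \<Longrightarrow> x > 0 \<Longrightarrow> x < N powr (- k) \<Longrightarrow> (N * x) powr (1 + g) \<le> N * (N powr (- h) * peak e x)"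
    and middle: "\<And>N x D \<mu>. N \<ge> 1 \<Longrightarrow> x > 0 \<Longrightarrow> N powr (- k) \<le> x \<Longrightarrow> x \<le> N powr k \<Longrightarrow> 0 < D \<Longrightarrow> D \<le> 1 \<Longrightarrow>
      0 \<le> \<mu> \<Longrightarrow> \<mu> \<le> 2 * x powr (- s) \<Longrightarrow>
      N * x * min 1 (D * x powr (- (s * (1 - g)))) + (N * x) powr (1 - pp / 16) * (1 + \<mu>) \<le> N * ((D powr t + 3 * N powr (- h)) * peak e x)"
    and far: "\<And>N x D. N \<ge> 1 \<Longrightarrow> x > 0 \<Longrightarrow> x > N powr k \<Longrightarrow> 0 < D \<Longrightarrow> D \<le> 1 \<Longrightarrow>
      (N * x) powr (1 + g) * (D * x powr (- (s * (1 - g)))) \<le> N * (N powr (- h) * peak e x)"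
    by (rule level_combine[OF s pp16]) blast
  obtain K where K: "K \<ge> 1" and bounds: "\<forall>(M :: 'w measure) Z n \<rho> \<theta>. gauss_level_geb M Z n \<rho> c C b\<^sub>0 \<longrightarrow>
      gauss_level_geb.risk_sum M Z n \<rho> b\<^sub>0 \<theta> \<le> ennreal (K * n powr (1 + g)) \<and>
      (\<forall>\<mu>>0. (\<Sum>i=1..n. \<bar>\<theta> i\<bar> powr pp) / n \<le> \<mu> \<longrightarrow>
        gauss_level_geb.risk_sum M Z n \<rho> b\<^sub>0 \<theta> \<le> ennreal (K * (n * min 1 (\<mu> powr (1 - g)) + n powr (1 - pp / 16) * (1 + \<mu>))) \<and>
        gauss_level_geb.risk_sum M Z n \<rho> b\<^sub>0 \<theta> \<le> ennreal (K * (1 / bw n ^ 3 + n powr (1 + g) * \<mu> powr (1 - g))))"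
    using level_bounds[where 'w='w, OF cC(1-3) b0 pp gk(1,2)] by blast
  obtain G where G: "\<And>N. N \<ge> 1 \<Longrightarrow> summable (\<lambda>j. peak e (2 ^ j / N)) \<and> (\<Sum>j. peak e (2 ^ j / N)) \<le> G"
    using sum_peak_bounded[OF gk(5)] by blast
  define low where "low i = (if int i - 1 < j_star n\<^sub>s then 8 * real (level_size (int i - 1)) else 0)" for i :: nat
  have low0: "low i \<ge> 0" for i by (simp add: low_def)
  have low_sum: "summable low"
    by (rule summable_finite[of "{..nat (j_star n\<^sub>s + 1)}"]) (auto simp: low_def)
  have u_sum: "summable (\<lambda>i. real i powr (- 3/2))" by (subst summable_real_powr_iff) simp
  \<comment> \<open>Total of the contributions that do not grow with \<open>N\<close>: the levels
    below \<open>j_star n\<^sub>s\<close> and the terms \<open>1 / bw n ^ 3\<close>. It disappears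
    on division by \<open>N\<close>.\<close>
  define W where "W = (\<Sum>i. low i) + K * (4 * (\<Sum>i. real i powr (- 3/2)))"
  \<comment> \<open>The factor allowed for the middle levels: their main contribution, after
    scaling, is \<open>K * \<bar>G\<bar> * D powr t\<close>, which is to be at most
    \<open>\<tau> / 4\<close>.\<close>
  define D where "D = min 1 ((\<tau> / (4 * K * (\<bar>G\<bar> + 1))) powr (1 / t))"
  have D: "0 < D" "D \<le> 1" using \<tau> K by (auto simp: D_def)
  have Dt: "K * \<bar>G\<bar> * D powr t \<le> \<tau> / 4"
  proof -
    have "D powr t \<le> ((\<tau> / (4 * K * (\<bar>G\<bar> + 1))) powr (1 / t)) powr t" using D gk by (intro powr_mono2) (auto simp: D_def)
    also have "\<dots> = \<tau> / (4 * K * (\<bar>G\<bar> + 1))" using gk \<tau> K by (simp add: powr_powr)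
    finally have "K * (\<bar>G\<bar> + 1) * D powr t \<le> K * (\<bar>G\<bar> + 1) * (\<tau> / (4 * K * (\<bar>G\<bar> + 1)))" using K by (intro mult_left_mono) auto
    also have "\<dots> = \<tau> / 4"
    proof -
      have "X * (\<tau> / (4 * X)) = \<tau> / 4" if "X \<noteq> 0" for X using that by simp
      from this[of "K * (\<bar>G\<bar> + 1)"] show ?thesis using K by (simp only: mult.assoc) auto
    qed
    finally have "K * (\<bar>G\<bar> + 1) * D powr t \<le> \<tau> / 4" .
    moreover have "K * \<bar>G\<bar> * D powr t \<le> K * (\<bar>G\<bar> + 1) * D powr t" using K by (intro mult_right_mono mult_left_mono) auto
    ultimately show ?thesis by linarith
  qed
  \<comment> \<open>Solves \<open>(2 * d powr pp) powr (1 - g) = D\<close>; the factor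
    \<open>2\<close> is that of \<open>moment_le_scale\<close>.\<close>
  define d where "d = (D powr (1 / (1 - g)) / 2) powr (1 / pp)"
  have d: "d > 0" using D by (simp add: d_def)
  have d1: "2 * d powr pp = D powr (1 / (1 - g))" using D pp by (simp add: d_def powr_powr)
  have d2: "2 * d powr pp \<le> 1" unfolding d1 using D gk by (intro powr_le1) auto
  have d3: "(2 * d powr pp) powr (1 - g) = D" unfolding d1 using D gk by (simp add: powr_powr)
  obtain m where m: "\<And>\<beta> j. \<beta> \<in> B \<Longrightarrow> j \<ge> m \<Longrightarrow> block_norm \<alpha> p j \<beta> \<le> d" using tail[OF d] by blast
  define N where "N \<epsilon> = \<epsilon> powr (- 1 / ?A)" for \<epsilon> :: real
  have N_lim: "filterlim N at_top (at_right 0)"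
  proof -
    have "- 1 / ?A < 0" using \<alpha> by simp
    then show ?thesis unfolding N_def[abs_def] by real_asymp
  qed
  have ev: "\<forall>\<^sub>F N :: real in at_top. N \<ge> 1 \<and> 2 ^ m \<le> N powr (1/2) \<and> W / N < \<tau> / 4 \<and> 4 * K * \<bar>G\<bar> * N powr (- h) < \<tau> / 4"
  proof (intro eventually_conj)
    show "\<forall>\<^sub>F N in at_top. (1::real) \<le> N" by (rule eventually_ge_at_top)
    have "filterlim (\<lambda>N::real. N powr (1/2)) at_top at_top" by real_asymp
    then show "\<forall>\<^sub>F N :: real in at_top. 2 ^ m \<le> N powr (1/2)" by (simp add: filterlim_at_top)
    have "((\<lambda>N::real. W / N) \<longlongrightarrow> 0) at_top" by real_asymp
    then show "\<forall>\<^sub>F N in at_top. W / N < \<tau> / 4" using \<tau> by (intro order_tendstoD(2)) auto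
    have "((\<lambda>N::real. N powr (- h)) \<longlongrightarrow> 0) at_top" using gk by (intro tendsto_neg_powr filterlim_ident) auto
    then have "((\<lambda>N::real. 4 * K * \<bar>G\<bar> * N powr (- h)) \<longlongrightarrow> 4 * K * \<bar>G\<bar> * 0) at_top" by (intro tendsto_intros)
    then show "\<forall>\<^sub>F N in at_top. 4 * K * \<bar>G\<bar> * N powr (- h) < \<tau> / 4" using \<tau> by (intro order_tendstoD(2)) auto
  qed
  have "\<forall>\<^sub>F \<epsilon> in at_right 0. \<epsilon> > (0::real)" by (rule eventually_at_right_less)
  moreover have "\<forall>\<^sub>F \<epsilon> in at_right 0. N \<epsilon> \<ge> 1 \<and> 2 ^ m \<le> N \<epsilon> powr (1/2) \<and> W / N \<epsilon> < \<tau> / 4 \<and> 4 * K * \<bar>G\<bar> * N \<epsilon> powr (- h) < \<tau> / 4"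
    using eventually_compose_filterlim[OF ev N_lim] .
  ultimately show ?thesis
  proof eventually_elim
    case (elim \<epsilon>)
    then have \<epsilon>: "\<epsilon> > 0" and N1: "N \<epsilon> \<ge> 1" and Nm: "2 ^ m \<le> N \<epsilon> powr (1/2)"
      and NW: "W / N \<epsilon> < \<tau> / 4" and Nh: "4 * K * \<bar>G\<bar> * N \<epsilon> powr (- h) < \<tau> / 4" by auto
    define w where "w = D powr t + 4 * N \<epsilon> powr (- h)"
    have w: "w \<ge> 0" by (simp add: w_def)
    \<comment> \<open>Index \<open>i\<close> stands for level \<open>i - 1\<close>, so
      \<open>2 ^ i / (2 * N \<epsilon>)\<close> is the ratio \<open>x\<close> of that level.\<close>
    define U where "U i = low i + K * (4 * real i powr (- 3/2) + N \<epsilon> * (w * peak e (2 ^ i / (2 * N \<epsilon>))))" for i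
    have U0: "U i \<ge> 0" for i unfolding U_def using low0 K N1 w by (intro add_nonneg_nonneg mult_nonneg_nonneg) (auto simp: peak_nonneg)
    have pk: "summable (\<lambda>i. peak e (2 ^ i / (2 * N \<epsilon>)))" "(\<Sum>i. peak e (2 ^ i / (2 * N \<epsilon>))) \<le> G" using G[of "2 * N \<epsilon>"] N1 by auto
    have U_sum: "summable U" unfolding U_def by (intro summable_add summable_mult low_sum u_sum pk)
    have U_tot: "(\<Sum>i. U i) \<le> W + K * (N \<epsilon> * (w * \<bar>G\<bar>))"
    proof -
      have "(\<Sum>i. U i) = (\<Sum>i. low i) + K * (4 * (\<Sum>i. real i powr (- 3/2)) + N \<epsilon> * (w * (\<Sum>i. peak e (2 ^ i / (2 * N \<epsilon>)))))"
        unfolding U_def using low_sum u_sum pk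
        by (simp add: suminf_add[symmetric] suminf_mult summable_add summable_mult)
      also have "\<dots> \<le> (\<Sum>i. low i) + K * (4 * (\<Sum>i. real i powr (- 3/2)) + N \<epsilon> * (w * \<bar>G\<bar>))"
        using pk(2) K N1 w by (intro add_left_mono mult_left_mono) auto
      finally show ?thesis by (simp add: W_def distrib_left)
    qed
    show "\<forall>\<beta>\<in>B. ennreal (\<epsilon> powr (- 2 * \<alpha> / ?A)) * risk M z \<epsilon> (geb_estimator n\<^sub>s \<eta> \<rho>\<^sub>0 b\<^sub>0 \<epsilon>) \<beta> \<le> ennreal \<tau>"
    proof
      fix \<beta> assume \<beta>: "\<beta> \<in> B"
      let ?r = "\<lambda>j. \<Sum>k=1..level_size j. \<integral>\<^sup>+\<omega>. ennreal ((geb_estimator n\<^sub>s \<eta> \<rho>\<^sub>0 b\<^sub>0 \<epsilon> (observation z \<epsilon> \<beta> \<omega>) j k - \<beta> j k)\<^sup>2) \<partial>M"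
      have level: "?r (int i - 1) \<le> ennreal (\<epsilon>\<^sup>2 * U i)" for i
      proof (cases "int i - 1 < j_star n\<^sub>s")
        case True
        have "?r (int i - 1) \<le> ennreal (\<epsilon>\<^sup>2 * (8 * level_size (int i - 1)))"
          using True by (intro risk_low_level dist \<epsilon>) (auto simp: coef_index_def)
        also have "\<dots> \<le> ennreal (\<epsilon>\<^sup>2 * U i)"
          unfolding U_def low_def using True K N1 w
          by (intro ennreal_leI mult_left_mono) (auto simp: peak_nonneg)
        finally show ?thesis .
      next
        case False
        define J where "J = i - 1"
        have J: "int i - 1 = int J" "i = Suc J" "J \<ge> 1" using False js by (auto simp: J_def)
        have jj: "int J \<ge> j_star n\<^sub>s" using False J by simp
        define n where "n = level_size (int J)"
        have n: "n = 2 ^ J" by (simp add: n_def level_size_def)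
        interpret gauss_level_geb M "z (int J)" n "geb_rho \<eta> \<rho>\<^sub>0 n" c C b\<^sub>0 using geb[OF jj] by (simp add: n_def)
        let ?\<theta> = "\<lambda>k. \<beta> (int J) k / \<epsilon>"
        define x where "x = 2 ^ J / N \<epsilon>"
        have x: "x > 0" "x = 2 ^ i / (2 * N \<epsilon>)" "N \<epsilon> * x = n" using N1 J by (auto simp: x_def n)
        note bd = bounds[rule_format, OF gauss_level_geb_axioms, of ?\<theta>]
        define V where "V = 4 * real i powr (- 3/2) + N \<epsilon> * (w * peak e x)"
        have pkN: "0 \<le> N \<epsilon> * (r * peak e x)" if "r \<ge> 0" for r using N1 that by (auto simp: peak_nonneg)
        have rs: "risk_sum ?\<theta> \<le> ennreal (K * V)"
        proof (cases "x < N \<epsilon> powr (- k)")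
          case True
          have "n powr (1 + g) \<le> N \<epsilon> * (N \<epsilon> powr (- h) * peak e x)"
            using near[OF N1 x(1) True] unfolding x(3) .
          also have "\<dots> \<le> N \<epsilon> * (w * peak e x)"
            using N1 by (intro mult_left_mono mult_right_mono) (auto simp: w_def peak_nonneg)
          also have "\<dots> \<le> V" by (simp add: V_def)
          finally have "K * n powr (1 + g) \<le> K * V" using K by (intro mult_left_mono) auto
          then show ?thesis using order_trans[OF conjunct1[OF bd] ennreal_leI] by blast
        next
          case notlow: False
          \<comment> \<open>Outside the near range \<open>2 ^ J\<close> is at least
            \<open>N \<epsilon> powr (1 - k)\<close>, hence by \<open>k \<le> 1/2\<close> at least
            \<open>N \<epsilon> powr (1/2)\<close>, which exceeds or equals \<open>2 ^ m\<close>.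
            The uniform bound \<open>d\<close> therefore holds at this level.\<close>
          have Jm: "J \<ge> m"
          proof -
            have "N \<epsilon> powr (1/2) \<le> N \<epsilon> powr (1 - k)" using N1 gk by (intro powr_mono) auto
            also have "\<dots> = N \<epsilon> * N \<epsilon> powr (- k)" using N1 by (simp add: powr_diff powr_minus divide_inverse)
            also have "\<dots> \<le> N \<epsilon> * x" using notlow N1 by (intro mult_left_mono) auto
            also have "\<dots> = 2 ^ J" using x(3) n by simp
            finally have "(2::real) ^ m \<le> 2 ^ J" using Nm by (rule order_trans[rotated])
            then show ?thesis by (simp only: power_increasing_iff)
          qed
          define \<mu> where "\<mu> = 2 * d powr pp * x powr (- s)"
          have \<mu>: "\<mu> > 0" using d x(1) by (simp add: \<mu>_def)
          have \<mu>2: "\<mu> \<le> 2 * x powr (- s)"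
            unfolding \<mu>_def using d2 by (intro mult_right_mono) auto
          have \<mu>g: "\<mu> powr (1 - g) = D * x powr (- (s * (1 - g)))"
            unfolding \<mu>_def using d3 by (simp add: powr_mult powr_powr)
          have mom: "(\<Sum>k=1..n. \<bar>?\<theta> k\<bar> powr pp) / n \<le> \<mu>"
            using moment_le_scale[OF p0 \<epsilon> _ m[OF \<beta> Jm]] \<alpha>
            unfolding pp_def[symmetric] N_def[symmetric] x_def[symmetric] s_def[symmetric] n \<mu>_def by simp
          note bd' = conjunct2[OF bd, rule_format, OF \<mu> mom]
          show ?thesis
          proof (cases "x \<le> N \<epsilon> powr k")
            case True
            have "n * min 1 (\<mu> powr (1 - g)) + n powr (1 - pp / 16) * (1 + \<mu>) \<le> N \<epsilon> * ((D powr t + 3 * N \<epsilon> powr (- h)) * peak e x)"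
              using middle[OF N1 x(1) _ True D _ \<mu>2] notlow \<mu> unfolding x(3) \<mu>g by simp
            also have "\<dots> \<le> N \<epsilon> * (w * peak e x)"
              using N1 by (intro mult_left_mono mult_right_mono) (auto simp: w_def peak_nonneg)
            also have "\<dots> \<le> V" by (simp add: V_def)
            finally have "K * (n * min 1 (\<mu> powr (1 - g)) + n powr (1 - pp / 16) * (1 + \<mu>)) \<le> K * V"
              using K by (intro mult_left_mono) auto
            then show ?thesis using order_trans[OF conjunct1[OF bd'] ennreal_leI] by blast
          next
            case False
            have "n powr (1 + g) * \<mu> powr (1 - g) \<le> N \<epsilon> * (N \<epsilon> powr (- h) * peak e x)"
              using far[OF N1 x(1) _ D] False unfolding x(3) \<mu>g by simp
            also have "\<dots> \<le> N \<epsilon> * (w * peak e x)"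
              using N1 by (intro mult_left_mono mult_right_mono) (auto simp: w_def peak_nonneg)
            finally have "1 / L ^ 3 + n powr (1 + g) * \<mu> powr (1 - g) \<le> V"
              using inverse_bw_cube[OF J(3)] unfolding V_def n J(2) by linarith
            then have "K * (1 / L ^ 3 + n powr (1 + g) * \<mu> powr (1 - g)) \<le> K * V"
              using K by (intro mult_left_mono) auto
            then show ?thesis using order_trans[OF conjunct2[OF bd'] ennreal_leI] by blast
          qed
        qed
        have KV: "K * V \<le> U i" unfolding U_def V_def x(2) using low0 by simp
        have "?r (int i - 1) = ennreal (\<epsilon>\<^sup>2) * risk_sum ?\<theta>"
          unfolding J(1) by (rule risk_level_eq[OF refl n_def jj \<epsilon>]) simp
        also have "\<dots> \<le> ennreal (\<epsilon>\<^sup>2) * ennreal (U i)"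
          using rs KV by (intro mult_left_mono order_trans[OF rs ennreal_leI]) auto
        also have "\<dots> = ennreal (\<epsilon>\<^sup>2 * U i)" using U0 by (simp add: ennreal_mult)
        finally show ?thesis .
      qed
      have "risk M z \<epsilon> (geb_estimator n\<^sub>s \<eta> \<rho>\<^sub>0 b\<^sub>0 \<epsilon>) \<beta> \<le> (\<Sum>i. ennreal (\<epsilon>\<^sup>2 * U i))"
        unfolding risk_def Let_def by (intro suminf_le level summableI)
      also have "\<dots> = ennreal (\<Sum>i. \<epsilon>\<^sup>2 * U i)"
        using U0 U_sum by (intro suminf_ennreal2 summable_mult) auto
      also have "\<dots> \<le> ennreal (\<epsilon>\<^sup>2 * (W + K * (N \<epsilon> * (w * \<bar>G\<bar>))))"
        using U_tot U_sum by (intro ennreal_leI) (simp add: suminf_mult mult_left_mono)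
      finally have "ennreal (\<epsilon> powr (- 2 * \<alpha> / ?A)) * risk M z \<epsilon> (geb_estimator n\<^sub>s \<eta> \<rho>\<^sub>0 b\<^sub>0 \<epsilon>) \<beta> \<le>
        ennreal (\<epsilon> powr (- 2 * \<alpha> / ?A)) * ennreal (\<epsilon>\<^sup>2 * (W + K * (N \<epsilon> * (w * \<bar>G\<bar>))))"
        by (intro mult_left_mono) auto
      also have "\<dots> = ennreal (\<epsilon> powr (- 2 * \<alpha> / ?A) * (\<epsilon>\<^sup>2 * (W + K * (N \<epsilon> * (w * \<bar>G\<bar>)))))"
        by (subst ennreal_mult') auto
      also have "\<dots> \<le> ennreal \<tau>"
      proof (intro ennreal_leI)
        \<comment> \<open>The normalising factor times the noise variance is exactly
          \<open>1 / N \<epsilon>\<close>.\<close>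
        have "\<epsilon> powr (- 2 * \<alpha> / ?A) * \<epsilon>\<^sup>2 = \<epsilon> powr (- 2 * \<alpha> / ?A) * \<epsilon> powr 2" using \<epsilon> by (simp add: powr_numeral)
        also have "\<dots> = \<epsilon> powr (- 2 * \<alpha> / ?A + 2)" by (rule powr_add[symmetric])
        also have "- 2 * \<alpha> / ?A + 2 = 1 / ?A" using \<alpha> by (simp add: field_simps)
        also have "\<epsilon> powr (1 / ?A) = 1 / N \<epsilon>" unfolding N_def by (simp add: powr_minus_divide)
        finally have sc: "\<epsilon> powr (- 2 * \<alpha> / ?A) * \<epsilon>\<^sup>2 = 1 / N \<epsilon>" .
        have "\<epsilon> powr (- 2 * \<alpha> / ?A) * (\<epsilon>\<^sup>2 * (W + K * (N \<epsilon> * (w * \<bar>G\<bar>)))) = 1 / N \<epsilon> * (W + K * (N \<epsilon> * (w * \<bar>G\<bar>)))"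
          unfolding sc[symmetric] by (simp add: mult.assoc)
        also have "\<dots> = W / N \<epsilon> + (K * \<bar>G\<bar> * D powr t + 4 * K * \<bar>G\<bar> * N \<epsilon> powr (- h))"
          using N1 by (simp add: w_def field_simps)
        also have "\<dots> \<le> \<tau>" using NW Nh Dt \<tau> by linarith
        finally show "\<epsilon> powr (- 2 * \<alpha> / ?A) * (\<epsilon>\<^sup>2 * (W + K * (N \<epsilon> * (w * \<bar>G\<bar>)))) \<le> \<tau>" .
      qed
      finally show "ennreal (\<epsilon> powr (- 2 * \<alpha> / ?A)) * risk M z \<epsilon> (geb_estimator n\<^sub>s \<eta> \<rho>\<^sub>0 b\<^sub>0 \<epsilon>) \<beta> \<le> ennreal \<tau>" .
    qed
  qed
qed

lemma tendsto_0_ennrealI: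
  fixes f :: "'a \<Rightarrow> ennreal"
  assumes "\<And>\<tau>::real. \<tau> > 0 \<Longrightarrow> \<forall>\<^sub>F x in F. f x \<le> ennreal \<tau>"
  shows "(f \<longlongrightarrow> 0) F"
proof (rule order_tendstoI)
  fix a :: ennreal assume "0 < a"
  then obtain b where b: "0 < b" "b < a" using dense by blast
  then obtain \<tau> where \<tau>: "b = ennreal \<tau>" "\<tau> \<ge> 0" by (cases b) auto
  then have "\<tau> > 0" using b(1) by simp
  from assms[OF this] show "\<forall>\<^sub>F x in F. f x < a" by (rule eventually_mono) (use b \<tau> in auto)
qed simp

theorem theorem3p5:
  fixes M :: "'w measure"
    and z :: "int \<Rightarrow> nat \<Rightarrow> 'w \<Rightarrow> real"
    and n\<^sub>s \<rho>\<^sub>0 b\<^sub>0 \<alpha> q :: real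
    and \<eta> :: "nat \<Rightarrow> real"
    and p :: ereal
  assumes "prob_space M"
    and "prob_space.indep_vars M (\<lambda>_. borel) (\<lambda>(j, k). z j k) coef_index"
    and "\<And>j k. (j, k) \<in> coef_index \<Longrightarrow> distributed M lborel (z j k) std_normal_density"
    and "n\<^sub>s > 2" and "\<rho>\<^sub>0 > 0" and "b\<^sub>0 > 0"
    and "\<eta> \<longlonglongrightarrow> 0"
    and "\<And>j. j \<ge> j_star n\<^sub>s \<Longrightarrow> geb_rho \<eta> \<rho>\<^sub>0 (level_size j) > 0"
    and "\<alpha> > 0" and "ereal (1 / (\<alpha> + 1/2)) < p" and "p \<le> \<infinity>" and "q > 0"
  shows "(\<forall>\<beta>\<in>besov_space \<alpha> p q.
            ((\<lambda>\<epsilon>. ennreal (\<epsilon> powr (- 2 * \<alpha> / (\<alpha> + 1/2))) *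
                   risk M z \<epsilon> (geb_estimator n\<^sub>s \<eta> \<rho>\<^sub>0 b\<^sub>0 \<epsilon>) \<beta>) \<longlongrightarrow> 0) (at_right 0))
       \<and> (\<forall>B. compactin (besov_topology \<alpha> p q) B \<longrightarrow>
            ((\<lambda>\<epsilon>. ennreal (\<epsilon> powr (- 2 * \<alpha> / (\<alpha> + 1/2))) *
                   (SUP \<beta>\<in>B. risk M z \<epsilon> (geb_estimator n\<^sub>s \<eta> \<rho>\<^sub>0 b\<^sub>0 \<epsilon>) \<beta>)) \<longlongrightarrow> 0) (at_right 0))"
proof -
  have "0 < ereal (1 / (\<alpha> + 1/2))" using assms(9) by simp
  then have p: "p > 0" using assms(10) by (rule less_trans)
  have small: "\<forall>\<^sub>F \<epsilon> in at_right 0. \<forall>\<beta>\<in>B. ennreal (\<epsilon> powr (- 2 * \<alpha> / (\<alpha> + 1/2))) *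
      risk M z \<epsilon> (geb_estimator n\<^sub>s \<eta> \<rho>\<^sub>0 b\<^sub>0 \<epsilon>) \<beta> \<le> ennreal \<tau>"
    if "\<And>d. d > 0 \<Longrightarrow> \<exists>m. \<forall>\<beta>\<in>B. \<forall>j\<ge>m. block_norm \<alpha> p j \<beta> \<le> d" "\<tau> > 0" for B and \<tau> :: real
    by (rule risk_eventually_small[OF assms(1,2) _ assms(4-7) _ assms(9,10)]) (use assms(3,8) that in auto)
  show ?thesis
  proof (intro conjI ballI allI impI tendsto_0_ennrealI)
    fix \<beta> and \<tau> :: real assume \<beta>: "\<beta> \<in> besov_space \<alpha> p q" and \<tau>: "\<tau> > 0"
    have "\<exists>m. \<forall>\<beta>'\<in>{\<beta>}. \<forall>j\<ge>m. block_norm \<alpha> p j \<beta>' \<le> d" if "d > 0" for d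
    proof -
      have "(\<lambda>j. block_norm \<alpha> p j \<beta>) \<longlonglongrightarrow> 0"
        using \<beta> assms(12) by (intro block_norm_tendsto_0) (auto simp: besov_space_def)
      then have "\<forall>\<^sub>F j in sequentially. block_norm \<alpha> p j \<beta> < d" using that by (intro order_tendstoD) auto
      then show ?thesis by (auto simp: eventually_sequentially intro: less_imp_le)
    qed
    from small[where B="{\<beta>}" and \<tau>=\<tau>, OF this \<tau>] show "\<forall>\<^sub>F \<epsilon> in at_right 0. ennreal (\<epsilon> powr (- 2 * \<alpha> / (\<alpha> + 1/2))) *
        risk M z \<epsilon> (geb_estimator n\<^sub>s \<eta> \<rho>\<^sub>0 b\<^sub>0 \<epsilon>) \<beta> \<le> ennreal \<tau>" by simp
  next
    fix B and \<tau> :: real assume B: "compactin (besov_topology \<alpha> p q) B" and \<tau>: "\<tau> > 0"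
    have "\<forall>\<^sub>F \<epsilon> in at_right 0. \<forall>\<beta>\<in>B. ennreal (\<epsilon> powr (- 2 * \<alpha> / (\<alpha> + 1/2))) *
        risk M z \<epsilon> (geb_estimator n\<^sub>s \<eta> \<rho>\<^sub>0 b\<^sub>0 \<epsilon>) \<beta> \<le> ennreal \<tau>"
      by (intro small compact_tail_small[OF p assms(12) B] \<tau>)
    \<comment> \<open>The bound holds for all \<beta> in \<open>B\<close> at the same \<epsilon>,
      and multiplication by a constant commutes with the supremum in \<open>ennreal\<close>.\<close>
    then show "\<forall>\<^sub>F \<epsilon> in at_right 0. ennreal (\<epsilon> powr (- 2 * \<alpha> / (\<alpha> + 1/2))) *
        (SUP \<beta>\<in>B. risk M z \<epsilon> (geb_estimator n\<^sub>s \<eta> \<rho>\<^sub>0 b\<^sub>0 \<epsilon>) \<beta>) \<le> ennreal \<tau>"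
      by eventually_elim (auto simp: SUP_mult_left_ennreal intro!: SUP_least)
  qed
qed

end
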